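(* Let $n\ge1$. Every closed subspace of $\mathfrak Z_n$ that is isomorphic to $\mathfrak Z_n$ is complemented in $\mathfrak Z_n$.
   Context: Let $\mathbb S=\{z\in\mathbb C:0<\mathrm{Re}\,z<1\}$ and let $\mathcal C$ be the Calderón space of the pair $(\ell_\infty,\ell_1)$: bounded continuous functions $f:\overline{\mathbb S}\to\ell_\infty$, holomorphic on $\mathbb S$, with $f(1+it)\in\ell_1$ for all real $t$ and $\|f\|_{\mathcal C}=\max(\sup_t\|f(it)\|_\infty,\sup_t\|f(1+it)\|_1)<\infty$. For $n\ge1$ the Rochberg space $\mathfrak Z_n$ is the space of arrays $(x_{n-1},\dots,x_0)\in\ell_\infty^n$ for which there is $f\in\mathcal C$ with $x_j=f^{(j)}(1/2)/j!$ for $0\le j\le n-1$, normed by the infimum of $\|f\|_{\mathcal C}$ over such $f$. *)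

theory Defs
  imports "HOL-Analysis.Analysis"
begin

definition linf :: "(nat \<Rightarrow> complex) \<Rightarrow> bool" where
  "linf x \<longleftrightarrow> bounded (range (\<lambda>k. cmod (x k)))"

definition linf_norm :: "(nat \<Rightarrow> complex) \<Rightarrow> real" where
  "linf_norm x = (SUP k. cmod (x k))"

definition lone :: "(nat \<Rightarrow> complex) \<Rightarrow> bool" where
  "lone x \<longleftrightarrow> summable (\<lambda>k. cmod (x k))"

definition lone_norm :: "(nat \<Rightarrow> complex) \<Rightarrow> real" where
  "lone_norm x = (\<Sum>k. cmod (x k))"

definition strip :: "complex set" where
  "strip = {z. 0 < Re z \<and> Re z < 1}"

definition cstrip :: "complex set" where
  "cstrip = {z. 0 \<le> Re z \<and> Re z \<le> 1}"

(* Calderon space of (ell_infty, ell_1): f z k is the k-th coordinate of f(z). *)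
definition calderon :: "(complex \<Rightarrow> nat \<Rightarrow> complex) \<Rightarrow> bool" where
  "calderon f \<longleftrightarrow>
     (\<forall>z\<in>cstrip. linf (f z)) \<and>
     (\<exists>B. \<forall>z\<in>cstrip. linf_norm (f z) \<le> B) \<and>
     (\<forall>z\<in>cstrip. ((\<lambda>w. linf_norm (\<lambda>k. f w k - f z k)) \<longlongrightarrow> 0) (at z within cstrip)) \<and>
     (\<forall>z\<in>strip. \<exists>D. linf D \<and>
        ((\<lambda>w. linf_norm (\<lambda>k. (f w k - f z k) / (w - z) - D k)) \<longlongrightarrow> 0) (at z)) \<and>
     (\<forall>t::real. lone (f (1 + \<i> * complex_of_real t))) \<and>
     (\<exists>B. \<forall>t::real. lone_norm (f (1 + \<i> * complex_of_real t)) \<le> B)"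

definition calderon_norm :: "(complex \<Rightarrow> nat \<Rightarrow> complex) \<Rightarrow> real" where
  "calderon_norm f = max (SUP t::real. linf_norm (f (\<i> * complex_of_real t)))
                         (SUP t::real. lone_norm (f (1 + \<i> * complex_of_real t)))"

(* j-th Taylor coefficient f^(j)(1/2)/j! in ell_infty, computed coordinatewise *)
definition taylor_coeff :: "(complex \<Rightarrow> nat \<Rightarrow> complex) \<Rightarrow> nat \<Rightarrow> nat \<Rightarrow> complex" where
  "taylor_coeff f j = (\<lambda>k. (deriv ^^ j) (\<lambda>z. f z k) (1/2) / of_nat (fact j))"

(* Elements of Z_n: x j = x_j for j < n, x j = 0 for j \<ge> n. *)
definition rochberg :: "nat \<Rightarrow> (nat \<Rightarrow> nat \<Rightarrow> complex) set" where
  "rochberg n = {x. (\<forall>j\<ge>n. x j = (\<lambda>k. 0)) \<and>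
      (\<exists>f. calderon f \<and> (\<forall>j<n. x j = taylor_coeff f j))}"

definition zn_norm :: "nat \<Rightarrow> (nat \<Rightarrow> nat \<Rightarrow> complex) \<Rightarrow> real" where
  "zn_norm n x = Inf {calderon_norm f | f. calderon f \<and> (\<forall>j<n. x j = taylor_coeff f j)}"

definition zadd :: "(nat \<Rightarrow> nat \<Rightarrow> complex) \<Rightarrow> (nat \<Rightarrow> nat \<Rightarrow> complex) \<Rightarrow> nat \<Rightarrow> nat \<Rightarrow> complex" where
  "zadd x y = (\<lambda>j k. x j k + y j k)"

definition zdiff :: "(nat \<Rightarrow> nat \<Rightarrow> complex) \<Rightarrow> (nat \<Rightarrow> nat \<Rightarrow> complex) \<Rightarrow> nat \<Rightarrow> nat \<Rightarrow> complex" where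
  "zdiff x y = (\<lambda>j k. x j k - y j k)"

definition zscale :: "complex \<Rightarrow> (nat \<Rightarrow> nat \<Rightarrow> complex) \<Rightarrow> nat \<Rightarrow> nat \<Rightarrow> complex" where
  "zscale c x = (\<lambda>j k. c * x j k)"

definition closed_subspace_Z :: "nat \<Rightarrow> (nat \<Rightarrow> nat \<Rightarrow> complex) set \<Rightarrow> bool" where
  "closed_subspace_Z n Y \<longleftrightarrow> Y \<subseteq> rochberg n \<and> (\<lambda>j k. 0) \<in> Y \<and>
     (\<forall>x\<in>Y. \<forall>y\<in>Y. zadd x y \<in> Y) \<and> (\<forall>c. \<forall>x\<in>Y. zscale c x \<in> Y) \<and>
     (\<forall>s x. (\<forall>m. s m \<in> Y) \<and> x \<in> rochberg n \<and>
            ((\<lambda>m. zn_norm n (zdiff (s m) x)) \<longlonglongrightarrow> 0) \<longrightarrow> x \<in> Y)"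

definition zlinear :: "nat \<Rightarrow> ((nat \<Rightarrow> nat \<Rightarrow> complex) \<Rightarrow> (nat \<Rightarrow> nat \<Rightarrow> complex)) \<Rightarrow> bool" where
  "zlinear n T \<longleftrightarrow> (\<forall>x\<in>rochberg n. \<forall>y\<in>rochberg n. T (zadd x y) = zadd (T x) (T y)) \<and>
     (\<forall>c. \<forall>x\<in>rochberg n. T (zscale c x) = zscale c (T x))"

definition isomorphic_to_Z :: "nat \<Rightarrow> (nat \<Rightarrow> nat \<Rightarrow> complex) set \<Rightarrow> bool" where
  "isomorphic_to_Z n Y \<longleftrightarrow> (\<exists>T. zlinear n T \<and> T ` rochberg n = Y \<and>
     (\<exists>c C. 0 < c \<and> (\<forall>x\<in>rochberg n. c * zn_norm n x \<le> zn_norm n (T x) \<and>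
                                    zn_norm n (T x) \<le> C * zn_norm n x)))"

definition complemented_in_Z :: "nat \<Rightarrow> (nat \<Rightarrow> nat \<Rightarrow> complex) set \<Rightarrow> bool" where
  "complemented_in_Z n Y \<longleftrightarrow> (\<exists>P. zlinear n P \<and> P ` rochberg n \<subseteq> Y \<and>
     (\<forall>y\<in>Y. P y = y) \<and> (\<exists>C. \<forall>x\<in>rochberg n. zn_norm n (P x) \<le> C * zn_norm n x))"

end

theory Submission
  imports Defs "HOL-Complex_Analysis.Complex_Analysis" "HOL-Library.Function_Algebras"
begin

text \<open>Write \<open>E\<^sub>s = exp (s N)\<close>, where \<open>N\<close> is the shift \<open>x\<^sub>j \<mapsto> x\<^sub>j\<^sub>-\<^sub>1\<close>, i.e. multiplication of functions by \<open>z - 1/2\<close>;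
  \<open>E\<^sub>s\<close> is multiplication by \<open>exp (s (z - 1/2))\<close>. The sesquilinear pairing \<open>form x y = \<Sum>\<^sub>k \<Sum>\<^sub>i (-1)\<^sup>j x\<^sub>i(k) cnj y\<^sub>j(k)\<close>,
  \<open>i + j = n - 1\<close>, is bounded by the three lines theorem, is invariant under \<open>E\<^sub>s\<close>, and identifies the space with its
  own antidual. If \<open>x\<^sub>1, \<dots>, x\<^sub>M\<close> are disjointly supported unit vectors, then \<open>E\<^sub>s (x\<^sub>1 + \<dots> + x\<^sub>M)\<close> with
  \<open>s = - ln M\<close> has norm of order \<open>\<surd>M\<close>, from above by rescaling the representing functions and from below by
  duality. Hence for a bounded operator \<open>T\<close> the polynomial \<open>s \<mapsto> E\<^sub>-\<^sub>s T E\<^sub>s\<close> is bounded on far-out vectors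
  uniformly in \<open>s\<close>, so its linear coefficient \<open>T N - N T\<close> is small on far-out vectors.

  Let \<open>T\<close> be an isomorphic embedding with range \<open>Y\<close> and let \<open>T\<^sup>+\<close> be its adjoint for the pairing. Since \<open>T\<close>
  essentially commutes with \<open>N\<close>, the operator \<open>A = T\<^sup>+ T\<close> is essentially triangular for the filtration given by \<open>N\<close>, with
  the same positive definite operator on each quotient \<open>\<ell>\<^sub>2\<close>. Thus its compression to the vectors supported
  on \<open>{K..}\<close> is onto for large \<open>K\<close>, and by symmetry of the pairing one-to-one. Then \<open>T A\<^sup>-\<^sup>1 T\<^sup>+\<close> is a projection onto a
  subspace of finite codimension in \<open>Y\<close>, and the missing dimensions are added one at a time.\<close>

text \<open>For \<open>n \<ge> 2\<close> the pairing is far from definite: the image of the power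
  n-1 of \<open>N\<close> is isotropic. So \<open>A\<close> has no positivity as a whole and must be
  inverted level by level. What survives is the top level: for far-out x, the pairing of A x with
  N^(n-1) x is that of T x with T N^(n-1) x, which up to sign and a small commutator is the squared
  ell_2 norm of the zeroth coordinate of T x. As T is bounded below, this dominates the squared norm
  of the zeroth coordinate of x. The lower levels follow by applying powers of \<open>N\<close> to
  solutions found at the top. The sign in the pairing comes from the reflection z -> 1 - cnj z,
  which swaps the two boundary lines, so that an ell_infty bound meets an ell_1 bound on each of
  them; it makes \<open>N\<close> skew. The logarithm in s = - ln M is what forces the commutator to
  be small: replacing M by M^(2^i) multiplies s by 2^i without changing the bound on the conjugated
  operator, so the linear coefficient is at most a constant divided by ln M, for every M.\<close>

unbundle no vec_syntax

section \<open>Functions on the strip and their jets\<close>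

text \<open>The number \<open>B\<close> is an a priori bound, as the three lines theorem requires;
  the bounds that enter norms are those on the two boundary lines. In \<open>jet_rep\<close> it also
  measures the decay in the coordinate index.\<close>

definition strip_fun :: "(complex \<Rightarrow> complex) \<Rightarrow> real \<Rightarrow> bool" where
  "strip_fun h B \<longleftrightarrow> continuous_on cstrip h \<and> h holomorphic_on strip \<and> (\<forall>z\<in>cstrip. cmod (h z) \<le> B)"

lemma open_strip: "open strip"
proof -
  have "strip = {z. 0 < Re z} \<inter> {z. Re z < 1}" by (auto simp: strip_def)
  then show ?thesis by (metis open_Int open_halfspace_Re_gt open_halfspace_Re_lt)
qed

lemma strip_subset_cstrip: "strip \<subseteq> cstrip"
  by (auto simp: strip_def cstrip_def)

lemma half_in_strip: "1/2 \<in> strip" "1/2 \<in> cstrip"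
  by (auto simp: strip_def cstrip_def)

lemma strip_fun_bound_nonneg: "strip_fun h B \<Longrightarrow> 0 \<le> B"
  unfolding strip_fun_def using half_in_strip(2) norm_ge_zero order_trans by blast

lemma cmod_exp_square: "cmod (exp (of_real \<epsilon> * z^2)) = exp (\<epsilon> * ((Re z)^2 - (Im z)^2))"
  by (simp add: Re_power2)

text \<open>A Gaussian factor makes the function decay at both ends of the strip.\<close>
lemma three_lines:
  assumes h: "strip_fun h B" and left: "\<And>t::real. cmod (h (\<i> * t)) \<le> R"
    and right: "\<And>t::real. cmod (h (1 + \<i> * t)) \<le> R" and z: "z \<in> cstrip"
  shows "cmod (h z) \<le> R"
proof -
  have R0: "0 \<le> R" using left[of 0] norm_ge_zero order_trans by blast
  have B0: "0 \<le> B" using h by (rule strip_fun_bound_nonneg)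
  have main: "cmod (h z) \<le> exp \<epsilon> * R * exp (\<epsilon> * (Im z)^2)" if "\<epsilon> > 0" for \<epsilon> :: real
  proof -
    define H where "H = (\<lambda>w. h w * exp (of_real \<epsilon> * w^2))"
    \<comment> \<open>On the horizontal sides of a rectangle of height \<open>Y\<close> the Gaussian
      factor is at most \<open>exp (\<epsilon> * (1 - Y^2))\<close>, so a tall rectangle makes them
      negligible.\<close>
    have ev: "eventually (\<lambda>Y::real. B * exp (\<epsilon> * (1 - Y^2)) < \<delta>) at_top" if "\<delta> > 0" for \<delta>
    proof -
      have "filterlim (\<lambda>Y::real. -1 + Y^2) at_top at_top"
        by (intro filterlim_tendsto_add_at_top[OF tendsto_const] filterlim_pow_at_top filterlim_ident) auto
      then have "filterlim (\<lambda>Y::real. \<epsilon> * (-1 + Y^2)) at_top at_top"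
        using \<open>\<epsilon> > 0\<close> by (intro filterlim_tendsto_pos_mult_at_top[OF tendsto_const]) auto
      then have "filterlim (\<lambda>Y::real. - (\<epsilon> * (-1 + Y^2))) at_bot at_top"
        by (simp add: filterlim_uminus_at_top)
      then have "((\<lambda>Y::real. exp (- (\<epsilon> * (-1 + Y^2)))) \<longlongrightarrow> 0) at_top"
        by (rule filterlim_compose[OF exp_at_bot])
      then have "((\<lambda>Y::real. B * exp (- (\<epsilon> * (-1 + Y^2)))) \<longlongrightarrow> B * 0) at_top"
        by (intro tendsto_intros)
      then have "((\<lambda>Y::real. B * exp (\<epsilon> * (1 - Y^2))) \<longlongrightarrow> 0) at_top"
        by (simp add: algebra_simps)
      then show ?thesis using that by (auto dest!: order_tendstoD(2))
    qed
    have H_le: "cmod (H z) \<le> exp \<epsilon> * R + \<delta>" if "\<delta> > 0" for \<delta>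
    proof -
      obtain Y where Y: "B * exp (\<epsilon> * (1 - Y^2)) < \<delta>" "Y > \<bar>Im z\<bar>" "Y > 0"
        using eventually_happens'[OF trivial_limit_at_top_linorder
          eventually_conj[OF ev[OF \<open>\<delta> > 0\<close>]
            eventually_conj[OF eventually_gt_at_top[of "\<bar>Im z\<bar>"] eventually_gt_at_top[of 0]]]] by blast
      define S where "S = cbox (Complex 0 (-Y)) (Complex 1 Y)"
      have S: "w \<in> S \<longleftrightarrow> 0 \<le> Re w \<and> Re w \<le> 1 \<and> - Y \<le> Im w \<and> Im w \<le> Y" for w
        by (simp add: S_def in_cbox_complex_iff)
      have iS: "interior S = box (Complex 0 (-Y)) (Complex 1 Y)"
        by (simp add: S_def interior_cbox)
      have iS': "w \<in> interior S \<longleftrightarrow> 0 < Re w \<and> Re w < 1 \<and> - Y < Im w \<and> Im w < Y" for w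
        by (simp add: iS in_box_complex_iff)
      have cS: "closure S = S" by (simp add: S_def closure_closed)
      have "cmod (H z) \<le> exp \<epsilon> * R + \<delta>"
      proof (rule maximum_modulus_frontier[where f = H and S = S and \<xi> = z])
        show "H holomorphic_on interior S"
          unfolding H_def using h
          by (intro holomorphic_intros)
             (auto simp: strip_fun_def strip_def iS' intro: holomorphic_on_subset)
        show "continuous_on (closure S) H"
          unfolding H_def cS using h
          by (intro continuous_intros) (auto simp: strip_fun_def cstrip_def S intro: continuous_on_subset)
        show "bounded S" by (simp add: S_def)
        show "z \<in> S" using z Y(2) by (auto simp: S cstrip_def)
        fix w assume "w \<in> frontier S"
        then have wS: "w \<in> S" and nw: "w \<notin> interior S" by (auto simp: frontier_def cS)
        then have c: "0 \<le> Re w" "Re w \<le> 1" and wc: "w \<in> cstrip" by (auto simp: S cstrip_def)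
        have sq: "(Re w)^2 \<le> 1" using c by (simp add: power_le_one)
        have eH: "cmod (H w) = cmod (h w) * exp (\<epsilon> * ((Re w)^2 - (Im w)^2))"
          unfolding H_def norm_mult cmod_exp_square ..
        have "\<epsilon> * ((Re w)^2 - (Im w)^2) \<le> \<epsilon> * 1"
          using \<open>\<epsilon> > 0\<close> sq zero_le_power2[of "Im w"] by (intro mult_left_mono) linarith+
        then have ex: "exp (\<epsilon> * ((Re w)^2 - (Im w)^2)) \<le> exp \<epsilon>" by simp
        from wS nw consider "Re w = 0" | "Re w = 1" | "\<bar>Im w\<bar> = Y"
          using Y(3) unfolding S iS' by linarith
        then show "cmod (H w) \<le> exp \<epsilon> * R + \<delta>"
        proof cases
          case 3
          have "(Im w)^2 = Y^2" using 3 by (metis power2_abs)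
          then have "cmod (H w) \<le> B * exp (\<epsilon> * (1 - Y^2))"
            unfolding eH using h wc \<open>\<epsilon> > 0\<close> sq B0 by (intro mult_mono) (auto simp: strip_fun_def)
          moreover have "0 \<le> exp \<epsilon> * R" using R0 by simp
          ultimately show ?thesis using Y(1) by linarith
        next
          case 1
          then have w: "w = \<i> * of_real (Im w)" by (simp add: complex_eq_iff)
          have "cmod (H w) \<le> R * exp \<epsilon>" unfolding eH
            using left[of "Im w"] w R0 ex by (intro mult_mono) auto
          then show ?thesis using \<open>\<delta> > 0\<close> by (simp add: mult.commute)
        next
          case 2
          then have w: "w = 1 + \<i> * of_real (Im w)" by (simp add: complex_eq_iff)
          have "cmod (H w) \<le> R * exp \<epsilon>" unfolding eH
            using right[of "Im w"] w R0 ex by (intro mult_mono) auto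
          then show ?thesis using \<open>\<delta> > 0\<close> by (simp add: mult.commute)
        qed
      qed
      then show ?thesis .
    qed
    have Hz: "cmod (H z) \<le> exp \<epsilon> * R" using H_le by (rule field_le_epsilon)
    have "cmod (h z) * exp (\<epsilon> * ((Re z)^2 - (Im z)^2)) \<le> exp \<epsilon> * R"
      using Hz unfolding H_def norm_mult cmod_exp_square .
    moreover have "exp (- \<epsilon> * (Im z)^2) \<le> exp (\<epsilon> * ((Re z)^2 - (Im z)^2))"
      using \<open>\<epsilon> > 0\<close> by (simp add: algebra_simps)
    ultimately have "cmod (h z) * exp (- \<epsilon> * (Im z)^2) \<le> exp \<epsilon> * R"
      by (meson mult_left_mono norm_ge_zero order_trans)
    then show ?thesis by (simp add: exp_minus field_simps)
  qed
  have "((\<lambda>\<epsilon>::real. exp \<epsilon> * R * exp (\<epsilon> * (Im z)^2)) \<longlongrightarrow> exp 0 * R * exp (0 * (Im z)^2)) (at_right 0)"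
    by (intro tendsto_intros)
  then have lim: "((\<lambda>\<epsilon>::real. exp \<epsilon> * R * exp (\<epsilon> * (Im z)^2)) \<longlongrightarrow> R) (at_right 0)" by simp
  show ?thesis
  proof (rule tendsto_lowerbound[OF lim])
    show "\<forall>\<^sub>F \<epsilon> in at_right 0. cmod (h z) \<le> exp \<epsilon> * R * exp (\<epsilon> * (Im z)^2)"
      using eventually_at_right_less by (rule eventually_mono) (rule main)
  qed simp
qed

text \<open>Keeping the whole Taylor series turns products and reflections of functions into
  identities between formal power series; truncation enters only later, in
  \<open>act\<close>.\<close>

abbreviation jet :: "(complex \<Rightarrow> complex) \<Rightarrow> complex fps" where
  "jet h \<equiv> fps_expansion h (1/2)"

lemma jet_expansion:
  assumes "h holomorphic_on strip"
  shows "(\<lambda>w. h (1/2 + w)) has_fps_expansion jet h"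
  using assms half_in_strip(1) open_strip analytic_at analytic_at_imp_has_fps_expansion by blast

lemma jet_eqI:
  assumes "(\<lambda>w. h (1/2 + w)) has_fps_expansion F" "h holomorphic_on strip"
  shows "jet h = F"
  using assms jet_expansion fps_expansion_unique_complex by blast

lemma jet_add: "f holomorphic_on strip \<Longrightarrow> g holomorphic_on strip \<Longrightarrow> jet (\<lambda>z. f z + g z) = jet f + jet g"
  by (rule jet_eqI) (auto intro!: has_fps_expansion_add jet_expansion holomorphic_intros)

lemma jet_mult: "f holomorphic_on strip \<Longrightarrow> g holomorphic_on strip \<Longrightarrow> jet (\<lambda>z. f z * g z) = jet f * jet g"
  by (rule jet_eqI) (auto intro!: has_fps_expansion_mult jet_expansion holomorphic_intros)

lemma jet_const: "jet (\<lambda>z. c) = fps_const c"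
  by (rule jet_eqI) (auto intro!: fps_expansion_intros holomorphic_intros)

lemma jet_sum: "(\<And>i. i \<in> I \<Longrightarrow> f i holomorphic_on strip) \<Longrightarrow> jet (\<lambda>z. \<Sum>i\<in>I. f i z) = (\<Sum>i\<in>I. jet (f i))"
  by (rule jet_eqI) (auto intro!: has_fps_expansion_sum jet_expansion holomorphic_intros)

lemma jet_exp: "jet (\<lambda>z. exp (s * (z - 1/2))) = fps_exp s"
proof (rule jet_eqI)
  show "(\<lambda>w. exp (s * (1/2 + w - 1/2))) has_fps_expansion fps_exp s"
    using has_fps_expansion_exp[of s] by simp
qed (auto intro!: holomorphic_intros)

text \<open>Taylor series at 1/2 of the reflected function \<open>strip_refl g\<close>: with z = 1/2
  + w the reflection sends w to - cnj w, which produces the signs.\<close>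

definition fps_refl :: "complex fps \<Rightarrow> complex fps" where
  "fps_refl F = Abs_fps (\<lambda>j. (-1)^j * cnj (fps_nth F j))"

lemma fps_refl_nth [simp]: "fps_nth (fps_refl F) j = (-1)^j * cnj (fps_nth F j)"
  by (simp add: fps_refl_def)

lemma fps_refl_mult: "fps_refl (F * G) = fps_refl F * fps_refl G"
proof (rule fps_ext)
  fix j
  have "(-1)^j * cnj (F $ i * G $ (j - i)) = ((-1)^i * cnj (F $ i)) * ((-1)^(j-i) * cnj (G $ (j - i)))"
    if "i \<le> j" for i
  proof -
    have "(-1::complex)^j = (-1)^i * (-1)^(j-i)" using that by (simp flip: power_add)
    then show ?thesis by simp
  qed
  then show "fps_refl (F * G) $ j = (fps_refl F * fps_refl G) $ j"
    unfolding fps_mult_nth fps_refl_nth sum_distrib_left cnj_sum by (intro sum.cong) auto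
qed

lemma fps_refl_refl [simp]: "fps_refl (fps_refl F) = F"
  by (rule fps_ext) (simp flip: mult.assoc power_mult_distrib)

text \<open>Reflection in the line Re z = 1/2, conjugated so as to stay holomorphic. It interchanges
  the two boundary lines, so in a product of f with a reflected g the sup bound of one factor meets
  the ell_1 bound of the other on each line.\<close>

definition strip_refl :: "(complex \<Rightarrow> complex) \<Rightarrow> complex \<Rightarrow> complex" where
  "strip_refl g z = cnj (g (1 - cnj z))"

lemma strip_fun_refl:
  assumes "strip_fun g B" shows "strip_fun (strip_refl g) B"
proof -
  have cs: "(\<lambda>z. 1 - cnj z) ` cstrip \<subseteq> cstrip" by (auto simp: cstrip_def)
  have "continuous_on cstrip (\<lambda>z. cnj (g (1 - cnj z)))"
  proof -
    have "continuous_on cstrip (\<lambda>z. g (1 - cnj z))"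
      using assms by (intro continuous_on_compose2[OF _ _ cs, where g=g] continuous_intros) (simp add: strip_fun_def)
    then show ?thesis by (rule continuous_on_cnj)
  qed
  moreover have "(\<lambda>z. cnj (g (1 - cnj z))) holomorphic_on strip"
  proof -
    have "(\<lambda>w. g (1 - w)) holomorphic_on strip"
    proof -
      have "g \<circ> (\<lambda>w. 1 - w) holomorphic_on strip"
        using assms by (intro holomorphic_on_compose_gen[where t=strip] holomorphic_intros)
          (auto simp: strip_fun_def strip_def)
      then show ?thesis by (simp add: o_def)
    qed
    moreover have "cnj ` strip \<subseteq> strip"
      by (auto simp: strip_def)
    ultimately have "(\<lambda>w. g (1 - w)) holomorphic_on cnj ` strip" by (rule holomorphic_on_subset)
    from holomorphic_on_compose_cnj_cnj[OF this open_strip]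
    show ?thesis by (simp add: o_def)
  qed
  moreover have "cmod (cnj (g (1 - cnj z))) \<le> B" if "z \<in> cstrip" for z
    using assms that cs by (auto simp: strip_fun_def)
  ultimately show ?thesis unfolding strip_fun_def strip_refl_def[abs_def] by blast
qed

text \<open>On the disc of radius 1/2 the series of \<open>g\<close> converges at - cnj w, and
  conjugating it term by term gives the series claimed.\<close>

lemma jet_refl:
  assumes "strip_fun g B" shows "jet (strip_refl g) = fps_refl (jet g)"
proof (rule jet_eqI)
  show "strip_refl g holomorphic_on strip" using strip_fun_refl[OF assms] by (simp add: strip_fun_def)
  have hol: "g holomorphic_on strip" using assms by (simp add: strip_fun_def)
  have b: "1/2 + w \<in> strip" if "w \<in> ball 0 (1/2)" for w
  proof -
    have "\<bar>Re w\<bar> < 1/2" using that abs_Re_le_cmod[of w] by simp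
    then have "0 < 1/2 + Re w \<and> 1/2 + Re w < 1" unfolding abs_less_iff by linarith
    then show ?thesis by (simp add: strip_def)
  qed
  have hol2: "(\<lambda>w. g (1/2 + w)) holomorphic_on eball 0 (ereal (1/2))"
  proof -
    have "g \<circ> (\<lambda>w. 1/2 + w) holomorphic_on ball 0 (1/2)"
      proof (rule holomorphic_on_compose_gen[OF _ hol])
      show "(\<lambda>w. 1/2 + w) holomorphic_on ball 0 (1/2)" by (intro holomorphic_intros)
    qed (use b in blast)
    then show ?thesis by (simp add: o_def del: ereal_divide)
  qed
  show "(\<lambda>w. strip_refl g (1/2 + w)) has_fps_expansion fps_refl (jet g)"
  proof (rule has_fps_expansionI)
    have "eventually (\<lambda>w::complex. w \<in> ball 0 (1/2)) (nhds 0)"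
      by (intro eventually_nhds_in_open) auto
    then show "\<forall>\<^sub>F w in nhds 0. (\<lambda>n. fps_refl (jet g) $ n * w ^ n) sums strip_refl g (1 / 2 + w)"
    proof eventually_elim
      case (elim w)
      have "(\<lambda>j. jet g $ j * (- cnj w) ^ j) sums g (1/2 + (- cnj w))"
        using elim by (intro has_fps_expansion_imp_sums_complex[OF jet_expansion[OF hol] hol2])
          (simp del: ereal_divide)
      then have "(\<lambda>j. cnj (jet g $ j * (- cnj w) ^ j)) sums cnj (g (1/2 + (- cnj w)))"
        by (simp only: sums_cnj)
      moreover have "cnj (jet g $ j * (- cnj w) ^ j) = fps_refl (jet g) $ j * w ^ j" for j
        by (simp add: power_minus[of w j])
      moreover have "cnj (g (1/2 + (- cnj w))) = strip_refl g (1/2 + w)"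
        by (simp add: strip_refl_def)
      ultimately show ?case by (simp only:)
    qed
  qed
qed

lemma cball_half_subset_cstrip: "cball (1/2) (1/2) \<subseteq> cstrip" and ball_half_subset_strip: "ball (1/2) (1/2) \<subseteq> strip"
proof -
  have *: "\<bar>1/2 - Re z\<bar> \<le> dist (1/2) z" for z using abs_Re_le_cmod[of "1/2 - z"] by (simp add: dist_norm)
  show "cball (1/2) (1/2) \<subseteq> cstrip"
  proof
    fix z :: complex assume "z \<in> cball (1/2) (1/2)"
    then have "\<bar>1/2 - Re z\<bar> \<le> 1/2" using *[of z] by simp
    then have "0 \<le> Re z \<and> Re z \<le> 1" unfolding abs_le_iff by linarith
    then show "z \<in> cstrip" by (simp add: cstrip_def)
  qed
  show "ball (1/2) (1/2) \<subseteq> strip"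
  proof
    fix z :: complex assume "z \<in> ball (1/2) (1/2)"
    then have "\<bar>1/2 - Re z\<bar> < 1/2" using *[of z] by simp
    then have "0 < Re z \<and> Re z < 1" unfolding abs_less_iff by linarith
    then show "z \<in> strip" by (simp add: strip_def)
  qed
qed

text \<open>Cauchy's estimate on the disc of radius 1/2, the largest one about 1/2 inside the closed
  strip. The factor \<open>2^(n-1)\<close> in the bound of the pairing comes from here.\<close>

lemma jet_bound:
  assumes "strip_fun h B" shows "cmod (jet h $ j) \<le> 2^j * B"
proof -
  have "cmod ((deriv ^^ j) h (1/2)) \<le> fact j * B / (1/2)^j"
  proof (rule Cauchy_inequality)
    show "h holomorphic_on ball (1/2) (1/2)" "continuous_on (cball (1/2) (1/2)) h"
      using assms ball_half_subset_strip cball_half_subset_cstrip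
      by (auto simp: strip_fun_def intro: holomorphic_on_subset continuous_on_subset)
    fix z :: complex assume "cmod (1/2 - z) = 1/2"
    then have "z \<in> cball (1/2) (1/2)" by (simp add: dist_norm)
    then show "cmod (h z) \<le> B" using assms cball_half_subset_cstrip by (auto simp: strip_fun_def)
  qed auto
  then show ?thesis by (simp add: fps_expansion_def norm_divide field_simps power_divide)
qed

lemma strip_fun_three_lines:
  assumes "strip_fun h B" "\<And>t::real. cmod (h (\<i> * t)) \<le> R" "\<And>t::real. cmod (h (1 + \<i> * t)) \<le> R"
  shows "strip_fun h R"
  using three_lines[OF assms] assms(1) by (auto simp: strip_fun_def)

lemma strip_fun_add: "strip_fun f A \<Longrightarrow> strip_fun g B \<Longrightarrow> strip_fun (\<lambda>z. f z + g z) (A + B)"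
  unfolding strip_fun_def by (auto intro!: continuous_intros holomorphic_intros norm_triangle_le add_mono)

lemma strip_fun_mult: "strip_fun f A \<Longrightarrow> strip_fun g B \<Longrightarrow> strip_fun (\<lambda>z. f z * g z) (A * B)"
  using strip_fun_bound_nonneg[of f A] unfolding strip_fun_def
  by (auto intro!: continuous_intros holomorphic_intros mult_mono simp: norm_mult)

lemma strip_fun_const: "strip_fun (\<lambda>z. c) (cmod c)"
  unfolding strip_fun_def by auto

lemma strip_fun_sum: "(\<And>i. i \<in> I \<Longrightarrow> strip_fun (f i) (A i)) \<Longrightarrow> strip_fun (\<lambda>z. \<Sum>i\<in>I. f i z) (\<Sum>i\<in>I. A i)"
  unfolding strip_fun_def by (auto intro!: continuous_intros holomorphic_intros sum_norm_le)

lemma strip_fun_exp: "strip_fun (\<lambda>z. exp (of_real s * (z - 1/2))) (exp (\<bar>s\<bar>/2))"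
proof -
  have "s * (Re z - 1/2) \<le> \<bar>s\<bar> / 2" if "z \<in> cstrip" for z
  proof -
    have "\<bar>Re z - 1/2\<bar> \<le> 1/2" using that unfolding abs_le_iff by (simp add: cstrip_def)
    then have "\<bar>s * (Re z - 1/2)\<bar> \<le> \<bar>s\<bar> * (1/2)" unfolding abs_mult by (intro mult_left_mono) auto
    then show ?thesis by linarith
  qed
  then show ?thesis unfolding strip_fun_def by (auto intro!: continuous_intros holomorphic_intros)
qed

section \<open>Arrays of jets and their representations\<close>

lemma zadd_plus: "zadd x y = x + y"
  by (simp add: zadd_def plus_fun_def)

lemma sum_fun_apply2: "(\<Sum>i\<in>I. x i) j k = (\<Sum>i\<in>I. x i j k)"
  for x :: "'i \<Rightarrow> nat \<Rightarrow> nat \<Rightarrow> complex"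
  by (induction I rule: infinite_finite_induct) auto

lemma zscale_apply [simp]: "zscale c x j k = c * x j k"
  by (simp add: zscale_def)

lemma zscale_simps: "zscale c (x + y) = zscale c x + zscale c y" "zscale (c + d) x = zscale c x + zscale d x"
  "zscale c (zscale d x) = zscale (c * d) x" "zscale 1 x = x" "zscale 0 x = 0" "zscale c 0 = 0"
  "zscale c (x - y) = zscale c x - zscale c y" "zscale (-1) x = - x"
  by (auto simp: fun_eq_iff algebra_simps)

text \<open>Arrays are read by coordinates of ell_infty: a column carries the Taylor coefficients of
  a single coordinate function.\<close>

definition col :: "(nat \<Rightarrow> nat \<Rightarrow> complex) \<Rightarrow> nat \<Rightarrow> complex fps" where
  "col x k = Abs_fps (\<lambda>j. x j k)"

lemma col_nth [simp]: "col x k $ j = x j k"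
  by (simp add: col_def)

definition restr :: "nat set \<Rightarrow> (nat \<Rightarrow> nat \<Rightarrow> complex) \<Rightarrow> nat \<Rightarrow> nat \<Rightarrow> complex" where
  "restr S x = (\<lambda>j k. if k \<in> S then x j k else 0)"

lemma restr_apply [simp]: "restr S x j k = (if k \<in> S then x j k else 0)"
  by (simp add: restr_def)

lemma restr_simps: "restr S (x + y) = restr S x + restr S y" "restr S (x - y) = restr S x - restr S y"
  "restr S (zscale c x) = zscale c (restr S x)" "restr S (restr S' x) = restr (S \<inter> S') x" "restr S 0 = 0"
  "restr UNIV x = x"
  by (auto simp: fun_eq_iff)

lemma fps_mult_nth_cong:
  assumes "\<And>i. i \<le> j \<Longrightarrow> A $ i = B $ i" shows "(F * A) $ j = (F * B) $ (j::nat)"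
  unfolding fps_mult_nth using assms by (intro sum.cong) auto

lemma fps_mult_const_nth: "(F * (fps_const c * A)) $ j = c * (F * A) $ (j::nat)" for c :: complex
  by (metis fps_mult_left_const_nth mult.left_commute)

lemma fps_refl_add: "fps_refl (F + G) = fps_refl F + fps_refl G"
  by (rule fps_ext) (simp add: algebra_simps)

lemma fps_refl_const: "fps_refl (fps_const c) = fps_const (cnj c)"
  by (rule fps_ext) simp

lemma fps_refl_exp: "fps_refl (fps_exp (of_real s)) = fps_exp (of_real (- s))"
proof (rule fps_ext)
  fix j show "fps_refl (fps_exp (of_real s)) $ j = fps_exp (of_real (- s)) $ j"
    by (simp add: power_minus[of "of_real s"])
qed

lemma jet_cmult: "f holomorphic_on strip \<Longrightarrow> jet (\<lambda>z. c * f z) = fps_const c * jet f"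
  using jet_mult[of "\<lambda>z. c" f] by (simp add: jet_const holomorphic_intros)

locale rochberg_index =
  fixes n :: nat
  assumes n_pos: "n \<ge> 1"
begin

section \<open>Truncated jets and multiplication operators\<close>

definition jets :: "(nat \<Rightarrow> nat \<Rightarrow> complex) \<Rightarrow> bool" where
  "jets x \<longleftrightarrow> (\<forall>j\<ge>n. x j = 0)"

text \<open>If \<open>x\<close> is the n-jet of a function and \<open>F\<close> the series of a
  multiplier, this is the n-jet of the product. \<open>act fps_X\<close> is the shift
  \<open>N\<close>, and \<open>act (fps_exp s)\<close> is the operator
  \<open>E\<^sub>s\<close>.\<close>

definition act :: "complex fps \<Rightarrow> (nat \<Rightarrow> nat \<Rightarrow> complex) \<Rightarrow> nat \<Rightarrow> nat \<Rightarrow> complex" where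
  "act F x = (\<lambda>j k. if j < n then (F * col x k) $ j else 0)"

lemma act_apply: "act F x j k = (if j < n then (F * col x k) $ j else 0)"
  by (simp add: act_def)

lemma jets_act [simp]: "jets (act F x)"
  by (auto simp: jets_def act_def fun_eq_iff)

lemma act_act: "act F (act G x) = act (F * G) x"
proof (intro ext)
  fix j k
  have "(F * col (act G x) k) $ j = (F * (G * col x k)) $ j" if "j < n"
    using that by (intro fps_mult_nth_cong) (simp add: act_apply)
  then show "act F (act G x) j k = act (F * G) x j k"
    by (simp add: act_apply mult.assoc)
qed

lemma col_simps: "col (x + y) k = col x k + col y k" "col (zscale c x) k = fps_const c * col x k"
  by (auto intro!: fps_ext)

lemma act_simps: "act F (x + y) = act F x + act F y" "act (F + G) x = act F x + act G x"
  "act F (zscale c x) = zscale c (act F x)" "act (fps_const c * F) x = zscale c (act F x)"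
  by (auto simp: fun_eq_iff act_apply col_simps distrib_left distrib_right fps_mult_const_nth mult.assoc)

lemma act_const: "jets x \<Longrightarrow> act (fps_const c) x = zscale c x"
  by (auto simp: fun_eq_iff act_apply jets_def)

lemma act_1: "jets x \<Longrightarrow> act 1 x = x"
  using act_const[of x 1] by (simp add: zscale_simps)

lemma act_restr: "act F (restr S x) = restr S (act F x)"
  by (auto simp: fun_eq_iff act_apply fps_mult_nth)

lemma act_cong: "(\<And>i. i < n \<Longrightarrow> F $ i = G $ i) \<Longrightarrow> act F x = act G x"
  unfolding act_def fps_mult_nth by (intro ext if_cong sum.cong) auto

lemma act_0 [simp]: "act F 0 = 0"
  by (auto simp: fun_eq_iff act_apply fps_mult_nth)

lemma act_X_power: "act (fps_X ^ i) x j k = (if i \<le> j \<and> j < n then x (j - i) k else 0)"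
  by (auto simp: act_apply fps_X_power_mult_nth)

lemma act_sum: "act F (\<Sum>i\<in>I. x i) = (\<Sum>i\<in>I. act F (x i))"
  using sum_comp_morphism[of "act F" x I] by (simp add: act_simps o_def)

lemma act_sum_left: "act (\<Sum>i\<in>I. F i) x = (\<Sum>i\<in>I. act (F i) x)"
  by (induction I rule: infinite_finite_induct) (auto simp: act_simps, auto simp: fun_eq_iff act_apply)

text \<open>Since the n-th power of the shift vanishes on n-jets, every multiplication operator is a
  polynomial in the shift.\<close>

lemma act_expand: "act F x = (\<Sum>i<n. zscale (F $ i) (act (fps_X ^ i) x))"
proof -
  have "act F x = act (\<Sum>i<n. fps_const (F $ i) * fps_X ^ i) x"
    by (intro act_cong) (auto simp: fps_sum_nth fps_X_power_nth sum.delta' if_distrib cong: if_cong)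
  then show ?thesis by (simp add: act_sum_left act_simps)
qed

lemma jets_simps [simp]: "jets x \<Longrightarrow> jets y \<Longrightarrow> jets (x + y)" "jets x \<Longrightarrow> jets y \<Longrightarrow> jets (x - y)" "jets x \<Longrightarrow> jets (zscale c x)"
  "jets x \<Longrightarrow> jets (restr S x)" "jets 0"
  by (auto simp: jets_def fun_eq_iff)

text \<open>One coordinate of the pairing: the Taylor coefficient of order n-1 of a coordinate
  function times the reflection of another.\<close>

definition fterm :: "(nat \<Rightarrow> nat \<Rightarrow> complex) \<Rightarrow> (nat \<Rightarrow> nat \<Rightarrow> complex) \<Rightarrow> nat \<Rightarrow> complex" where
  "fterm x y k = (col x k * fps_refl (col y k)) $ (n - 1)"

lemma fterm_simps:
  "fterm (x + y) z k = fterm x z k + fterm y z k" "fterm x (y + z) k = fterm x y k + fterm x z k"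
  "fterm (zscale c x) y k = c * fterm x y k" "fterm x (zscale c y) k = cnj c * fterm x y k"
  by (simp_all add: fterm_def col_simps fps_refl_add fps_refl_mult fps_refl_const distrib_left distrib_right
      fps_mult_const_nth mult.assoc)

lemma fterm_restr: "fterm (restr S x) y k = (if k \<in> S then fterm x y k else 0)"
  "fterm x (restr S y) k = (if k \<in> S then fterm x y k else 0)"
  by (auto simp: fterm_def fps_mult_nth)

text \<open>The coefficient of order n-1 does not see the truncation in \<open>act\<close>, and
  reflection is multiplicative, so a factor can be moved across. For \<open>fps_X\<close> this makes
  the shift skew; for real exponentials it makes them preserve the pairing.\<close>

lemma fterm_act: "fterm (act F x) y k = fterm x (act (fps_refl F) y) k"
proof -
  have "fterm (act F x) y k = (fps_refl (col y k) * col (act F x) k) $ (n-1)"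
    by (simp add: fterm_def mult.commute)
  also have "\<dots> = (fps_refl (col y k) * (F * col x k)) $ (n-1)"
    using n_pos by (intro fps_mult_nth_cong) (auto simp: act_apply)
  also have "\<dots> = (col x k * fps_refl (fps_refl F * col y k)) $ (n-1)"
    by (simp add: fps_refl_mult algebra_simps)
  also have "\<dots> = (col x k * fps_refl (col (act (fps_refl F) y) k)) $ (n-1)"
    using n_pos by (intro fps_mult_nth_cong) (auto simp: act_apply)
  finally show ?thesis by (simp add: fterm_def)
qed

lemma fterm_sym: "fterm y x k = (-1)^(n-1) * cnj (fterm x y k)"
proof -
  have "(-1)^(n-1) * cnj (fterm x y k) = fps_refl (col x k * fps_refl (col y k)) $ (n-1)"
    by (simp add: fterm_def)
  also have "\<dots> = fterm y x k" by (simp add: fps_refl_mult fterm_def mult.commute)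
  finally show ?thesis by simp
qed

text \<open>With \<open>P\<close>, the coordinate functions tend to \<open>0\<close> uniformly on the strip, so that they form an element of the
  Calderon space; without \<open>P\<close>, no regularity beyond that of the single coordinates is required. That both
  notions define the same space is a consequence of the dual criterion below.\<close>
definition jet_rep :: "bool \<Rightarrow> real \<Rightarrow> real \<Rightarrow> (nat \<Rightarrow> nat \<Rightarrow> complex) \<Rightarrow> bool" where
  "jet_rep P a b x \<longleftrightarrow> jets x \<and> (\<exists>f e. (\<forall>k. strip_fun (f k) (e k)) \<and> (P \<longrightarrow> e \<longlonglongrightarrow> 0) \<and>
     (\<forall>k (t::real). cmod (f k (\<i> * t)) \<le> a) \<and> (\<forall>K (t::real). (\<Sum>k<K. cmod (f k (1 + \<i> * t))) \<le> b) \<and>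
     (\<forall>j<n. \<forall>k. x j k = jet (f k) $ j))"

lemma jet_repI:
  assumes "jets x" "\<And>k. strip_fun (f k) (e k)" "P \<Longrightarrow> e \<longlonglongrightarrow> 0"
    "\<And>k (t::real). cmod (f k (\<i> * t)) \<le> a" "\<And>K (t::real). (\<Sum>k<K. cmod (f k (1 + \<i> * t))) \<le> b"
    "\<And>j k. j < n \<Longrightarrow> x j k = jet (f k) $ j"
  shows "jet_rep P a b x"
  unfolding jet_rep_def using assms by blast

lemma jet_repE:
  assumes "jet_rep P a b x"
  obtains f e where "jets x" "\<And>k. strip_fun (f k) (e k)" "P \<Longrightarrow> e \<longlonglongrightarrow> 0"
    "\<And>k (t::real). cmod (f k (\<i> * t)) \<le> a" "\<And>K (t::real). (\<Sum>k<K. cmod (f k (1 + \<i> * t))) \<le> b"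
    "\<And>j k. j < n \<Longrightarrow> x j k = jet (f k) $ j"
  using assms unfolding jet_rep_def by blast

lemma jet_rep_jets: "jet_rep P a b x \<Longrightarrow> jets x" by (simp add: jet_rep_def)

lemma jet_rep_nonneg: assumes "jet_rep P a b x" shows "0 \<le> a" "0 \<le> b"
proof -
  from assms obtain f e where f: "jets x" "\<And>k. strip_fun (f k) (e k)" "P \<Longrightarrow> e \<longlonglongrightarrow> 0"
    "\<And>k (t::real). cmod (f k (\<i> * t)) \<le> a" "\<And>K (t::real). (\<Sum>k<K. cmod (f k (1 + \<i> * t))) \<le> b"
    "\<And>j k. j < n \<Longrightarrow> x j k = jet (f k) $ j" by (rule jet_repE) blast
  show "0 \<le> a" using f(4)[of 0 0] norm_ge_zero order_trans by blast
  show "0 \<le> b" using f(5)[of 0 0] by simp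
qed

lemma jet_rep_mono: "jet_rep P a b x \<Longrightarrow> a \<le> a' \<Longrightarrow> b \<le> b' \<Longrightarrow> (P' \<Longrightarrow> P) \<Longrightarrow> jet_rep P' a' b' x"
  unfolding jet_rep_def by (meson order_trans)

lemma jet_rep_0: "0 \<le> a \<Longrightarrow> 0 \<le> b \<Longrightarrow> jet_rep P a b 0"
  by (rule jet_repI[where f="\<lambda>k z. 0" and e="\<lambda>k. 0"]) (auto simp: jet_const strip_fun_def)

lemma jet_rep_add:
  assumes "jet_rep P a b x" "jet_rep P a' b' y" shows "jet_rep P (a + a') (b + b') (x + y)"
proof -
  from assms(1) obtain f e where f: "jets x" "\<And>k. strip_fun (f k) (e k)" "P \<Longrightarrow> e \<longlonglongrightarrow> 0"
    "\<And>k (t::real). cmod (f k (\<i> * t)) \<le> a" "\<And>K (t::real). (\<Sum>k<K. cmod (f k (1 + \<i> * t))) \<le> b"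
    "\<And>j k. j < n \<Longrightarrow> x j k = jet (f k) $ j" by (rule jet_repE) blast
  from assms(2) obtain g d where g: "jets y" "\<And>k. strip_fun (g k) (d k)" "P \<Longrightarrow> d \<longlonglongrightarrow> 0"
    "\<And>k (t::real). cmod (g k (\<i> * t)) \<le> a'" "\<And>K (t::real). (\<Sum>k<K. cmod (g k (1 + \<i> * t))) \<le> b'"
    "\<And>j k. j < n \<Longrightarrow> y j k = jet (g k) $ j" by (rule jet_repE) blast
  show ?thesis
  proof (rule jet_repI[where f="\<lambda>k z. f k z + g k z" and e="\<lambda>k. e k + d k"])
    show "strip_fun (\<lambda>z. f k z + g k z) (e k + d k)" for k using f(2) g(2) by (rule strip_fun_add)
    show "(\<lambda>k. e k + d k) \<longlonglongrightarrow> 0" if P using tendsto_add[OF f(3) g(3)] that by simp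
    show "cmod (f k (\<i> * t) + g k (\<i> * t)) \<le> a + a'" for k and t :: real
      using f(4)[of k t] g(4)[of k t] by (intro norm_triangle_le add_mono)
    show "(\<Sum>k<K. cmod (f k (1 + \<i> * t) + g k (1 + \<i> * t))) \<le> b + b'" for K and t :: real
    proof -
      have "(\<Sum>k<K. cmod (f k (1 + \<i> * t) + g k (1 + \<i> * t))) \<le> (\<Sum>k<K. cmod (f k (1 + \<i> * t)) + cmod (g k (1 + \<i> * t)))"
        by (intro sum_mono norm_triangle_ineq)
      also have "\<dots> \<le> b + b'" unfolding sum.distrib using f(5)[of t K] g(5)[of t K] by (rule add_mono)
      finally show ?thesis .
    qed
    show "(x + y) j k = jet (\<lambda>z. f k z + g k z) $ j" if "j < n" for j k
      using that f(2)[of k] g(2)[of k] f(6) g(6) by (simp add: strip_fun_def jet_add)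
  qed (use f(1) g(1) in simp)
qed

text \<open>Here it pays to record the bounds on the two lines separately: disjoint supports leave
  the sup bound on the left line unchanged, while the ell_1 bounds on the right line add. This
  asymmetry causes the growth of order sqrt M of block sums.\<close>

lemma jet_rep_disjoint_add:
  assumes "jet_rep P a b x" "jet_rep P a b' y" "restr S x = x" "restr S y = 0" shows "jet_rep P a (b + b') (x + y)"
proof -
  from assms(1) obtain f e where f: "jets x" "\<And>k. strip_fun (f k) (e k)" "P \<Longrightarrow> e \<longlonglongrightarrow> 0"
    "\<And>k (t::real). cmod (f k (\<i> * t)) \<le> a" "\<And>K (t::real). (\<Sum>k<K. cmod (f k (1 + \<i> * t))) \<le> b"
    "\<And>j k. j < n \<Longrightarrow> x j k = jet (f k) $ j" by (rule jet_repE) blast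
  from assms(2) obtain g d where g: "jets y" "\<And>k. strip_fun (g k) (d k)" "P \<Longrightarrow> d \<longlonglongrightarrow> 0"
    "\<And>k (t::real). cmod (g k (\<i> * t)) \<le> a" "\<And>K (t::real). (\<Sum>k<K. cmod (g k (1 + \<i> * t))) \<le> b'"
    "\<And>j k. j < n \<Longrightarrow> y j k = jet (g k) $ j" by (rule jet_repE) blast
  have nn: "0 \<le> e k" "0 \<le> d k" for k using f(2)[of k] g(2)[of k] strip_fun_bound_nonneg by blast+
  define h where "h k = (if k \<in> S then f k else g k)" for k
  show ?thesis
  proof (rule jet_repI[where f=h and e="\<lambda>k. e k + d k"])
    show "strip_fun (h k) (e k + d k)" for k
      using f(2)[of k] g(2)[of k] nn[of k] by (auto simp: h_def strip_fun_def intro: order_trans)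
    show "(\<lambda>k. e k + d k) \<longlonglongrightarrow> 0" if P using tendsto_add[OF f(3) g(3)] that by simp
    show "cmod (h k (\<i> * t)) \<le> a" for k and t :: real using f(4)[of k t] g(4)[of k t] by (simp add: h_def)
    show "(\<Sum>k<K. cmod (h k (1 + \<i> * t))) \<le> b + b'" for K and t :: real
    proof -
      have "(\<Sum>k<K. cmod (h k (1 + \<i> * t))) \<le> (\<Sum>k<K. cmod (f k (1 + \<i> * t)) + cmod (g k (1 + \<i> * t)))"
        by (intro sum_mono) (simp add: h_def)
      also have "\<dots> \<le> b + b'" unfolding sum.distrib using f(5)[of t K] g(5)[of t K] by (rule add_mono)
      finally show ?thesis .
    qed
    have "x j k = 0" if "k \<notin> S" for j k using assms(3) that by (metis restr_apply)
    moreover have "y j k = 0" if "k \<in> S" for j k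
    proof -
      have "restr S y j k = 0" unfolding assms(4) by simp
      then show ?thesis using that by simp
    qed
    ultimately show "(x + y) j k = jet (h k) $ j" if "j < n" for j k
      using f(6)[OF that, of k] g(6)[OF that, of k] by (cases "k \<in> S") (simp_all add: h_def)
  qed (use f(1) g(1) in simp)
qed

text \<open>Separate bounds of the multiplier on the two lines are what exponentials call for, as
  these trade one bound for the other.\<close>

lemma jet_rep_act:
  assumes "jet_rep P a b x" "strip_fun h B" "\<And>t::real. cmod (h (\<i> * t)) \<le> A'" "\<And>t::real. cmod (h (1 + \<i> * t)) \<le> B'"
  shows "jet_rep P (A' * a) (B' * b) (act (jet h) x)"
proof -
  from assms(1) obtain f e where f: "jets x" "\<And>k. strip_fun (f k) (e k)" "P \<Longrightarrow> e \<longlonglongrightarrow> 0"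
    "\<And>k (t::real). cmod (f k (\<i> * t)) \<le> a" "\<And>K (t::real). (\<Sum>k<K. cmod (f k (1 + \<i> * t))) \<le> b"
    "\<And>j k. j < n \<Longrightarrow> x j k = jet (f k) $ j" by (rule jet_repE) blast
  have A0: "0 \<le> A'" "0 \<le> B'" using assms(3,4)[of 0] norm_ge_zero order_trans by blast+
  show ?thesis
  proof (rule jet_repI[where f="\<lambda>k z. h z * f k z" and e="\<lambda>k. B * e k"])
    show "strip_fun (\<lambda>z. h z * f k z) (B * e k)" for k using assms(2) f(2) by (rule strip_fun_mult)
    show "(\<lambda>k. B * e k) \<longlonglongrightarrow> 0" if P using tendsto_mult_left_zero[OF f(3)] that by (simp add: tendsto_mult_right_zero f(3))
    show "cmod (h (\<i> * t) * f k (\<i> * t)) \<le> A' * a" for k and t :: real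
      unfolding norm_mult using assms(3) f(4) A0 by (intro mult_mono) auto
    show "(\<Sum>k<K. cmod (h (1 + \<i> * t) * f k (1 + \<i> * t))) \<le> B' * b" for K and t :: real
      unfolding norm_mult sum_distrib_left[symmetric] using assms(4) f(5) A0 by (intro mult_mono) (auto intro: sum_nonneg)
    show "act (jet h) x j k = jet (\<lambda>z. h z * f k z) $ j" if "j < n" for j k
    proof -
      have "act (jet h) x j k = (jet h * col x k) $ j" using that by (simp add: act_apply)
      also have "\<dots> = (jet h * jet (f k)) $ j" using that f(6) by (intro fps_mult_nth_cong) auto
      finally show ?thesis using assms(2) f(2)[of k] by (simp add: strip_fun_def jet_mult)
    qed
  qed simp
qed

lemma jet_rep_restr: assumes "jet_rep P a b x" shows "jet_rep P a b (restr S x)"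
proof -
  from assms(1) obtain f e where f: "jets x" "\<And>k. strip_fun (f k) (e k)" "P \<Longrightarrow> e \<longlonglongrightarrow> 0"
    "\<And>k (t::real). cmod (f k (\<i> * t)) \<le> a" "\<And>K (t::real). (\<Sum>k<K. cmod (f k (1 + \<i> * t))) \<le> b"
    "\<And>j k. j < n \<Longrightarrow> x j k = jet (f k) $ j" by (rule jet_repE) blast
  define h where "h k = (if k \<in> S then f k else (\<lambda>z. 0))" for k
  have a0: "0 \<le> a" using assms by (rule jet_rep_nonneg)
  show ?thesis
  proof (rule jet_repI[where f=h and e=e])
    show "strip_fun (h k) (e k)" for k
      using f(2)[of k] strip_fun_bound_nonneg[OF f(2)[of k]] by (simp add: h_def strip_fun_def)
    show "cmod (h k (\<i> * t)) \<le> a" for k and t :: real using f(4)[of k t] a0 by (simp add: h_def)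
    show "(\<Sum>k<K. cmod (h k (1 + \<i> * t))) \<le> b" for K and t :: real
    proof -
      have "(\<Sum>k<K. cmod (h k (1 + \<i> * t))) \<le> (\<Sum>k<K. cmod (f k (1 + \<i> * t)))"
        by (intro sum_mono) (simp add: h_def)
      also have "\<dots> \<le> b" by (rule f(5))
      finally show ?thesis .
    qed
    show "restr S x j k = jet (h k) $ j" if "j < n" for j k
      using f(6)[OF that] by (simp add: h_def jet_const)
  qed (use f in simp_all)
qed

lemma jet_rep_coord:
  assumes "jet_rep P r r x" shows "cmod (x j k) \<le> 2^n * r"
proof -
  from assms(1) obtain f e where f: "jets x" "\<And>k. strip_fun (f k) (e k)" "P \<Longrightarrow> e \<longlonglongrightarrow> 0"
    "\<And>k (t::real). cmod (f k (\<i> * t)) \<le> r" "\<And>K (t::real). (\<Sum>k<K. cmod (f k (1 + \<i> * t))) \<le> r"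
    "\<And>j k. j < n \<Longrightarrow> x j k = jet (f k) $ j" by (rule jet_repE) blast
  have r0: "0 \<le> r" using assms by (rule jet_rep_nonneg)
  have "cmod (f k (1 + \<i> * t)) \<le> r" for t :: real
    using f(5)[of t "Suc k"] sum_nonneg[of "{..<k}" "\<lambda>k. cmod (f k (1 + \<i> * t))"] by (simp add: add.commute)
  then have "strip_fun (f k) r" by (rule strip_fun_three_lines[OF f(2) f(4)])
  then have "cmod (jet (f k) $ j) \<le> 2^j * r" by (rule jet_bound)
  then have "cmod (x j k) \<le> 2^n * r" if "j < n"
    using that f(6)[OF that] r0 mult_right_mono[of "2^j" "2^n" r] by fastforce
  moreover have "cmod (x j k) \<le> 2^n * r" if "\<not> j < n" using that f(1) r0 by (simp add: jets_def)
  ultimately show ?thesis by blast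
qed

text \<open>Phase factors turn the sum of absolute values into one Taylor coefficient of a scalar
  function on the strip. On each boundary line a sup bound meets an ell_1 bound, so the three lines
  theorem and Cauchy's estimate finish the proof.\<close>

lemma jet_rep_fterm:
  assumes x: "jet_rep P a b x" and y: "jet_rep P' a' b' y" and R: "a * b' \<le> R" "b * a' \<le> R"
  shows "(\<Sum>k<K. cmod (fterm x y k)) \<le> 2^(n-1) * R"
proof -
  from x obtain f e where f: "\<And>k. strip_fun (f k) (e k)"
    "\<And>k (t::real). cmod (f k (\<i> * t)) \<le> a" "\<And>K (t::real). (\<Sum>k<K. cmod (f k (1 + \<i> * t))) \<le> b"
    "\<And>j k. j < n \<Longrightarrow> x j k = jet (f k) $ j" by (rule jet_repE) blast
  from y obtain g d where g: "\<And>k. strip_fun (g k) (d k)"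
    "\<And>k (t::real). cmod (g k (\<i> * t)) \<le> a'" "\<And>K (t::real). (\<Sum>k<K. cmod (g k (1 + \<i> * t))) \<le> b'"
    "\<And>j k. j < n \<Longrightarrow> y j k = jet (g k) $ j" by (rule jet_repE) blast
  have nn: "0 \<le> a" "0 \<le> b" "0 \<le> a'" "0 \<le> b'" using jet_rep_nonneg x y by blast+
  define c where "c k = cnj (sgn (fterm x y k))" for k
  have c1: "cmod (c k) \<le> 1" and cf: "c k * fterm x y k = cmod (fterm x y k)" for k
  proof -
    show "cmod (c k) \<le> 1" by (simp add: c_def norm_sgn)
    show "c k * fterm x y k = cmod (fterm x y k)"
    proof (cases "fterm x y k = 0")
      case False
      then show ?thesis
        using complex_norm_square[of "fterm x y k"]
        by (simp add: c_def sgn_eq field_simps power2_eq_square)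
    qed (simp add: c_def)
  qed
  define h where "h z = (\<Sum>k<K. c k * (f k z * strip_refl (g k) z))" for z
  have h: "strip_fun h (\<Sum>k<K. cmod (c k) * (e k * d k))"
    unfolding h_def using f(1) g(1) by (intro strip_fun_sum strip_fun_mult strip_fun_const strip_fun_refl)
  have hb: "cmod (h z) \<le> (\<Sum>k<K. cmod (f k z) * cmod (g k (1 - cnj z)))" for z
    unfolding h_def
  proof (intro sum_norm_le)
    fix k
    have "cmod (c k * (f k z * strip_refl (g k) z)) = cmod (c k) * (cmod (f k z) * cmod (g k (1 - cnj z)))"
      by (simp add: norm_mult strip_refl_def)
    also have "\<dots> \<le> 1 * (cmod (f k z) * cmod (g k (1 - cnj z)))" using c1 by (intro mult_right_mono) auto
    finally show "cmod (c k * (f k z * strip_refl (g k) z)) \<le> cmod (f k z) * cmod (g k (1 - cnj z))" by simp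
  qed
  have h0: "cmod (h (\<i> * t)) \<le> R" for t :: real
  proof -
    have "cmod (h (\<i> * t)) \<le> (\<Sum>k<K. cmod (f k (\<i> * t)) * cmod (g k (1 + \<i> * t)))"
      using hb[of "\<i> * t"] by simp
    also have "\<dots> \<le> (\<Sum>k<K. a * cmod (g k (1 + \<i> * t)))" using f(2) by (intro sum_mono mult_right_mono) auto
    also have "\<dots> \<le> a * b'" unfolding sum_distrib_left[symmetric] using g(3) nn by (intro mult_left_mono)
    finally show ?thesis using R by simp
  qed
  have h1: "cmod (h (1 + \<i> * t)) \<le> R" for t :: real
  proof -
    have "cmod (h (1 + \<i> * t)) \<le> (\<Sum>k<K. cmod (f k (1 + \<i> * t)) * cmod (g k (\<i> * t)))"
      using hb[of "1 + \<i> * t"] by simp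
    also have "\<dots> \<le> (\<Sum>k<K. cmod (f k (1 + \<i> * t)) * a')" using g(2) by (intro sum_mono mult_left_mono) auto
    also have "\<dots> \<le> b * a'" unfolding sum_distrib_right[symmetric] using f(3) nn by (intro mult_right_mono)
    finally show ?thesis using R by simp
  qed
  have "strip_fun h R" by (rule strip_fun_three_lines[OF h h0 h1])
  then have bd: "cmod (jet h $ (n-1)) \<le> 2^(n-1) * R" by (rule jet_bound)
  have hol: "f k holomorphic_on strip" "strip_refl (g k) holomorphic_on strip" for k
    using f(1)[of k] strip_fun_refl[OF g(1)[of k]] by (auto simp: strip_fun_def)
  have "jet (\<lambda>z. c k * (f k z * strip_refl (g k) z)) = fps_const (c k) * (jet (f k) * fps_refl (jet (g k)))" for k
    using jet_cmult[OF holomorphic_on_mult[OF hol]] jet_mult[OF hol] jet_refl[OF g(1)] by simp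
  then have "jet h = (\<Sum>k<K. fps_const (c k) * (jet (f k) * fps_refl (jet (g k))))"
    unfolding h_def by (subst jet_sum) (auto intro!: holomorphic_intros hol)
  moreover have "(jet (f k) * fps_refl (jet (g k))) $ (n-1) = fterm x y k" for k
    unfolding fterm_def fps_mult_nth using f(4) g(4) n_pos by (intro sum.cong) auto
  ultimately have "jet h $ (n-1) = (\<Sum>k<K. c k * fterm x y k)" by (simp add: fps_sum_nth)
  also have "\<dots> = of_real (\<Sum>k<K. cmod (fterm x y k))" by (simp add: cf)
  finally have "cmod (jet h $ (n-1)) = (\<Sum>k<K. cmod (fterm x y k))"
    by (simp add: sum_nonneg del: of_real_sum)
  then show ?thesis using bd by simp
qed

end

section \<open>The norm and the pairing\<close>

text \<open>Such weights extract the linear coefficient of a polynomial p of degree at most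
  \<open>d\<close>: the sum of c_i p(2^i s) is s p'(0). The nodes are geometric because multiplying
  s = ln M by 2^i amounts to replacing M by M^(2^i).\<close>

lemma derivative_weights:
  assumes "d \<ge> 1"
  shows "\<exists>c::nat \<Rightarrow> real. \<forall>j\<le>d. (\<Sum>i\<le>d. c i * (2^i)^j) = of_bool (j = 1)"
  using assms
proof (induction d rule: nat_induct_at_least)
  case base
  have "\<forall>j\<le>1. (\<Sum>i\<le>1. (if i = 0 then -1 else 1 :: real) * (2^i)^j) = of_bool (j = 1)"
  proof (intro allI impI)
    fix j :: nat assume "j \<le> 1"
    then have j: "j = 0 \<or> j = 1" by arith
    have "(\<Sum>i\<le>Suc 0. (if i = 0 then -1 else 1 :: real) * (2^i)^j) = -1 + 2^j" by simp
    then show "(\<Sum>i\<le>1. (if i = 0 then -1 else 1 :: real) * (2^i)^j) = of_bool (j = 1)"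
      using j by (elim disjE) simp_all
  qed
  then show ?case by (intro exI[of _ "\<lambda>i::nat. if i = 0 then -1 else 1 :: real"])
next
  case (Suc d)
  then obtain c :: "nat \<Rightarrow> real" where c: "\<And>j. j \<le> d \<Longrightarrow> (\<Sum>i\<le>d. c i * (2^i)^j) = of_bool (j = 1)" by blast
  \<comment> \<open>Passing from p(t) to p(2 t) - 2^(d+1) p(t) kills the new top degree and
    multiplies the linear coefficient by \<open>q\<close>.\<close>
  define q :: real where "q = 2 - 2^Suc d"
  have "(2::real)^Suc d \<ge> 2^2" using Suc.hyps by (intro power_increasing) auto
  then have q: "q \<noteq> 0" by (simp add: q_def)
  define c' where "c' i = ((if i = 0 then 0 else c (i-1)) - 2^Suc d * (if i \<le> d then c i else 0)) / q" for i
  have *: "(\<Sum>i\<le>Suc d. c' i * (2^i)^j) = (2^j - 2^Suc d) / q * (\<Sum>i\<le>d. c i * (2^i)^j)" for j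
  proof -
    have 1: "(\<Sum>i\<le>Suc d. (if i = 0 then 0 else c (i-1)) * (2^i)^j) = 2^j * (\<Sum>i\<le>d. c i * (2^i)^j)"
      unfolding sum.atMost_Suc_shift by (simp add: sum_distrib_left power_mult_distrib algebra_simps)
    have 2: "(\<Sum>i\<le>Suc d. (if i \<le> d then c i else 0) * (2^i)^j) = (\<Sum>i\<le>d. c i * (2^i)^j)"
      by simp
    have "(\<Sum>i\<le>Suc d. c' i * (2^i)^j) = ((\<Sum>i\<le>Suc d. (if i = 0 then 0 else c (i-1)) * (2^i)^j)
        - 2^Suc d * (\<Sum>i\<le>Suc d. (if i \<le> d then c i else 0) * (2^i)^j)) / q"
      unfolding c'_def sum_distrib_left sum_subtractf[symmetric] sum_divide_distrib
      by (intro sum.cong) (auto simp: algebra_simps diff_divide_distrib)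
    then show ?thesis unfolding 1 2 by (simp add: algebra_simps diff_divide_distrib)
  qed
  have "(\<Sum>i\<le>Suc d. c' i * (2^i)^j) = of_bool (j = 1)" if "j \<le> Suc d" for j
  proof (cases "j = Suc d")
    case True
    have "(2^j - 2^Suc d) / q = 0" using True by simp
    then show ?thesis using *[of j] True Suc.hyps by (simp only: mult_zero_left) simp
  next
    case False
    then have "(\<Sum>i\<le>d. c i * (2^i)^j) = of_bool (j = 1)" using c that by simp
    then show ?thesis using *[of j] q by (cases "j = 1") (simp_all only: q_def, simp_all)
  qed
  then show ?case by blast
qed

context rochberg_index
begin

definition Z :: "(nat \<Rightarrow> nat \<Rightarrow> complex) set" where
  "Z = {x. \<exists>r. jet_rep False r r x}"

text \<open>The infimum runs over the weak representations, which are easier to manipulate;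
  \<open>zn_norm_bounds\<close> shows that the result is equivalent to
  \<open>zn_norm\<close>.\<close>

definition nrm :: "(nat \<Rightarrow> nat \<Rightarrow> complex) \<Rightarrow> real" where
  "nrm x = Inf {r. jet_rep False r r x}"

lemma jet_rep_Z: assumes "jet_rep P a b x" shows "x \<in> Z"
proof -
  have "jet_rep False (max a b) (max a b) x" using assms by (rule jet_rep_mono) auto
  then show ?thesis unfolding Z_def by blast
qed

lemma Z_jets: "x \<in> Z \<Longrightarrow> jets x" by (auto simp: Z_def jet_rep_jets)

lemma bdd_below_reps: "bdd_below {r. jet_rep False r r x}"
  using jet_rep_nonneg(1) by (intro bdd_belowI[where m=0]) blast

lemma nrm_le: assumes "jet_rep P a b x" "a \<le> r" "b \<le> r" shows "nrm x \<le> r"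
proof -
  have "jet_rep False r r x" using assms by (intro jet_rep_mono[OF assms(1)]) auto
  then show ?thesis unfolding nrm_def using bdd_below_reps by (intro cInf_lower) auto
qed

lemma le_nrmI: assumes "x \<in> Z" "\<And>r. jet_rep False r r x \<Longrightarrow> c \<le> r" shows "c \<le> nrm x"
  unfolding nrm_def using assms by (intro cInf_greatest) (auto simp: Z_def)

lemma nrm_less_rep: assumes "x \<in> Z" "nrm x < r" shows "jet_rep False r r x"
proof -
  obtain s where "jet_rep False s s x" "s < r"
    using assms cInf_less_iff[OF _ bdd_below_reps] unfolding nrm_def Z_def by fastforce
  then show ?thesis by (meson jet_rep_mono less_imp_le)
qed

lemma nrm_nonneg: "x \<in> Z \<Longrightarrow> 0 \<le> nrm x"
  by (rule le_nrmI) (auto dest: jet_rep_nonneg)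

lemma nrm_zero_eq [simp]: "nrm 0 = 0" and zero_in_Z [simp]: "0 \<in> Z"
proof -
  have r: "jet_rep False 0 0 0" by (rule jet_rep_0) auto
  then show "0 \<in> Z" by (rule jet_rep_Z)
  then show "nrm 0 = 0" using nrm_le[OF r, of 0] nrm_nonneg[of 0] by simp
qed

lemma nrm_linear_bound:
  assumes x: "x \<in> Z" and c: "0 \<le> c" and rep: "\<And>r. jet_rep False r r x \<Longrightarrow> jet_rep P (c * r) (c * r) y"
  shows "y \<in> Z" "nrm y \<le> c * nrm x"
proof -
  obtain r where "jet_rep False r r x" using x by (auto simp: Z_def)
  then show "y \<in> Z" using rep jet_rep_Z by blast
  have "nrm y \<le> c * (nrm x + \<delta>)" if "\<delta> > 0" for \<delta>
    using nrm_less_rep[OF x, of "nrm x + \<delta>"] that rep by (intro nrm_le) auto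
  then have *: "nrm y \<le> c * nrm x + c * \<delta>" if "\<delta> > 0" for \<delta> using that by (simp add: algebra_simps)
  show "nrm y \<le> c * nrm x"
  proof (cases "c = 0")
    case True then show ?thesis using *[of 1] by simp
  next
    case False
    have "nrm y \<le> c * nrm x + \<delta>" if "\<delta> > 0" for \<delta>
      using *[of "\<delta> / c"] that c False by simp
    then show ?thesis by (rule field_le_epsilon)
  qed
qed

lemma Z_add: assumes "x \<in> Z" "y \<in> Z" shows "x + y \<in> Z" "nrm (x + y) \<le> nrm x + nrm y"
proof -
  obtain r s where "jet_rep False r r x" "jet_rep False s s y" using assms by (auto simp: Z_def)
  then show "x + y \<in> Z" using jet_rep_add jet_rep_Z by blast
  show "nrm (x + y) \<le> nrm x + nrm y"
  proof (rule field_le_epsilon)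
    fix \<delta> :: real assume "\<delta> > 0"
    then have "jet_rep False (nrm x + \<delta>/2) (nrm x + \<delta>/2) x" "jet_rep False (nrm y + \<delta>/2) (nrm y + \<delta>/2) y"
      using assms by (auto intro!: nrm_less_rep)
    from jet_rep_add[OF this] show "nrm (x + y) \<le> nrm x + nrm y + \<delta>" by (rule nrm_le) auto
  qed
qed

lemma Z_scale: assumes "x \<in> Z" shows "zscale c x \<in> Z" "nrm (zscale c x) = cmod c * nrm x"
proof -
  have A: "zscale c x \<in> Z \<and> nrm (zscale c x) \<le> cmod c * nrm x" if "x \<in> Z" for c x
  proof -
    have "jet_rep False (cmod c * r) (cmod c * r) (zscale c x)" if "jet_rep False r r x" for r
      using jet_rep_act[OF that strip_fun_const[of c], of "cmod c" "cmod c"] jet_rep_jets[OF that]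
      by (simp add: jet_const act_const)
    then show ?thesis using nrm_linear_bound[OF that, of "cmod c" False "zscale c x"] by auto
  qed
  show "zscale c x \<in> Z" using A assms by blast
  show "nrm (zscale c x) = cmod c * nrm x"
  proof (cases "c = 0")
    case True then show ?thesis by (simp add: zscale_simps)
  next
    case False
    have "nrm (zscale (inverse c) (zscale c x)) \<le> cmod (inverse c) * nrm (zscale c x)"
      using A assms by blast
    then have "nrm x \<le> inverse (cmod c) * nrm (zscale c x)"
      using False by (simp add: zscale_simps norm_inverse)
    then have "cmod c * nrm x \<le> nrm (zscale c x)"
      using False by (simp add: field_simps)
    then show ?thesis using A[OF assms, of c] by simp
  qed
qed

lemma Z_uminus: assumes "x \<in> Z" shows "- x \<in> Z" "nrm (- x) = nrm x"
  using Z_scale[OF assms, of "-1"] by (simp_all add: zscale_simps)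

lemma Z_diff: assumes "x \<in> Z" "y \<in> Z" shows "x - y \<in> Z" "nrm (x - y) \<le> nrm x + nrm y"
  using Z_add[OF assms(1) Z_uminus(1)[OF assms(2)]] Z_uminus(2)[OF assms(2)] by simp_all

lemma Z_restr: assumes "x \<in> Z" shows "restr S x \<in> Z" "nrm (restr S x) \<le> nrm x"
  using nrm_linear_bound[OF assms, of 1 False "restr S x"] jet_rep_restr by auto

lemma Z_sum: "(\<And>i. i \<in> I \<Longrightarrow> x i \<in> Z) \<Longrightarrow> (\<Sum>i\<in>I. x i) \<in> Z \<and> nrm (\<Sum>i\<in>I. x i) \<le> (\<Sum>i\<in>I. nrm (x i))"
proof (induction I rule: infinite_finite_induct)
  case (insert i I)
  then have "x i \<in> Z" "sum x I \<in> Z" "nrm (sum x I) \<le> (\<Sum>i\<in>I. nrm (x i))" by auto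
  then show ?case using Z_add[of "x i" "sum x I"] unfolding sum.insert[OF insert.hyps(1,2)] by linarith
qed (simp_all only: sum.infinite sum.empty zero_in_Z nrm_zero_eq order_refl simp_thms)

lemma Z_coord: assumes "x \<in> Z" shows "cmod (x j k) \<le> 2^n * nrm x"
proof -
  have "cmod (x j k) / 2^n \<le> nrm x"
    by (rule le_nrmI[OF assms]) (use jet_rep_coord in \<open>simp add: field_simps\<close>)
  then show ?thesis by (simp add: field_simps)
qed

lemma nrm_eq_0: "x \<in> Z \<Longrightarrow> nrm x = 0 \<Longrightarrow> x = 0"
  using Z_coord[of x] by (auto simp: fun_eq_iff)

text \<open>The function z - 1/2 is unbounded on the strip and cannot serve as a multiplier. A
  combination of the exponentials exp (2^i (z - 1/2)) is bounded there and has the same Taylor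
  coefficients below order \<open>n\<close>.\<close>

lemma shift_bound_ex: "\<exists>C\<ge>1. \<forall>P a b x. jet_rep P a b x \<longrightarrow> jet_rep P (C * a) (C * b) (act fps_X x)"
proof -
  obtain c :: "nat \<Rightarrow> real" where c: "\<And>j. j \<le> n \<Longrightarrow> (\<Sum>i\<le>n. c i * (2^i)^j) = of_bool (j = 1)"
    using derivative_weights[OF n_pos] by blast
  define h where "h z = (\<Sum>i\<le>n. of_real (c i) * exp (of_real (2^i) * (z - 1/2)))" for z :: complex
  define C where "C = (\<Sum>i\<le>n. cmod (of_real (c i)) * exp (\<bar>2^i\<bar>/2))"
  have h: "strip_fun h C"
    unfolding h_def C_def by (intro strip_fun_sum strip_fun_mult strip_fun_const strip_fun_exp)
  have "jet h = (\<Sum>i\<le>n. fps_const (of_real (c i)) * fps_exp (of_real (2^i)))"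
    unfolding h_def by (subst jet_sum) (simp_all only: jet_cmult jet_exp holomorphic_intros)
  then have "jet h $ j = of_real (\<Sum>i\<le>n. c i * (2^i)^j) / fact j" for j
    by (simp add: fps_sum_nth sum_divide_distrib)
  then have "jet h $ j = of_real (of_bool (j = 1)) / fact j" if "j < n" for j using c[of j] that by (simp only:)
  then have "jet h $ j = fps_X $ j" if "j < n" for j using that by (simp add: of_bool_def)
  then have eq: "act (jet h) x = act fps_X x" for x by (rule act_cong)
  have "jet_rep P (max 1 C * a) (max 1 C * b) (act fps_X x)" if "jet_rep P a b x" for P a b x
  proof -
    have "cmod (h (\<i> * of_real t)) \<le> max 1 C" "cmod (h (1 + \<i> * of_real t)) \<le> max 1 C" for t
      using h by (auto simp: strip_fun_def cstrip_def le_max_iff_disj)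
    then show ?thesis using jet_rep_act[OF that h, of "max 1 C" "max 1 C"] unfolding eq by simp
  qed
  then show ?thesis by (intro exI[of _ "max 1 C"] conjI allI impI) simp
qed

definition CN :: real where
  "CN = (SOME C. C \<ge> 1 \<and> (\<forall>P a b x. jet_rep P a b x \<longrightarrow> jet_rep P (C * a) (C * b) (act fps_X x)))"

lemma CN_ge1: "CN \<ge> 1" and jet_rep_shift: "jet_rep P a b x \<Longrightarrow> jet_rep P (CN * a) (CN * b) (act fps_X x)"
  using someI_ex[OF shift_bound_ex, folded CN_def] by blast+

lemma jet_rep_shift_power: assumes "jet_rep P a b x" shows "jet_rep P (CN^i * a) (CN^i * b) (act (fps_X^i) x)"
proof (induction i)
  case 0 then show ?case using assms by (simp add: act_1 jet_rep_jets)
next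
  case (Suc i) then show ?case using jet_rep_shift[OF Suc] by (simp add: act_act mult.assoc)
qed

text \<open>A crude bound for the operator norm of \<open>act F\<close>. For
  \<open>fps_exp s\<close> it is a polynomial in the modulus of s, not an exponential, which decides
  \<open>restr_tail_small\<close>.\<close>

definition opn :: "complex fps \<Rightarrow> real" where
  "opn F = (\<Sum>i<n. cmod (F $ i) * CN^i)"

lemma opn_nonneg: "0 \<le> opn F"
  unfolding opn_def using CN_ge1 by (intro sum_nonneg) auto

lemma Z_shift: assumes "x \<in> Z" shows "act (fps_X^i) x \<in> Z" "nrm (act (fps_X^i) x) \<le> CN^i * nrm x"
  using nrm_linear_bound[OF assms, of "CN^i" False "act (fps_X^i) x"] jet_rep_shift_power CN_ge1 by auto

lemma Z_act: assumes "x \<in> Z" shows "act F x \<in> Z" "nrm (act F x) \<le> opn F * nrm x"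
proof -
  have A: "zscale (F $ i) (act (fps_X ^ i) x) \<in> Z" for i using assms Z_shift Z_scale by blast
  have B: "nrm (zscale (F $ i) (act (fps_X ^ i) x)) \<le> cmod (F $ i) * CN^i * nrm x" for i
    using Z_shift[OF assms, of i] Z_scale(2)[of "act (fps_X ^ i) x" "F $ i"]
    by (simp add: mult.assoc mult_left_mono)
  have S: "(\<Sum>i<n. zscale (F $ i) (act (fps_X ^ i) x)) \<in> Z \<and>
      nrm (\<Sum>i<n. zscale (F $ i) (act (fps_X ^ i) x)) \<le> (\<Sum>i<n. nrm (zscale (F $ i) (act (fps_X ^ i) x)))"
    by (rule Z_sum) (rule A)
  then show "act F x \<in> Z" by (subst act_expand) simp
  have "nrm (act F x) \<le> (\<Sum>i<n. nrm (zscale (F $ i) (act (fps_X ^ i) x)))"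
    using S by (subst act_expand) simp
  also have "\<dots> \<le> (\<Sum>i<n. cmod (F $ i) * CN^i * nrm x)" by (intro sum_mono B)
  finally show "nrm (act F x) \<le> opn F * nrm x" by (simp add: opn_def sum_distrib_right)
qed

section \<open>Boundedness and symmetry of the pairing\<close>

definition form :: "(nat \<Rightarrow> nat \<Rightarrow> complex) \<Rightarrow> (nat \<Rightarrow> nat \<Rightarrow> complex) \<Rightarrow> complex" where
  "form x y = (\<Sum>k. fterm x y k)"

lemma fterm_sum_bound: assumes "x \<in> Z" "y \<in> Z" shows "(\<Sum>k<K. cmod (fterm x y k)) \<le> 2^(n-1) * (nrm x * nrm y)"
proof -
  have *: "(\<Sum>k<K. cmod (fterm x y k)) \<le> 2^(n-1) * ((nrm x + \<delta>) * (nrm y + \<delta>))" if "\<delta> > 0" for \<delta>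
    using that jet_rep_fterm[OF nrm_less_rep[OF assms(1), of "nrm x + \<delta>"] nrm_less_rep[OF assms(2), of "nrm y + \<delta>"], of "(nrm x + \<delta>) * (nrm y + \<delta>)" K]
    by simp
  have "((\<lambda>\<delta>. 2^(n-1) * ((nrm x + \<delta>) * (nrm y + \<delta>))) \<longlongrightarrow> 2^(n-1) * ((nrm x + 0) * (nrm y + 0))) (at_right 0)"
    by (intro tendsto_intros)
  then have lim: "((\<lambda>\<delta>. 2^(n-1) * ((nrm x + \<delta>) * (nrm y + \<delta>))) \<longlongrightarrow> 2^(n-1) * (nrm x * nrm y)) (at_right 0)" by simp
  show ?thesis
  proof (rule tendsto_lowerbound[OF lim])
    show "\<forall>\<^sub>F \<delta> in at_right 0. (\<Sum>k<K. cmod (fterm x y k)) \<le> 2^(n-1) * ((nrm x + \<delta>) * (nrm y + \<delta>))"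
      using eventually_at_right_less by (rule eventually_mono) (rule *)
  qed simp
qed

lemma fterm_summable: assumes "x \<in> Z" "y \<in> Z" shows "summable (\<lambda>k. cmod (fterm x y k))" "summable (fterm x y)"
proof -
  show "summable (\<lambda>k. cmod (fterm x y k))"
    by (rule summableI_nonneg_bounded) (use fterm_sum_bound[OF assms] in auto)
  then show "summable (fterm x y)" by (rule summable_norm_cancel)
qed

lemma form_bound: assumes "x \<in> Z" "y \<in> Z" shows "cmod (form x y) \<le> 2^(n-1) * nrm x * nrm y"
proof -
  have "cmod (form x y) \<le> (\<Sum>k. cmod (fterm x y k))"
    unfolding form_def by (rule summable_norm[OF fterm_summable(1)[OF assms]])
  also have "\<dots> \<le> 2^(n-1) * (nrm x * nrm y)"
    by (rule suminf_le_const[OF fterm_summable(1)[OF assms]]) (rule fterm_sum_bound[OF assms])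
  finally show ?thesis by (simp add: mult.assoc)
qed

lemma form_add_left: assumes "x \<in> Z" "y \<in> Z" "z \<in> Z" shows "form (x + y) z = form x z + form y z"
proof -
  have "fterm (x + y) z = (\<lambda>k. fterm x z k + fterm y z k)" by (rule ext) (rule fterm_simps)
  then show ?thesis unfolding form_def by (simp only: suminf_add[OF fterm_summable(2)[OF assms(1,3)] fterm_summable(2)[OF assms(2,3)]])
qed

lemma form_add_right: assumes "x \<in> Z" "y \<in> Z" "z \<in> Z" shows "form x (y + z) = form x y + form x z"
proof -
  have "fterm x (y + z) = (\<lambda>k. fterm x y k + fterm x z k)" by (rule ext) (rule fterm_simps)
  then show ?thesis unfolding form_def by (simp only: suminf_add[OF fterm_summable(2)[OF assms(1,2)] fterm_summable(2)[OF assms(1,3)]])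
qed

lemma form_scale_left: assumes "x \<in> Z" "y \<in> Z" shows "form (zscale c x) y = c * form x y"
proof -
  have "fterm (zscale c x) y = (\<lambda>k. c * fterm x y k)" by (rule ext) (rule fterm_simps)
  then show ?thesis unfolding form_def by (simp only: suminf_mult[OF fterm_summable(2)[OF assms]])
qed

lemma form_scale_right: assumes "x \<in> Z" "y \<in> Z" shows "form x (zscale c y) = cnj c * form x y"
proof -
  have "fterm x (zscale c y) = (\<lambda>k. cnj c * fterm x y k)" by (rule ext) (rule fterm_simps)
  then show ?thesis unfolding form_def by (simp only: suminf_mult[OF fterm_summable(2)[OF assms]])
qed

lemma form_diff_left: "x \<in> Z \<Longrightarrow> y \<in> Z \<Longrightarrow> z \<in> Z \<Longrightarrow> form (x - y) z = form x z - form y z"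
  using form_add_left[of "x - y" y z] Z_diff(1) by simp

lemma form_act: "form (act F x) y = form x (act (fps_refl F) y)"
  unfolding form_def by (rule arg_cong[where f=suminf]) (simp add: fun_eq_iff fterm_act)

lemma form_restr: "form (restr S x) y = form x (restr S y)"
  unfolding form_def by (rule arg_cong[where f=suminf]) (simp add: fun_eq_iff fterm_restr)

text \<open>Hermitian or skew-Hermitian according to the parity of n-1; either way orthogonality is
  a symmetric relation, which is what \<open>injective\<close> relies on.\<close>

lemma form_sym: assumes "x \<in> Z" "y \<in> Z" shows "form y x = (-1)^(n-1) * cnj (form x y)"
proof -
  have "fterm x y sums form x y" unfolding form_def using fterm_summable(2)[OF assms] by (rule summable_sums)
  then have "(\<lambda>k. cnj (fterm x y k)) sums cnj (form x y)" by (simp only: sums_cnj)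
  then have "(\<lambda>k. (-1)^(n-1) * cnj (fterm x y k)) sums ((-1)^(n-1) * cnj (form x y))" by (rule sums_mult)
  then have "fterm y x sums ((-1)^(n-1) * cnj (form x y))" by (simp only: fterm_sym[of y x, symmetric])
  then show ?thesis unfolding form_def by (simp add: sums_iff)
qed

definition finsupp :: "(nat \<Rightarrow> nat \<Rightarrow> complex) \<Rightarrow> bool" where
  "finsupp y \<longleftrightarrow> (\<exists>K. restr {..<K} y = y)"

lemma form_finsupp: assumes "restr {..<K} y = y" shows "form x y = (\<Sum>k<K. fterm x y k)"
proof -
  have "fterm x y k = 0" if "k \<notin> {..<K}" for k
    using assms that by (metis fterm_restr(2))
  then show ?thesis unfolding form_def by (intro suminf_finite) auto
qed

definition unitv :: "nat \<Rightarrow> nat \<Rightarrow> nat \<Rightarrow> nat \<Rightarrow> complex" where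
  "unitv j k = (\<lambda>j' k'. if j' = j \<and> k' = k then 1 else 0)"

lemma unitv_Z: assumes "j < n" shows "unitv j k \<in> Z"
proof -
  have "jet_rep True 1 1 (unitv 0 k)"
  proof (rule jet_repI[where f="\<lambda>i z. if i = k then 1 else 0" and e="\<lambda>i. if i = k then 1 else 0"])
    show "(\<lambda>i. if i = k then 1 else 0 :: real) \<longlonglongrightarrow> 0"
      by (rule tendsto_eventually, rule eventually_mono[OF eventually_gt_at_top[of k]]) auto
  qed (use n_pos in \<open>auto simp: jets_def unitv_def fun_eq_iff strip_fun_def jet_const if_distrib sum.If_cases cong: if_cong\<close>)
  then have "act (fps_X^j) (unitv 0 k) \<in> Z" using Z_act jet_rep_Z by blast
  moreover have "act (fps_X^j) (unitv 0 k) = unitv j k"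
    using assms by (auto simp: fun_eq_iff act_X_power unitv_def)
  ultimately show ?thesis by simp
qed

end

section \<open>Lifting and the dual criterion\<close>

text \<open>Let r_k be the sum of the squares of |v| from k on and a_k its root. Since r_k - r_(k+1)
  = (a_k - a_(k+1)) (a_k + a_(k+1)), the quotient b_k of the square of |v_k| by a_k is at most 2
  (a_k - a_(k+1)). So \<open>b\<close> is summable by telescoping while \<open>a\<close> tends to
  0.\<close>

lemma tail_weights:
  fixes v :: "nat \<Rightarrow> complex"
  assumes \<rho>: "0 \<le> \<rho>" and v: "\<And>K. (\<Sum>k<K. (cmod (v k))^2) \<le> \<rho>^2"
  obtains a b :: "nat \<Rightarrow> real" where "\<And>k. 0 \<le> a k" "\<And>k. 0 \<le> b k" "\<And>k. a k \<le> \<rho>" "\<And>k. b k \<le> a k" "a \<longlonglongrightarrow> 0"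
    "\<And>K. (\<Sum>k<K. b k) \<le> 2 * \<rho>" "\<And>k. a k * b k = (cmod (v k))^2"
proof -
  have sm: "summable (\<lambda>k. (cmod (v k))^2)" by (rule summableI_nonneg_bounded) (use v in auto)
  define r where "r k = (\<Sum>i. (cmod (v (i + k)))^2)" for k
  have smk: "summable (\<lambda>i. (cmod (v (i + k)))^2)" for k using sm by (rule summable_ignore_initial_segment)
  have r0: "0 \<le> r k" for k unfolding r_def by (intro suminf_nonneg smk) auto
  have step: "r k = (cmod (v k))^2 + r (Suc k)" for k
    using suminf_split_head[OF smk[of k]] by (simp add: r_def)
  have "r 0 \<le> \<rho>^2" unfolding r_def using suminf_le_const[OF sm] v by simp
  moreover have "r k \<le> r 0" for k
  proof (induction k)
    case (Suc k)
    then show ?case using step[of k] zero_le_power2[of "cmod (v k)"] by linarith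
  qed simp
  ultimately have r_le: "r k \<le> \<rho>^2" for k using order_trans by blast
  have "r \<longlonglongrightarrow> 0" unfolding r_def
  proof (rule LIMSEQ_I)
    fix e :: real assume "e > 0"
    then obtain N where "\<And>k. k \<ge> N \<Longrightarrow> norm (\<Sum>i. (cmod (v (i + k)))^2) < e" using suminf_exist_split[OF \<open>e > 0\<close> sm] by blast
    then show "\<exists>no. \<forall>k\<ge>no. norm ((\<Sum>i. (cmod (v (i + k)))^2) - 0) < e" by (intro exI[of _ N]) auto
  qed
  define a where "a k = sqrt (r k)" for k
  \<comment> \<open>Where the tail vanishes, division by 0 makes \<open>b k\<close> zero, in
    accordance with \<open>v k = 0\<close>.\<close>
  define b where "b k = (cmod (v k))^2 / a k" for k
  have lim: "a \<longlonglongrightarrow> 0" using tendsto_real_sqrt[OF \<open>r \<longlonglongrightarrow> 0\<close>] by (simp add: a_def[abs_def])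
  have a0: "0 \<le> a k" and aa: "a k * a k = r k" for k using r0 by (auto simp: a_def)
  have b0: "0 \<le> b k" for k using a0 by (simp add: b_def)
  have vr: "(cmod (v k))^2 \<le> a k * a k" for k using step[of k] r0[of "Suc k"] aa by simp
  have "b k \<le> a k" for k
    using vr[of k] a0[of k] by (cases "a k = 0") (auto simp: b_def field_simps)
  moreover have "a k \<le> \<rho>" for k using r_le[of k] \<rho> real_le_lsqrt by (simp add: a_def)
  moreover have "a k * b k = (cmod (v k))^2" for k using vr[of k] by (cases "a k = 0") (auto simp: b_def)
  moreover have bk: "b k \<le> 2 * (a k - a (Suc k))" for k
  proof (cases "a k = 0")
    case True
    then show ?thesis using step[of k] aa[of k] aa[of "Suc k"] r0[of "Suc k"] by (simp add: b_def) (metis add_nonneg_eq_0_iff mult_eq_0_iff order_refl zero_le_power2)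
  next
    case False
    have "a (Suc k) \<le> a k" unfolding a_def using step[of k] by simp
    have "(cmod (v k))^2 = (a k - a (Suc k)) * (a k + a (Suc k))" using step[of k] aa[of k] aa[of "Suc k"] by (simp add: algebra_simps)
    also have "\<dots> \<le> (a k - a (Suc k)) * (2 * a k)" using \<open>a (Suc k) \<le> a k\<close> by (intro mult_left_mono) auto
    finally show ?thesis using False a0[of k] by (simp add: b_def field_simps)
  qed
  moreover have "(\<Sum>k<K. b k) \<le> 2 * \<rho>" for K
  proof -
    have "(\<Sum>k<K. b k) \<le> (\<Sum>k<K. 2 * (a k - a (Suc k)))" by (intro sum_mono bk)
    also have "\<dots> = 2 * (a 0 - a K)" by (induction K) (simp_all add: algebra_simps)
    also have "\<dots> \<le> 2 * \<rho>" using \<open>\<And>k. a k \<le> \<rho>\<close>[of 0] a0[of K] by simp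
    finally show ?thesis .
  qed
  ultimately show ?thesis using that a0 b0 lim by blast
qed

context rochberg_index
begin

text \<open>The functions \<open>f\<^sub>k(z) = sgn v\<^sub>k \<cdot> a\<^sub>k powr (1 - z) \<cdot> b\<^sub>k powr z\<close> with \<open>a\<^sub>k b\<^sub>k = \<bar>v\<^sub>k\<bar>\<^sup>2\<close> and \<open>b \<in> \<ell>\<^sub>1\<close>. The usual
  choice of a constant \<open>a\<close> would not be continuous into \<open>\<ell>\<^sub>\<infinity>\<close> up to the boundary, so \<open>a\<close> is taken in \<open>c\<^sub>0\<close>.\<close>
lemma lift_ex:
  assumes \<rho>: "0 \<le> \<rho>" and v: "\<And>K. (\<Sum>k<K. (cmod (v k))^2) \<le> \<rho>^2"
  shows "\<exists>x. jet_rep True (2 * \<rho>) (2 * \<rho>) x \<and> x 0 = v \<and> (\<forall>k. v k = 0 \<longrightarrow> (\<forall>j. x j k = 0))"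
proof -
  obtain a b :: "nat \<Rightarrow> real" where ab: "\<And>k. 0 \<le> a k" "\<And>k. 0 \<le> b k" "\<And>k. a k \<le> \<rho>" "\<And>k. b k \<le> a k" "a \<longlonglongrightarrow> 0"
    "\<And>K. (\<Sum>k<K. b k) \<le> 2 * \<rho>" "\<And>k. a k * b k = (cmod (v k))^2"
    using tail_weights[OF \<rho> v] by blast
  \<comment> \<open>The factor \<open>sgn (v k)\<close> annihilates the coordinates with
    \<open>v k = 0\<close>, so the logarithms matter only for positive arguments.\<close>
  define f where "f k z = sgn (v k) * exp ((1 - z) * of_real (ln (a k)) + z * of_real (ln (b k)))" for k z
  have pos: "0 < a k \<and> 0 < b k" if "v k \<noteq> 0" for k
    using ab(1,2,7)[of k] that by (metis less_eq_real_def mult_eq_0_iff norm_eq_zero power_not_zero)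
  have fmod: "cmod (f k z) = exp ((1 - Re z) * ln (a k) + Re z * ln (b k))" if "v k \<noteq> 0" for k z
    using that by (simp add: f_def norm_mult norm_sgn)
  have f0: "f k z = 0" if "v k = 0" for k z using that by (simp add: f_def)
  have fle: "cmod (f k z) \<le> a k" if "0 \<le> Re z" for k z
  proof (cases "v k = 0")
    case True then show ?thesis using f0 ab(1) by simp
  next
    case False
    have "ln (b k) \<le> ln (a k)" using pos[OF False] ab(4) by simp
    then have "Re z * ln (b k) \<le> Re z * ln (a k)" using that by (intro mult_left_mono)
    then have "(1 - Re z) * ln (a k) + Re z * ln (b k) \<le> ln (a k)" by (simp add: algebra_simps)
    then have "cmod (f k z) \<le> exp (ln (a k))" unfolding fmod[OF False] by simp
    then show ?thesis using pos[OF False] by simp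
  qed
  define x where "x j k = (if j < n then jet (f k) $ j else 0)" for j k
  have hf: "f k (1/2) = v k" for k
  proof (cases "v k = 0")
    case False
    have "exp (1/2 * ln (a k) + 1/2 * ln (b k)) = sqrt (a k * b k)"
      using pos[OF False] by (simp add: exp_add real_sqrt_mult flip: ln_sqrt)
    also have "\<dots> = cmod (v k)" by (simp add: ab(7))
    finally have e: "exp (1/2 * ln (a k) + 1/2 * ln (b k)) = cmod (v k)" .
    have "f k (1/2) = sgn (v k) * of_real (exp (1/2 * ln (a k) + 1/2 * ln (b k)))"
      by (simp add: f_def exp_of_real[symmetric])
    then show ?thesis unfolding e using False by (simp add: sgn_eq)
  qed (simp add: f0)
  have "jet_rep True (2 * \<rho>) (2 * \<rho>) x"
  proof (rule jet_repI[where f=f and e=a])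
    show "jets x" by (auto simp: jets_def x_def fun_eq_iff)
    show "strip_fun (f k) (a k)" for k
      unfolding strip_fun_def using fle by (auto simp: f_def[abs_def] cstrip_def intro!: continuous_intros holomorphic_intros)
    show "cmod (f k (\<i> * t)) \<le> 2 * \<rho>" for k and t :: real
      using fle[of "\<i> * t" k] ab(3)[of k] \<rho> by simp
    show "(\<Sum>k<K. cmod (f k (1 + \<i> * t))) \<le> 2 * \<rho>" for K and t :: real
    proof -
      have "cmod (f k (1 + \<i> * t)) \<le> b k" for k
      proof (cases "v k = 0")
        case False then show ?thesis using pos[OF False] by (simp add: fmod)
      qed (use f0 ab(2) in simp)
      then show ?thesis using sum_mono[of "{..<K}" "\<lambda>k. cmod (f k (1 + \<i> * t))" b] ab(6)[of K] by force
    qed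
  qed (use ab(5) in \<open>auto simp: x_def\<close>)
  moreover have "x 0 = v" using n_pos hf by (auto simp: x_def fps_expansion_def)
  moreover have "x j k = 0" if "v k = 0" for j k
  proof -
    have "f k = (\<lambda>z. 0)" using f0[OF that] by auto
    then show ?thesis by (simp add: x_def jet_const)
  qed
  ultimately show ?thesis by blast
qed

text \<open>The two columns start at the orders \<open>j\<close> and n-1-j, so the coefficient of
  order n-1 is the product of the leading ones. Pairing with a power of the shift thus isolates a
  single level.\<close>

lemma fterm_level:
  assumes "j < n" "\<And>i. i < j \<Longrightarrow> x i k = 0"
  shows "fterm x (act (fps_X^(n-1-j)) y) k = (-1)^(n-1-j) * (x j k * cnj (y 0 k))"
proof -
  let ?t = "\<lambda>i. x i k * ((-1)^(n-1-i) * cnj (act (fps_X^(n-1-j)) y (n-1-i) k))"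
  have "fterm x (act (fps_X^(n-1-j)) y) k = (\<Sum>i=0..n-1. ?t i)"
    by (simp add: fterm_def fps_mult_nth)
  also have "\<dots> = (\<Sum>i=0..n-1. if i = j then ?t j else 0)"
    using assms(2) by (intro sum.cong refl) (auto simp: act_X_power)
  also have "\<dots> = ?t j" using assms(1) by simp
  finally show ?thesis using assms(1) by (simp add: act_X_power)
qed

text \<open>Against finitely supported \<open>y\<close> the pairing is a finite sum, so the
  condition makes sense before \<open>x\<close> is known to lie in \<open>Z\<close>.\<close>

definition dual_bound :: "real \<Rightarrow> (nat \<Rightarrow> nat \<Rightarrow> complex) \<Rightarrow> bool" where
  "dual_bound D x \<longleftrightarrow> (\<forall>y\<in>Z. finsupp y \<longrightarrow> cmod (form x y) \<le> D * nrm y)"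

text \<open>Test against a shifted lift of a truncation of the level \<open>x j\<close> itself: the
  modulus of the pairing is the square of its ell_2 norm, while the norm of the test vector is only
  linear in it.\<close>

lemma level_bound:
  assumes j: "j < n" and x: "\<forall>i<j. x i = 0" and D: "0 \<le> D" "dual_bound D x"
  shows "(\<Sum>k<K. (cmod (x j k))^2) \<le> (2 * CN^(n-1-j) * D)^2"
proof -
  define \<rho> where "\<rho> = 2 * CN^(n-1-j) * D"
  have \<rho>0: "0 \<le> \<rho>" using CN_ge1 D by (simp add: \<rho>_def)
  define \<sigma> where "\<sigma> = sqrt (\<Sum>k<K. (cmod (x j k))^2)"
  define v where "v k = (if k < K then x j k else 0)" for k
  have s0: "0 \<le> \<sigma>" and s2: "\<sigma>^2 = (\<Sum>k<K. (cmod (x j k))^2)" by (auto simp: \<sigma>_def sum_nonneg)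
  have "(\<Sum>k<L. (cmod (v k))^2) \<le> \<sigma>^2" for L
  proof -
    have "(\<Sum>k<L. (cmod (v k))^2) = (\<Sum>k\<in>{..<L} \<inter> {..<K}. (cmod (x j k))^2)"
      unfolding sum.inter_restrict[OF finite_lessThan] by (intro sum.cong) (auto simp: v_def)
    also have "\<dots> \<le> \<sigma>^2" unfolding s2 by (intro sum_mono2) auto
    finally show ?thesis .
  qed
  from lift_ex[OF s0 this] obtain y where y: "jet_rep True (2*\<sigma>) (2*\<sigma>) y" "y 0 = v" "\<And>k j. v k = 0 \<Longrightarrow> y j k = 0" by blast
  define w where "w = act (fps_X^(n-1-j)) y"
  have "restr {..<K} y = y" using y(3) by (auto simp: fun_eq_iff v_def)
  then have wr: "restr {..<K} w = w" by (simp add: w_def flip: act_restr)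
  have wZ: "w \<in> Z" and wn: "nrm w \<le> CN^(n-1-j) * (2*\<sigma>)"
    using jet_rep_shift_power[OF y(1), of "n-1-j"] nrm_le[OF _ order_refl order_refl] jet_rep_Z by (auto simp: w_def)
  have "fterm x w k = (-1)^(n-1-j) * (x j k * cnj (x j k))" if "k < K" for k
    unfolding w_def using j x that by (subst fterm_level) (auto simp: y(2) v_def)
  then have "form x w = (\<Sum>k<K. (-1)^(n-1-j) * (x j k * cnj (x j k)))"
    unfolding form_finsupp[OF wr] by simp
  also have "\<dots> = (-1)^(n-1-j) * of_real (\<sigma>^2)"
    by (simp add: s2 sum_distrib_left complex_norm_square[symmetric] mult.commute)
  finally have "cmod (form x w) = \<sigma>^2" by (simp add: norm_mult norm_power)
  moreover have "cmod (form x w) \<le> D * nrm w" using D(2) wZ wr unfolding dual_bound_def finsupp_def by blast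
  moreover have "D * nrm w \<le> D * (CN^(n-1-j) * (2*\<sigma>))" using wn D(1) by (rule mult_left_mono)
  ultimately have "\<sigma> * \<sigma> \<le> \<rho> * \<sigma>" by (simp add: \<rho>_def power2_eq_square algebra_simps)
  then have "\<sigma> \<le> \<rho>" using s0 \<rho>0 by (cases "\<sigma> = 0") auto
  then show ?thesis unfolding s2[symmetric] \<rho>_def[symmetric] using s0 by (rule power_mono)
qed

text \<open>Downward induction on the number of vanishing leading levels. The first remaining level
  is in ell_2, hence has a lift; subtracting the j-th shift of the lift leaves one more vanishing
  level, and the dual bound deteriorates only by a constant.\<close>

lemma dual_criterion_aux:
  assumes "j \<le> n"
  shows "\<exists>C\<ge>0. \<forall>x D. jets x \<longrightarrow> (\<forall>i<j. x i = 0) \<longrightarrow> 0 \<le> D \<longrightarrow> dual_bound D x \<longrightarrow> jet_rep True (C * D) (C * D) x"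
  using assms
proof (induction j rule: inc_induct)
  case base
  have "jet_rep True (1 * D) (1 * D) x" if "jets x" "\<forall>i<n. x i = 0" "0 \<le> D" for x D
  proof -
    have "x = 0" using that by (auto simp: jets_def fun_eq_iff) (metis leI zero_fun_apply)
    then show ?thesis using jet_rep_0 that by simp
  qed
  then show ?case by (intro exI[of _ 1] conjI allI impI) (simp, blast)
next
  case (step j)
  then obtain C where C0: "C \<ge> 0" and C: "\<And>x D. jets x \<Longrightarrow> (\<forall>i<Suc j. x i = 0) \<Longrightarrow> 0 \<le> D \<Longrightarrow> dual_bound D x \<Longrightarrow> jet_rep True (C * D) (C * D) x"
    by blast
  \<comment> \<open>The constant of the removed part: \<open>2 * CN^(n-1-j)\<close> from
    \<open>level_bound\<close>, 2 from the lift and \<open>CN^j\<close> from shifting it.\<close>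
  define G where "G = CN^j * (2 * (2 * CN^(n-1-j)))"
  have CN0: "0 \<le> CN" using CN_ge1 by simp
  have G0: "0 \<le> G" using CN0 by (simp add: G_def)
  have "jet_rep True ((C * (1 + 2^(n-1) * G) + G) * D) ((C * (1 + 2^(n-1) * G) + G) * D) x"
    if x: "jets x" "\<forall>i<j. x i = 0" and D: "0 \<le> D" "dual_bound D x" for x D
  proof -
    define \<rho> where "\<rho> = 2 * CN^(n-1-j) * D"
    have \<rho>0: "0 \<le> \<rho>" using CN0 D by (simp add: \<rho>_def)
    have "(\<Sum>k<K. (cmod (x j k))^2) \<le> \<rho>^2" for K
      unfolding \<rho>_def using level_bound[OF step(2) x(2) D] .
    from lift_ex[OF \<rho>0 this] obtain y where y: "jet_rep True (2*\<rho>) (2*\<rho>) y" "y 0 = x j" by blast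
    define w where "w = act (fps_X^j) y"
    have w: "jet_rep True (G * D) (G * D) w"
      using jet_rep_shift_power[OF y(1), of j] by (simp add: w_def G_def \<rho>_def mult.assoc)
    then have wZ: "w \<in> Z" and wn: "nrm w \<le> G * D" using jet_rep_Z nrm_le by blast+
    have xZ: "fterm (x - w) z k = fterm x z k - fterm w z k" for z k
      using fterm_simps(1)[of "x - w" w z k] by simp
    have "dual_bound ((1 + 2^(n-1) * G) * D) (x - w)"
      unfolding dual_bound_def
    proof (intro ballI impI)
      fix z assume z: "z \<in> Z" "finsupp z"
      then obtain K where K: "restr {..<K} z = z" by (auto simp: finsupp_def)
      have "form (x - w) z = form x z - form w z"
        unfolding form_finsupp[OF K] by (simp add: xZ sum_subtractf)
      then have "cmod (form (x - w) z) \<le> cmod (form x z) + cmod (form w z)" by (simp add: norm_triangle_ineq4)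
      also have "\<dots> \<le> D * nrm z + 2^(n-1) * (G * D) * nrm z"
      proof (rule add_mono)
        show "cmod (form x z) \<le> D * nrm z" using D(2) z by (auto simp: dual_bound_def)
        have "cmod (form w z) \<le> 2^(n-1) * nrm w * nrm z" using form_bound[OF wZ z(1)] .
        also have "\<dots> \<le> 2^(n-1) * (G * D) * nrm z" using wn nrm_nonneg[OF z(1)] by (intro mult_right_mono mult_left_mono) auto
        finally show "cmod (form w z) \<le> 2^(n-1) * (G * D) * nrm z" .
      qed
      finally show "cmod (form (x - w) z) \<le> (1 + 2^(n-1) * G) * D * nrm z" by (simp add: algebra_simps)
    qed
    moreover have "\<forall>i<Suc j. (x - w) i = 0"
      using x(2) y(2) step(2) by (auto simp: less_Suc_eq fun_eq_iff w_def act_X_power)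
    ultimately have "jet_rep True (C * ((1 + 2^(n-1) * G) * D)) (C * ((1 + 2^(n-1) * G) * D)) (x - w)"
      using G0 D(1) x(1) wZ by (intro C) (auto simp: Z_jets)
    from jet_rep_add[OF this w] show ?thesis by (simp add: algebra_simps)
  qed
  moreover have "0 \<le> C * (1 + 2^(n-1) * G) + G" using C0 G0 by simp
  ultimately show ?case by blast
qed

lemma dual_criterion_ex:
  "\<exists>C\<ge>1. \<forall>x D. jets x \<longrightarrow> 0 \<le> D \<longrightarrow> dual_bound D x \<longrightarrow> jet_rep True (C * D) (C * D) x"
proof -
  obtain C where C: "C \<ge> 0" "\<And>x D. jets x \<Longrightarrow> 0 \<le> D \<Longrightarrow> dual_bound D x \<Longrightarrow> jet_rep True (C * D) (C * D) x"
    using dual_criterion_aux[of 0] by auto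
  have "jet_rep True (max 1 C * D) (max 1 C * D) x" if "jets x" "0 \<le> D" "dual_bound D x" for x D
    using C(2)[OF that] by (rule jet_rep_mono) (use that in \<open>auto intro: mult_right_mono\<close>)
  then show ?thesis by (intro exI[of _ "max 1 C"] conjI allI impI) simp
qed

definition CD :: real where
  "CD = (SOME C. C \<ge> 1 \<and> (\<forall>x D. jets x \<longrightarrow> 0 \<le> D \<longrightarrow> dual_bound D x \<longrightarrow> jet_rep True (C * D) (C * D) x))"

lemma CD_ge1: "CD \<ge> 1"
  and dual_criterion: "jets x \<Longrightarrow> 0 \<le> D \<Longrightarrow> dual_bound D x \<Longrightarrow> jet_rep True (CD * D) (CD * D) x"
  using someI_ex[OF dual_criterion_ex, folded CD_def] by blast+

lemma dual_criterion_nrm: "jets x \<Longrightarrow> 0 \<le> D \<Longrightarrow> dual_bound D x \<Longrightarrow> x \<in> Z \<and> nrm x \<le> CD * D"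
  using dual_criterion jet_rep_Z nrm_le by blast

lemma Z_dual_bound: "x \<in> Z \<Longrightarrow> dual_bound (2^(n-1) * nrm x) x"
  unfolding dual_bound_def using form_bound by blast

text \<open>Boundedness of the pairing turns a weak representation into a dual bound, and the dual
  criterion returns a representation with decaying coordinates. Hence \<open>Z\<close> consists of
  jets of genuine elements of the Calderon space.\<close>

lemma strong_rep: assumes "x \<in> Z" shows "jet_rep True (CD * (2^(n-1) * nrm x)) (CD * (2^(n-1) * nrm x)) x"
  using assms Z_dual_bound nrm_nonneg Z_jets by (intro dual_criterion) auto

end

section \<open>Comparison with the Calderon space\<close>

lemma linf_coord: assumes "linf x" shows "cmod (x k) \<le> linf_norm x"
  unfolding linf_norm_def using assms bounded_imp_bdd_above unfolding linf_def by (intro cSUP_upper) auto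

lemma linfI: "(\<And>k. cmod (x k) \<le> B) \<Longrightarrow> linf x"
  unfolding linf_def by (rule boundedI[of _ B]) auto

lemma linf_bound: "linf x \<Longrightarrow> \<exists>B. \<forall>k. cmod (x k) \<le> B"
  using linf_coord by blast

lemma linf_diff: assumes "linf x" "linf y" shows "linf (\<lambda>k. x k - y k)"
proof -
  obtain A B where "\<And>k. cmod (x k) \<le> A" "\<And>k. cmod (y k) \<le> B" using assms linf_bound by metis
  then show ?thesis by (intro linfI[of _ "A + B"]) (meson add_mono norm_triangle_ineq4 order_trans)
qed

lemma linf_cmult: assumes "linf x" shows "linf (\<lambda>k. x k / c)"
proof -
  obtain A where "\<And>k. cmod (x k) \<le> A" using assms linf_bound by metis
  then show ?thesis by (intro linfI[of _ "A / cmod c"]) (auto simp: norm_divide divide_right_mono)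
qed

lemma linf_norm_le: "(\<And>k. cmod (x k) \<le> B) \<Longrightarrow> linf_norm x \<le> B"
  unfolding linf_norm_def by (rule cSUP_least) auto

lemma linf_norm_nonneg: "linf x \<Longrightarrow> 0 \<le> linf_norm x"
  using linf_coord[of x 0] norm_ge_zero order_trans by blast

text \<open>Uniform smallness of the tail coordinates reduces convergence in \<open>\<ell>\<^sub>\<infinity>\<close> to coordinatewise convergence.\<close>
lemma linf_norm_tendsto_0:
  assumes ev_all: "\<forall>\<^sub>F w in F. \<forall>k. cmod (g w k) \<le> d k"
    and d: "d \<longlonglongrightarrow> 0" and pt: "\<And>k. ((\<lambda>w. g w k) \<longlongrightarrow> 0) F"
  shows "((\<lambda>w. linf_norm (g w)) \<longlongrightarrow> 0) F"
proof (rule tendstoI)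
  fix \<epsilon> :: real assume e: "\<epsilon> > 0"
  then obtain K where K: "\<And>k. k \<ge> K \<Longrightarrow> d k < \<epsilon>/2"
    using order_tendstoD(2)[OF d, of "\<epsilon>/2"] unfolding eventually_sequentially by auto
  have "\<forall>\<^sub>F w in F. \<forall>k\<in>{..<K}. cmod (g w k) < \<epsilon>/2"
  proof (intro eventually_ball_finite ballI)
    show "\<forall>\<^sub>F w in F. cmod (g w k) < \<epsilon>/2" for k
      using tendstoD[OF pt[of k], of "\<epsilon>/2"] e by simp
  qed simp
  with ev_all show "\<forall>\<^sub>F w in F. dist (linf_norm (g w)) 0 < \<epsilon>"
  proof eventually_elim
    case (elim w)
    have "cmod (g w k) \<le> \<epsilon>/2" for k
    proof (cases "k < K")
      case True then show ?thesis using elim by (simp add: less_imp_le)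
    next
      case False then show ?thesis using elim K[of k] by (meson leI less_imp_le order_trans)
    qed
    then have "linf_norm (g w) \<le> \<epsilon>/2" "0 \<le> linf_norm (g w)"
      using linf_norm_le linfI linf_norm_nonneg by blast+
    then show ?case using e by simp
  qed
qed

context rochberg_index
begin

lemma taylor_coeff_jet: "taylor_coeff f j k = jet (\<lambda>z. f z k) $ j"
  by (simp add: taylor_coeff_def fps_expansion_def)

lemma calderon_jet_rep:
  assumes f: "calderon f" and x: "jets x" "\<And>j. j < n \<Longrightarrow> x j = taylor_coeff f j"
  shows "jet_rep False (calderon_norm f) (calderon_norm f) x"
proof -
  have lf: "linf (f z)" if "z \<in> cstrip" for z using f that by (simp add: calderon_def)
  obtain B where B: "\<And>z. z \<in> cstrip \<Longrightarrow> linf_norm (f z) \<le> B" using f unfolding calderon_def by blast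
  have lo: "lone (f (1 + \<i> * complex_of_real t))" for t using f by (simp add: calderon_def)
  obtain B1 where B1: "\<And>t. lone_norm (f (1 + \<i> * complex_of_real t)) \<le> B1" using f unfolding calderon_def by blast
  have cs: "\<i> * complex_of_real t \<in> cstrip" for t by (simp add: cstrip_def)
  have cont: "continuous_on cstrip (\<lambda>z. f z k)" for k
    unfolding continuous_on_def
  proof
    fix z assume z: "z \<in> cstrip"
    have "((\<lambda>w. linf_norm (\<lambda>k. f w k - f z k)) \<longlongrightarrow> 0) (at z within cstrip)"
      using f z unfolding calderon_def by blast
    then have "((\<lambda>w. f w k - f z k) \<longlongrightarrow> 0) (at z within cstrip)"
    proof (rule Lim_null_comparison[rotated])
      show "\<forall>\<^sub>F w in at z within cstrip. norm (f w k - f z k) \<le> linf_norm (\<lambda>k. f w k - f z k)"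
        unfolding eventually_at_filter
        by (rule always_eventually) (use linf_coord[OF linf_diff[OF lf lf[OF z]]] in blast)
    qed
    then show "((\<lambda>z. f z k) \<longlongrightarrow> f z k) (at z within cstrip)" by (simp add: LIM_zero_cancel)
  qed
  have hol: "(\<lambda>z. f z k) holomorphic_on strip" for k
    unfolding holomorphic_on_open[OF open_strip]
  proof
    fix z assume z: "z \<in> strip"
    then obtain D where D: "linf D" "((\<lambda>w. linf_norm (\<lambda>k. (f w k - f z k) / (w - z) - D k)) \<longlongrightarrow> 0) (at z)"
      using f unfolding calderon_def by blast
    have "((\<lambda>w. (f w k - f z k) / (w - z) - D k) \<longlongrightarrow> 0) (at z)"
      using D(2)
    proof (rule Lim_null_comparison[rotated])
      have "\<forall>\<^sub>F w in at z. w \<in> strip" using open_strip z by (simp add: eventually_at_in_open')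
      then show "\<forall>\<^sub>F w in at z. norm ((f w k - f z k) / (w - z) - D k) \<le> linf_norm (\<lambda>k. (f w k - f z k) / (w - z) - D k)"
      proof eventually_elim
        case (elim w)
        have "linf (\<lambda>k. (f w k - f z k) / (w - z) - D k)"
          using elim z strip_subset_cstrip by (intro linf_diff linf_cmult lf D(1)) auto
        then show ?case by (rule linf_coord)
      qed
    qed
    then have "((\<lambda>w. (f w k - f z k) / (w - z)) \<longlongrightarrow> D k) (at z)" by (simp add: LIM_zero_cancel)
    then show "\<exists>f'. ((\<lambda>z. f z k) has_field_derivative f') (at z)"
      unfolding has_field_derivative_iff by blast
  qed
  have left: "linf_norm (f (\<i> * complex_of_real t)) \<le> calderon_norm f" for t
  proof -
    have "linf_norm (f (\<i> * complex_of_real t)) \<le> (SUP t::real. linf_norm (f (\<i> * complex_of_real t)))"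
      by (rule cSUP_upper) (auto intro!: bdd_aboveI[of _ B] B cs)
    then show ?thesis by (simp add: calderon_norm_def)
  qed
  have right: "lone_norm (f (1 + \<i> * complex_of_real t)) \<le> calderon_norm f" for t
  proof -
    have "lone_norm (f (1 + \<i> * complex_of_real t)) \<le> (SUP t::real. lone_norm (f (1 + \<i> * complex_of_real t)))"
      by (rule cSUP_upper) (auto intro!: bdd_aboveI[of _ B1] B1)
    then show ?thesis by (simp add: calderon_norm_def)
  qed
  show ?thesis
  proof (rule jet_repI[where f="\<lambda>k z. f z k" and e="\<lambda>k. B"])
    show "strip_fun (\<lambda>z. f z k) B" for k
      unfolding strip_fun_def using cont hol order_trans[OF linf_coord[OF lf] B] by blast
    show "cmod (f (\<i> * complex_of_real t) k) \<le> calderon_norm f" for k t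
      using linf_coord[OF lf[OF cs]] left order_trans by blast
    show "(\<Sum>k<K. cmod (f (1 + \<i> * complex_of_real t) k)) \<le> calderon_norm f" for K t
    proof -
      have "(\<Sum>k<K. cmod (f (1 + \<i> * complex_of_real t) k)) \<le> lone_norm (f (1 + \<i> * complex_of_real t))"
        unfolding lone_norm_def using lo by (intro sum_le_suminf) (auto simp: lone_def)
      then show ?thesis using right order_trans by blast
    qed
    show "x j k = jet (\<lambda>z. f z k) $ j" if "j < n" for j k
      using x(2)[OF that] taylor_coeff_jet by simp
  qed (use x(1) in auto)
qed

text \<open>The decay of the bounds \<open>e k\<close> upgrades coordinatewise continuity and
  differentiability to the norm of ell_infty, through \<open>linf_norm_tendsto_0\<close>.\<close>

lemma jet_rep_calderon:
  assumes "jet_rep True r r x"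
  shows "\<exists>f. calderon f \<and> calderon_norm f \<le> r \<and> (\<forall>j<n. x j = taylor_coeff f j)"
proof -
  from assms obtain f e where f: "jets x" "\<And>k. strip_fun (f k) (e k)" "True \<Longrightarrow> e \<longlonglongrightarrow> 0"
    "\<And>k (t::real). cmod (f k (\<i> * t)) \<le> r" "\<And>K (t::real). (\<Sum>k<K. cmod (f k (1 + \<i> * t))) \<le> r"
    "\<And>j k. j < n \<Longrightarrow> x j k = jet (f k) $ j" by (rule jet_repE) blast
  have lim: "e \<longlonglongrightarrow> 0" using f(3) by simp
  obtain B where B: "\<And>k. \<bar>e k\<bar> \<le> B" using convergent_imp_Bseq[of e] lim unfolding Bseq_def convergent_def by auto
  have fe: "cmod (f k z) \<le> e k" if "z \<in> cstrip" for k z using f(2)[of k] that by (simp add: strip_fun_def)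
  have fB: "cmod (f k z) \<le> B" if "z \<in> cstrip" for k z using fe[OF that, of k] B[of k] by simp
  define g where "g z k = f k z" for z k
  have sm: "summable (\<lambda>k. cmod (g (1 + \<i> * complex_of_real t) k))" for t
    by (rule summableI_nonneg_bounded[where x=r]) (use f(5) in \<open>auto simp: g_def\<close>)
  have lone: "lone_norm (g (1 + \<i> * complex_of_real t)) \<le> r" for t
    unfolding lone_norm_def by (rule suminf_le_const[OF sm]) (use f(5) in \<open>simp add: g_def\<close>)
  have "calderon g"
    unfolding calderon_def
  proof (intro conjI ballI allI)
    show "linf (g z)" if "z \<in> cstrip" for z using fB[OF that] by (intro linfI) (simp add: g_def)
    show "\<exists>B. \<forall>z\<in>cstrip. linf_norm (g z) \<le> B" using fB by (intro exI[of _ B] ballI linf_norm_le) (simp add: g_def)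
    show "lone (g (1 + \<i> * complex_of_real t))" for t using sm by (simp add: lone_def)
    show "\<exists>B. \<forall>t. lone_norm (g (1 + \<i> * complex_of_real t)) \<le> B" using lone by blast
    show "((\<lambda>w. linf_norm (\<lambda>k. g w k - g z k)) \<longlongrightarrow> 0) (at z within cstrip)" if z: "z \<in> cstrip" for z
    proof (rule linf_norm_tendsto_0[where d="\<lambda>k. 2 * e k"])
      have "cmod (g w k - g z k) \<le> 2 * e k" if "w \<in> cstrip" for w k
        using fe[OF that, of k] fe[OF z, of k] norm_triangle_ineq4[of "g w k" "g z k"] by (simp add: g_def)
      then show "\<forall>\<^sub>F w in at z within cstrip. \<forall>k. cmod (g w k - g z k) \<le> 2 * e k"
        unfolding eventually_at_filter by (intro always_eventually) blast
      show "(\<lambda>k. 2 * e k) \<longlonglongrightarrow> 0" using tendsto_mult_right_zero[OF lim] .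
      have "((\<lambda>w. g w k) \<longlongrightarrow> g z k) (at z within cstrip)" for k
        using f(2)[of k] z unfolding strip_fun_def continuous_on_def g_def by blast
      then show "((\<lambda>w. g w k - g z k) \<longlongrightarrow> 0) (at z within cstrip)" for k by (rule LIM_zero)
    qed
    show "\<exists>D. linf D \<and> ((\<lambda>w. linf_norm (\<lambda>k. (g w k - g z k) / (w - z) - D k)) \<longlongrightarrow> 0) (at z)" if z: "z \<in> strip" for z
    proof -
      obtain \<rho> where \<rho>: "\<rho> > 0" "ball z \<rho> \<subseteq> strip" using open_strip z openE by blast
      have der: "(f k has_field_derivative deriv (f k) w) (at w)" if "w \<in> strip" for k w
        using f(2)[of k] that open_strip holomorphic_derivI unfolding strip_fun_def by blast
      \<comment> \<open>Cauchy's estimate on discs of radius \<open>\<rho>/4\<close>: the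
        derivatives, and with them the difference quotients, inherit the decay of
        \<open>e\<close>.\<close>
      define M where "M k = e k * 4 / \<rho>" for k
      have db: "cmod (deriv (f k) w) \<le> M k" if w: "w \<in> ball z (\<rho>/2)" for k w
      proof -
        have b: "cball w (\<rho>/4) \<subseteq> strip"
        proof
          fix u assume "u \<in> cball w (\<rho>/4)"
          then have "dist z u < \<rho>" using w \<rho>(1) dist_triangle[of z u w] by simp
          then show "u \<in> strip" using \<rho> by auto
        qed
        have hol: "f k holomorphic_on strip" using f(2)[of k] by (simp add: strip_fun_def)
        have "cmod ((deriv ^^ 1) (f k) w) \<le> fact 1 * e k / (\<rho>/4)^1"
        proof (rule Cauchy_inequality)
          show "f k holomorphic_on ball w (\<rho>/4)" using hol b ball_subset_cball holomorphic_on_subset by blast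
          show "continuous_on (cball w (\<rho>/4)) (f k)" using hol b holomorphic_on_subset holomorphic_on_imp_continuous_on by blast
          show "cmod (f k u) \<le> e k" if "cmod (w - u) = \<rho>/4" for u
          proof -
            have "u \<in> cball w (\<rho>/4)" using that by (simp add: dist_norm)
            then show ?thesis using b strip_subset_cstrip fe by blast
          qed
        qed (use \<rho> in simp)
        then show ?thesis by (simp add: M_def)
      qed
      have zb: "z \<in> ball z (\<rho>/2)" using \<rho>(1) by simp
      have qb: "cmod ((f k w - f k z) / (w - z)) \<le> M k" if w: "w \<in> ball z (\<rho>/2)" "w \<noteq> z" for k w
      proof -
        have sub: "ball z (\<rho>/2) \<subseteq> strip" using \<rho> by force
        have "cmod (f k w - f k z) \<le> M k * cmod (w - z)"
        proof (rule field_differentiable_bound[where S="ball z (\<rho>/2)" and f'="deriv (f k)"])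
          show "(f k has_field_derivative deriv (f k) u) (at u within ball z (\<rho>/2))" if "u \<in> ball z (\<rho>/2)" for u
            using der[of u k] sub that by (meson has_field_derivative_at_within subsetD)
        qed (use db w zb in auto)
        then show ?thesis using w(2) by (simp add: norm_divide field_simps)
      qed
      define D where "D k = deriv (f k) z" for k
      have "linf D"
      proof (rule linfI)
        fix k
        have "cmod (D k) \<le> M k" unfolding D_def by (rule db[OF zb])
        also have "\<dots> \<le> B * 4 / \<rho>" unfolding M_def using B[of k] \<rho>(1) by (intro divide_right_mono mult_right_mono) auto
        finally show "cmod (D k) \<le> B * 4 / \<rho>" .
      qed
      moreover have "((\<lambda>w. linf_norm (\<lambda>k. (g w k - g z k) / (w - z) - D k)) \<longlongrightarrow> 0) (at z)"
      proof (rule linf_norm_tendsto_0[where d="\<lambda>k. 2 * M k"])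
        have "\<forall>\<^sub>F w in at z. w \<in> ball z (\<rho>/2) - {z}"
          using \<rho>(1) by (intro eventually_at_in_open) auto
        then show "\<forall>\<^sub>F w in at z. \<forall>k. cmod ((g w k - g z k) / (w - z) - D k) \<le> 2 * M k"
        proof eventually_elim
          case (elim w)
          show ?case
          proof
            fix k
            have "cmod ((f k w - f k z) / (w - z) - D k) \<le> M k + M k"
              using qb[of w k] db[OF zb, of k] elim norm_triangle_ineq4[of "(f k w - f k z) / (w - z)" "D k"]
              by (simp add: D_def)
            then show "cmod ((g w k - g z k) / (w - z) - D k) \<le> 2 * M k" by (simp add: g_def)
          qed
        qed
        show "(\<lambda>k. 2 * M k) \<longlonglongrightarrow> 0"
          using tendsto_mult_right_zero[OF lim, of "8 / \<rho>"] by (simp add: M_def mult.commute)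
        show "((\<lambda>w. (g w k - g z k) / (w - z) - D k) \<longlongrightarrow> 0) (at z)" for k
          using der[OF z, of k] unfolding has_field_derivative_iff g_def D_def by (rule LIM_zero)
      qed
      ultimately show ?thesis by blast
    qed
  qed
  moreover have "calderon_norm g \<le> r"
    unfolding calderon_norm_def
  proof (rule max.boundedI)
    show "(SUP t::real. linf_norm (g (\<i> * complex_of_real t))) \<le> r"
      using f(4) by (intro cSUP_least linf_norm_le) (auto simp: g_def)
    show "(SUP t::real. lone_norm (g (1 + \<i> * complex_of_real t))) \<le> r"
      using lone by (intro cSUP_least) auto
  qed
  moreover have "x j = taylor_coeff g j" if "j < n" for j
    using f(6)[OF that] by (intro ext) (simp add: taylor_coeff_jet g_def)
  ultimately show ?thesis by blast
qed

lemma rochberg_eq: "rochberg n = Z"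
proof
  show "rochberg n \<subseteq> Z"
    using calderon_jet_rep jet_rep_Z unfolding rochberg_def jets_def zero_fun_def by blast
  show "Z \<subseteq> rochberg n"
  proof
    fix x assume x: "x \<in> Z"
    then show "x \<in> rochberg n"
      using jet_rep_calderon[OF strong_rep[OF x]] Z_jets[OF x] unfolding rochberg_def jets_def zero_fun_def by blast
  qed
qed

text \<open>A Calderon function is itself a weak representation with the same bound; conversely
  \<open>strong_rep\<close> yields a Calderon function at the cost of the factor
  \<open>CD * 2^(n-1)\<close>.\<close>

lemma zn_norm_bounds: assumes "x \<in> Z" shows "nrm x \<le> zn_norm n x" "zn_norm n x \<le> CD * 2^(n-1) * nrm x"
proof -
  let ?S = "{calderon_norm f | f. calderon f \<and> (\<forall>j<n. x j = taylor_coeff f j)}"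
  have lb: "nrm x \<le> r" if "r \<in> ?S" for r
    using that calderon_jet_rep[OF _ Z_jets[OF assms]] nrm_le by blast
  obtain f where f: "calderon f" "calderon_norm f \<le> CD * (2^(n-1) * nrm x)" "\<forall>j<n. x j = taylor_coeff f j"
    using jet_rep_calderon[OF strong_rep[OF assms]] by blast
  have mem: "calderon_norm f \<in> ?S" using f by blast
  show "nrm x \<le> zn_norm n x" unfolding zn_norm_def using mem lb by (intro cInf_greatest) blast+
  have "zn_norm n x \<le> calderon_norm f"
    unfolding zn_norm_def using mem lb by (intro cInf_lower bdd_belowI[where m="nrm x"]) blast+
  then show "zn_norm n x \<le> CD * 2^(n-1) * nrm x" using f(2) by (simp add: mult.assoc)
qed

end

section \<open>Bounded functionals and operators\<close>

text \<open>As simplification rules these eta-expand arrays and thereby hide sums of arrays.\<close>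
declare restr_apply [simp del] zscale_apply [simp del] plus_fun_apply [simp del] zero_fun_apply [simp del]

lemmas pointwise = restr_apply zscale_apply plus_fun_apply zero_fun_apply

context rochberg_index
begin

text \<open>These are the far-out vectors. \<open>W K\<close> has finite codimension: the
  \<open>unitv j k\<close> with \<open>j < n\<close> and \<open>k < K\<close> span a
  complement.\<close>

definition W :: "nat \<Rightarrow> (nat \<Rightarrow> nat \<Rightarrow> complex) set" where
  "W K = {x \<in> Z. restr {K..} x = x}"

lemma W_Z: "x \<in> W K \<Longrightarrow> x \<in> Z" by (simp add: W_def)

lemma restr_W: "x \<in> Z \<Longrightarrow> restr {K..} x \<in> W K"
  by (simp add: W_def Z_restr restr_simps)

lemma W_mono: assumes "K \<le> L" "x \<in> W L" shows "x \<in> W K"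
proof -
  have "restr {K..} (restr {L..} x) = restr {L..} x" using assms(1) by (auto simp: fun_eq_iff pointwise)
  then show ?thesis using assms(2) by (simp add: W_def)
qed

text \<open>The multiplier exp (s (z - 1/2)) has modulus exp (-s/2) on the left line and exp (s/2)
  on the right one; \<open>s = ln (a / b)\<close> makes both bounds equal to their geometric
  mean.\<close>

lemma jet_rep_balance:
  assumes "jet_rep P a b x" "a > 0" "b > 0"
  shows "jet_rep P (sqrt (a * b)) (sqrt (a * b)) (act (fps_exp (of_real (ln (a / b)))) x)"
proof -
  define s where "s = ln (a / b)"
  have es: "exp (s/2) = sqrt (a / b)" "exp (-s/2) = sqrt (b / a)"
  proof -
    have "exp (s/2) = exp (ln (sqrt (a / b)))" using assms by (simp add: s_def ln_sqrt)
    then show "exp (s/2) = sqrt (a / b)" using assms by simp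
    then show "exp (-s/2) = sqrt (b / a)" by (simp add: exp_minus real_sqrt_divide)
  qed
  have "cmod (exp (of_real s * (\<i> * of_real t - 1/2))) \<le> exp (-s/2)" for t by simp
  moreover have "cmod (exp (of_real s * (1 + \<i> * of_real t - 1/2))) \<le> exp (s/2)" for t by simp
  ultimately have "jet_rep P (exp (-s/2) * a) (exp (s/2) * b) (act (jet (\<lambda>z. exp (of_real s * (z - 1/2)))) x)"
    by (intro jet_rep_act[OF assms(1) strip_fun_exp])
  moreover have "exp (-s/2) * a = sqrt (a * b)" "exp (s/2) * b = sqrt (a * b)"
    unfolding es using assms(2,3) by (simp_all add: real_sqrt_divide real_sqrt_mult real_div_sqrt field_simps)
  ultimately show ?thesis by (simp add: jet_exp s_def)
qed

lemma act_exp_exp: "jets x \<Longrightarrow> act (fps_exp s) (act (fps_exp (- s)) x) = x"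
  by (simp add: act_act act_1 fps_exp_add_mult[symmetric])

text \<open>On the tail of a decaying representation the left bound \<delta> is as small as desired
  while the right bound stays at r. Balancing gives norm sqrt (\<delta> r), and undoing the
  exponential costs only a polynomial in m = ln (r / \<delta>), against the gain exp (- m / 2). In
  particular finitely supported vectors are dense.\<close>

lemma restr_tail_small:
  assumes x: "x \<in> Z" and \<epsilon>: "\<epsilon> > 0"
  shows "\<exists>K. \<forall>L\<ge>K. nrm (restr {L..} x) \<le> \<epsilon>"
proof -
  obtain r where r: "r > 0" "jet_rep True r r x"
  proof
    show "jet_rep True (CD * (2^(n-1) * nrm x) + 1) (CD * (2^(n-1) * nrm x) + 1) x"
      using strong_rep[OF x] by (rule jet_rep_mono) auto
    show "CD * (2^(n-1) * nrm x) + 1 > 0" using CD_ge1 nrm_nonneg[OF x] by (simp add: add_nonneg_pos)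
  qed
  from r(2) obtain f e where f: "jets x" "\<And>k. strip_fun (f k) (e k)" "True \<Longrightarrow> e \<longlonglongrightarrow> 0"
    "\<And>k (t::real). cmod (f k (\<i> * t)) \<le> r" "\<And>K (t::real). (\<Sum>k<K. cmod (f k (1 + \<i> * t))) \<le> r"
    "\<And>j k. j < n \<Longrightarrow> x j k = jet (f k) $ j" by (rule jet_repE) blast
  have lim: "(\<lambda>m. r * (\<Sum>i<n. CN^i / fact i * ((real m)^i * exp (- real m / 2)))) \<longlonglongrightarrow> r * (\<Sum>i<n. CN^i / fact i * 0)"
  proof (intro tendsto_mult tendsto_sum tendsto_const)
    fix i
    have "((\<lambda>u::real. u^i / exp u) \<longlongrightarrow> 0) at_top" by (rule tendsto_power_div_exp_0)
    moreover have "filterlim (\<lambda>m. real m / 2) at_top sequentially"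
      using filterlim_tendsto_pos_mult_at_top[OF tendsto_const[of "1/2::real"] _ filterlim_real_sequentially] by simp
    ultimately have "(\<lambda>m. (real m / 2)^i / exp (real m / 2)) \<longlonglongrightarrow> 0" by (rule filterlim_compose)
    then have "(\<lambda>m. 2^i * ((real m / 2)^i / exp (real m / 2))) \<longlonglongrightarrow> 0" by (rule tendsto_mult_right_zero)
    moreover have "2^i * ((real m / 2)^i / exp (real m / 2)) = (real m)^i * exp (- real m / 2)" for m
      by (simp add: power_divide exp_minus divide_simps)
    ultimately show "(\<lambda>m. (real m)^i * exp (- real m / 2)) \<longlonglongrightarrow> 0" by (simp only:)
  qed
  obtain m where m: "r * (\<Sum>i<n. CN^i / fact i * ((real m)^i * exp (- real m / 2))) < \<epsilon>"
    using order_tendstoD(2)[OF lim, of \<epsilon>] \<epsilon> unfolding eventually_sequentially by auto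
  define \<delta> where "\<delta> = r * exp (- real m)"
  have \<delta>: "\<delta> > 0" using r by (simp add: \<delta>_def)
  obtain K where K: "\<And>k. k \<ge> K \<Longrightarrow> e k < \<delta>"
    using order_tendstoD(2)[OF f(3), of \<delta>] \<delta> unfolding eventually_sequentially by auto
  have "nrm (restr {L..} x) \<le> \<epsilon>" if L: "L \<ge> K" for L
  proof -
    define h where "h k = (if k \<ge> L then f k else (\<lambda>z. 0))" for k
    have "jet_rep False \<delta> r (restr {L..} x)"
    proof (rule jet_repI[where f=h and e=e])
      show "strip_fun (h k) (e k)" for k
        using f(2)[of k] strip_fun_bound_nonneg[OF f(2)[of k]] by (simp add: h_def strip_fun_def)
      show "cmod (h k (\<i> * t)) \<le> \<delta>" for k and t :: real
      proof (cases "k \<ge> L")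
        case True
        have "cmod (f k (\<i> * t)) \<le> e k" using f(2)[of k] by (simp add: strip_fun_def cstrip_def)
        then show ?thesis using True L K[of k] by (simp add: h_def)
      qed (use \<delta> in \<open>simp add: h_def\<close>)
      show "(\<Sum>k<N. cmod (h k (1 + \<i> * t))) \<le> r" for N and t :: real
      proof -
        have "(\<Sum>k<N. cmod (h k (1 + \<i> * t))) \<le> (\<Sum>k<N. cmod (f k (1 + \<i> * t)))"
          by (intro sum_mono) (simp add: h_def)
        also have "\<dots> \<le> r" by (rule f(5))
        finally show ?thesis .
      qed
      show "restr {L..} x j k = jet (h k) $ j" if "j < n" for j k
        using f(6)[OF that] by (simp add: h_def jet_const pointwise)
    qed (use f in simp_all)
    from jet_rep_balance[OF this \<delta> r(1)]
    have rep: "jet_rep False (sqrt (\<delta> * r)) (sqrt (\<delta> * r)) (act (fps_exp (of_real (- real m))) (restr {L..} x))"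
      using r(1) by (simp add: \<delta>_def)
    have sq: "sqrt (\<delta> * r) = r * exp (- real m / 2)"
    proof -
      have "\<delta> * r = (r * exp (- real m / 2))^2" by (simp add: \<delta>_def power2_eq_square exp_add[symmetric])
      then show ?thesis using r(1) by simp
    qed
    have yZ: "act (fps_exp (of_real (- real m))) (restr {L..} x) \<in> Z" using rep by (rule jet_rep_Z)
    have yn: "nrm (act (fps_exp (of_real (- real m))) (restr {L..} x)) \<le> r * exp (- real m / 2)"
      using nrm_le[OF rep] by (simp add: sq)
    have "restr {L..} x = act (fps_exp (of_real (real m))) (act (fps_exp (of_real (- real m))) (restr {L..} x))"
      using act_exp_exp[of "restr {L..} x" "of_real (real m)"] f(1) by simp
    then have "nrm (restr {L..} x) \<le> opn (fps_exp (of_real (real m))) * nrm (act (fps_exp (of_real (- real m))) (restr {L..} x))"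
      using Z_act(2)[OF yZ, of "fps_exp (of_real (real m))"] by simp
    also have "\<dots> \<le> opn (fps_exp (of_real (real m))) * (r * exp (- real m / 2))"
      using yn opn_nonneg by (rule mult_left_mono)
    also have "\<dots> = r * (\<Sum>i<n. CN^i / fact i * ((real m)^i * exp (- real m / 2)))"
      by (simp add: opn_def norm_divide norm_power sum_distrib_left sum_distrib_right algebra_simps)
    finally show ?thesis using m by simp
  qed
  then show ?thesis by blast
qed

lemma Z_sum_mem: "(\<And>i. i \<in> I \<Longrightarrow> x i \<in> Z) \<Longrightarrow> (\<Sum>i\<in>I. x i) \<in> Z"
  using Z_sum[of I x] by blast

lemma restr_split: "x = restr {..<K} x + restr {K..} x"
  by (auto simp: fun_eq_iff pointwise)

lemma finsupp_expand:
  assumes "jets y" "restr {..<K} y = y"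
  shows "y = (\<Sum>k<K. \<Sum>j<n. zscale (y j k) (unitv j k))"
proof (intro ext)
  fix j' k'
  have "(\<Sum>k<K. \<Sum>j<n. zscale (y j k) (unitv j k)) j' k' = (\<Sum>k<K. \<Sum>j<n. if j = j' then (if k = k' then y j k else 0) else 0)"
    unfolding sum_fun_apply2 by (intro sum.cong refl) (auto simp: unitv_def pointwise)
  also have "\<dots> = (\<Sum>k<K. if k = k' then (if j' < n then y j' k' else 0) else 0)"
    by (intro sum.cong refl) auto
  also have "\<dots> = (if k' < K then (if j' < n then y j' k' else 0) else 0)" by simp
  also have "\<dots> = y j' k'"
  proof -
    have "y j' k' = 0" if "\<not> k' < K" using assms(2) that by (metis lessThan_iff restr_apply)
    moreover have "y j' k' = 0" if "\<not> j' < n" using assms(1) that by (simp add: jets_def pointwise)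
    ultimately show ?thesis by auto
  qed
  finally show "y j' k' = (\<Sum>k<K. \<Sum>j<n. zscale (y j k) (unitv j k)) j' k'" by simp
qed

section \<open>Representation of functionals, bounded operators and adjoints\<close>

lemma form_nondegenerate: assumes "x \<in> Z" "\<And>y. y \<in> Z \<Longrightarrow> form x y = 0" shows "x = 0"
proof -
  have "dual_bound 0 x" using assms by (simp add: dual_bound_def)
  then have "nrm x \<le> 0" using dual_criterion_nrm[of x 0] Z_jets[OF assms(1)] by simp
  then show ?thesis using nrm_eq_0[OF assms(1)] nrm_nonneg[OF assms(1)] by simp
qed

text \<open>The values on unit vectors dictate the coordinates of the representing array; the dual
  criterion puts it into \<open>Z\<close>, and density of the finitely supported vectors extends the
  identity to all of \<open>Z\<close>.\<close>

lemma functional_representation: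
  assumes add: "\<And>x y. x \<in> Z \<Longrightarrow> y \<in> Z \<Longrightarrow> \<phi> (x + y) = \<phi> x + \<phi> y"
    and scale: "\<And>c x. x \<in> Z \<Longrightarrow> \<phi> (zscale c x) = cnj c * \<phi> x"
    and bd: "\<And>x. x \<in> Z \<Longrightarrow> cmod (\<phi> x) \<le> C * nrm x" and C: "C \<ge> 0"
  shows "\<exists>a\<in>Z. nrm a \<le> CD * C \<and> (\<forall>y\<in>Z. \<phi> y = form a y)"
proof -
  \<comment> \<open>The pairing couples level \<open>i\<close> of \<open>a\<close> with level n-1-i
    of the other argument, with the sign (-1)^(n-1-i); the same sign here compensates it.\<close>
  define a where "a i k = (if i < n then (-1)^(n-1-i) * \<phi> (unitv (n-1-i) k) else 0)" for i k
  have ja: "jets a" by (auto simp: jets_def a_def fun_eq_iff pointwise)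
  have \<phi>0: "\<phi> 0 = 0" using scale[of 0 0] by (simp add: zscale_simps)
  have \<phi>sum: "\<phi> (\<Sum>i\<in>I. x i) = (\<Sum>i\<in>I. \<phi> (x i))" if "\<And>i. i \<in> I \<Longrightarrow> x i \<in> Z" for I :: "nat set" and x
    using that
  proof (induction I rule: infinite_finite_induct)
    case (insert i I)
    then have "x i \<in> Z" "sum x I \<in> Z" using Z_sum[of I x] by auto
    moreover have "\<phi> (sum x I) = (\<Sum>i\<in>I. \<phi> (x i))" using insert by blast
    ultimately show ?case by (simp only: sum.insert[OF insert.hyps(1,2)] add)
  qed (simp_all only: sum.infinite sum.empty \<phi>0 simp_thms)
  have fin: "\<phi> y = form a y" if y: "y \<in> Z" "restr {..<K} y = y" for y K
  proof -
    have mem: "zscale (y j k) (unitv j k) \<in> Z" if "j < n" for j k using that unitv_Z Z_scale by blast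
    have "\<phi> y = \<phi> (\<Sum>k<K. \<Sum>j<n. zscale (y j k) (unitv j k))"
      by (rule arg_cong[where f=\<phi>]) (rule finsupp_expand[OF Z_jets[OF y(1)] y(2)])
    also have "\<dots> = (\<Sum>k<K. \<phi> (\<Sum>j<n. zscale (y j k) (unitv j k)))"
      using mem by (intro \<phi>sum Z_sum_mem) simp
    also have "\<dots> = (\<Sum>k<K. \<Sum>j<n. cnj (y j k) * \<phi> (unitv j k))"
    proof (intro sum.cong refl)
      fix k
      have "\<phi> (\<Sum>j<n. zscale (y j k) (unitv j k)) = (\<Sum>j<n. \<phi> (zscale (y j k) (unitv j k)))"
        using mem by (intro \<phi>sum) simp
      also have "\<dots> = (\<Sum>j<n. cnj (y j k) * \<phi> (unitv j k))"
        using unitv_Z by (intro sum.cong refl scale) simp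
      finally show "\<phi> (\<Sum>j<n. zscale (y j k) (unitv j k)) = (\<Sum>j<n. cnj (y j k) * \<phi> (unitv j k))" .
    qed
    also have "\<dots> = (\<Sum>k<K. fterm a y k)"
    proof (intro sum.cong refl)
      fix k
      have "fterm a y k = (\<Sum>i=0..n-1. a i k * ((-1)^(n-1-i) * cnj (y (n-1-i) k)))"
        by (simp add: fterm_def fps_mult_nth)
      also have "\<dots> = (\<Sum>i<n. a i k * ((-1)^(n-1-i) * cnj (y (n-1-i) k)))"
        using n_pos by (intro sum.cong) auto
      also have "\<dots> = (\<Sum>i<n. cnj (y (n - Suc i) k) * \<phi> (unitv (n - Suc i) k))"
      proof (intro sum.cong refl)
        fix i assume i: "i \<in> {..<n}"
        have e: "n - Suc i = n - 1 - i" by simp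
        have "a i k * ((-1)^(n-1-i) * cnj (y (n-1-i) k))
            = ((-1)^(n-1-i) * (-1)^(n-1-i)) * (cnj (y (n-1-i) k) * \<phi> (unitv (n-1-i) k))"
          using i by (simp add: a_def)
        also have "(-1::complex)^(n-1-i) * (-1)^(n-1-i) = 1" by (simp flip: power_mult_distrib)
        finally show "a i k * ((-1)^(n-1-i) * cnj (y (n-1-i) k)) = cnj (y (n - Suc i) k) * \<phi> (unitv (n - Suc i) k)"
          unfolding e by simp
      qed
      also have "\<dots> = (\<Sum>i<n. cnj (y i k) * \<phi> (unitv i k))" by (rule sum.nat_diff_reindex)
      finally show "(\<Sum>j<n. cnj (y j k) * \<phi> (unitv j k)) = fterm a y k" by simp
    qed
    also have "\<dots> = form a y" using form_finsupp[OF y(2)] by simp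
    finally show ?thesis .
  qed
  have "dual_bound C a" unfolding dual_bound_def finsupp_def using fin bd by metis
  then have aZ: "a \<in> Z" and an: "nrm a \<le> CD * C" using dual_criterion_nrm[OF ja C] by auto
  have "\<phi> y = form a y" if y: "y \<in> Z" for y
  proof -
    have "cmod (\<phi> y - form a y) \<le> 0 + \<epsilon>" if "\<epsilon> > 0" for \<epsilon>
    proof -
      define D where "D = C + 2^(n-1) * nrm a"
      have D: "D \<ge> 0" using C nrm_nonneg[OF aZ] by (simp add: D_def)
      obtain K where K: "nrm (restr {K..} y) \<le> \<epsilon> / (D + 1)"
        using restr_tail_small[OF y, of "\<epsilon> / (D + 1)"] \<open>\<epsilon> > 0\<close> D by auto
      have m: "restr {..<K} y \<in> Z" "restr {K..} y \<in> Z" using y Z_restr by auto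
      have "\<phi> y - form a y = (\<phi> (restr {..<K} y) + \<phi> (restr {K..} y)) - (form a (restr {..<K} y) + form a (restr {K..} y))"
        using add[OF m] form_add_right[OF aZ m] restr_split[of y K] by simp
      also have "\<phi> (restr {..<K} y) = form a (restr {..<K} y)"
        by (rule fin[OF m(1), of K]) (simp add: restr_simps)
      finally have "\<phi> y - form a y = \<phi> (restr {K..} y) - form a (restr {K..} y)" by simp
      then have "cmod (\<phi> y - form a y) \<le> cmod (\<phi> (restr {K..} y)) + cmod (form a (restr {K..} y))"
        by (simp add: norm_triangle_ineq4)
      also have "\<dots> \<le> C * nrm (restr {K..} y) + 2^(n-1) * nrm a * nrm (restr {K..} y)"
        using bd[OF m(2)] form_bound[OF aZ m(2)] by (rule add_mono)
      also have "\<dots> = D * nrm (restr {K..} y)" by (simp add: D_def algebra_simps)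
      also have "\<dots> \<le> (D + 1) * (\<epsilon> / (D + 1))" using K D nrm_nonneg[OF m(2)] by (intro mult_mono) auto
      finally show ?thesis using D by simp
    qed
    then have "cmod (\<phi> y - form a y) \<le> 0" by (rule field_le_epsilon)
    then show ?thesis by simp
  qed
  then show ?thesis using aZ an by blast
qed

definition zbop :: "((nat \<Rightarrow> nat \<Rightarrow> complex) \<Rightarrow> (nat \<Rightarrow> nat \<Rightarrow> complex)) \<Rightarrow> bool" where
  "zbop T \<longleftrightarrow> (\<forall>x\<in>Z. T x \<in> Z) \<and> (\<forall>x\<in>Z. \<forall>y\<in>Z. T (x + y) = T x + T y) \<and>
     (\<forall>c. \<forall>x\<in>Z. T (zscale c x) = zscale c (T x)) \<and> (\<exists>C\<ge>0. \<forall>x\<in>Z. nrm (T x) \<le> C * nrm x)"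

lemma zbopD: assumes "zbop T"
  shows "x \<in> Z \<Longrightarrow> T x \<in> Z" "x \<in> Z \<Longrightarrow> y \<in> Z \<Longrightarrow> T (x + y) = T x + T y"
    "x \<in> Z \<Longrightarrow> T (zscale c x) = zscale c (T x)"
  using assms by (auto simp: zbop_def)

lemma zbop_bound: assumes "zbop T" obtains C where "C \<ge> 0" "\<And>x. x \<in> Z \<Longrightarrow> nrm (T x) \<le> C * nrm x"
  using assms unfolding zbop_def by blast

lemma zbop_0: "zbop T \<Longrightarrow> T 0 = 0"
  using zbopD(3)[of T 0 0] by (simp add: zscale_simps)

lemma zbop_diff: assumes "zbop T" "x \<in> Z" "y \<in> Z" shows "T (x - y) = T x - T y"
  using zbopD(2)[OF assms(1), of "x - y" y] Z_diff(1)[OF assms(2,3)] assms(3) by simp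

lemma zbop_sum: assumes "zbop T" "\<And>i. i \<in> I \<Longrightarrow> x i \<in> Z" shows "T (\<Sum>i\<in>I. x i) = (\<Sum>i\<in>I. T (x i))"
  using assms(2)
proof (induction I rule: infinite_finite_induct)
  case (insert i I)
  then have "x i \<in> Z" "sum x I \<in> Z" using Z_sum[of I x] by auto
  moreover have "T (sum x I) = (\<Sum>i\<in>I. T (x i))" using insert by blast
  ultimately show ?case by (simp only: sum.insert[OF insert.hyps(1,2)] zbopD(2)[OF assms(1)])
qed (simp_all only: sum.infinite sum.empty zbop_0[OF assms(1)] simp_thms)

lemma zbop_comp: assumes "zbop S" "zbop T" shows "zbop (\<lambda>x. S (T x))"
proof -
  obtain C where C: "C \<ge> 0" "\<And>x. x \<in> Z \<Longrightarrow> nrm (S x) \<le> C * nrm x" using zbop_bound[OF assms(1)] by blast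
  obtain D where D: "D \<ge> 0" "\<And>x. x \<in> Z \<Longrightarrow> nrm (T x) \<le> D * nrm x" using zbop_bound[OF assms(2)] by blast
  have "nrm (S (T x)) \<le> (C * D) * nrm x" if "x \<in> Z" for x
  proof -
    have "nrm (S (T x)) \<le> C * nrm (T x)" using C(2) zbopD(1)[OF assms(2) that] by blast
    also have "\<dots> \<le> C * (D * nrm x)" using D(2)[OF that] C(1) by (rule mult_left_mono)
    finally show ?thesis by (simp add: mult.assoc)
  qed
  then have "\<exists>C\<ge>0. \<forall>x\<in>Z. nrm (S (T x)) \<le> C * nrm x" using C(1) D(1) by (intro exI[of _ "C * D"]) auto
  then show ?thesis unfolding zbop_def using zbopD[OF assms(1)] zbopD[OF assms(2)] by auto
qed

lemma zbop_act: "zbop (act F)"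
  unfolding zbop_def using Z_act opn_nonneg by (auto simp: act_simps intro!: exI[of _ "opn F"])

lemma zbop_restr: "zbop (restr S)"
  unfolding zbop_def using Z_restr by (auto simp: restr_simps intro!: exI[of _ 1])

text \<open>The functional y -> form x (T y) is represented by some T' x; nondegeneracy makes it
  unique, hence linear in x.\<close>

lemma adjoint_ex: assumes T: "zbop T"
  shows "\<exists>T'. zbop T' \<and> (\<forall>x\<in>Z. \<forall>y\<in>Z. form (T' x) y = form x (T y))"
proof -
  obtain C where C: "C \<ge> 0" "\<And>x. x \<in> Z \<Longrightarrow> nrm (T x) \<le> C * nrm x" using zbop_bound[OF T] by blast
  have "\<exists>a\<in>Z. nrm a \<le> CD * (2^(n-1) * nrm x * C) \<and> (\<forall>y\<in>Z. form x (T y) = form a y)" if x: "x \<in> Z" for x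
  proof (rule functional_representation)
    show "0 \<le> 2^(n-1) * nrm x * C" using nrm_nonneg[OF x] C by simp
    fix y assume y: "y \<in> Z"
    note Ty = zbopD(1)[OF T y]
    show "form x (T (y + z)) = form x (T y) + form x (T z)" if "z \<in> Z" for z
      using zbopD[OF T] y that x form_add_right by simp
    show "form x (T (zscale c y)) = cnj c * form x (T y)" for c
      using zbopD[OF T] y x form_scale_right by simp
    have "cmod (form x (T y)) \<le> 2^(n-1) * nrm x * nrm (T y)" by (rule form_bound[OF x Ty])
    also have "\<dots> \<le> 2^(n-1) * nrm x * (C * nrm y)" using C(2)[OF y] nrm_nonneg[OF x] by (intro mult_left_mono) auto
    finally show "cmod (form x (T y)) \<le> 2^(n-1) * nrm x * C * nrm y" by (simp add: mult.assoc)
  qed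
  then obtain T' where T': "\<And>x. x \<in> Z \<Longrightarrow> T' x \<in> Z" "\<And>x. x \<in> Z \<Longrightarrow> nrm (T' x) \<le> CD * (2^(n-1) * nrm x * C)"
    "\<And>x y. x \<in> Z \<Longrightarrow> y \<in> Z \<Longrightarrow> form x (T y) = form (T' x) y" by metis
  have uniq: "a = b" if "a \<in> Z" "b \<in> Z" "\<And>y. y \<in> Z \<Longrightarrow> form a y = form b y" for a b
    using form_nondegenerate[of "a - b"] that by (simp add: Z_diff form_diff_left)
  have "zbop T'" unfolding zbop_def
  proof (intro conjI ballI allI)
    show "T' x \<in> Z" if "x \<in> Z" for x using T'(1) that .
    show "T' (x + y) = T' x + T' y" if "x \<in> Z" "y \<in> Z" for x y
      using that T' zbopD[OF T] by (intro uniq) (simp_all add: Z_add form_add_left flip: T'(3))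
    show "T' (zscale c x) = zscale c (T' x)" if "x \<in> Z" for x c
      using that T' zbopD[OF T] by (intro uniq) (simp_all add: Z_scale form_scale_left flip: T'(3))
    have "nrm (T' x) \<le> (CD * 2^(n-1) * C) * nrm x" if "x \<in> Z" for x using T'(2)[OF that] by (simp add: algebra_simps)
    then show "\<exists>C\<ge>0. \<forall>x\<in>Z. nrm (T' x) \<le> C * nrm x" using C(1) CD_ge1 by (intro exI[of _ "CD * 2^(n-1) * C"]) auto
  qed
  then show ?thesis using T'(3) by auto
qed

section \<open>Blocks and conjugated operators\<close>

text \<open>A coordinate of \<open>T x\<close> is, up to conjugation, the pairing of a fixed vector
  with \<open>x\<close>, and for \<open>x\<close> in \<open>W K\<close> only the tail of that vector
  counts.\<close>

lemma coord_operator_small: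
  assumes T: "zbop T" and "\<eta> > 0"
  shows "\<forall>\<^sub>F K in sequentially. \<forall>x\<in>W K. cmod (T x j k) \<le> \<eta> * nrm x"
proof -
  obtain C where C: "C \<ge> 0" "\<And>x. x \<in> Z \<Longrightarrow> nrm (T x) \<le> C * nrm x" using zbop_bound[OF T] by blast
  have "\<exists>a\<in>Z. nrm a \<le> CD * (2^n * C) \<and> (\<forall>y\<in>Z. cnj (T y j k) = form a y)"
  proof (rule functional_representation)
    fix x assume x: "x \<in> Z"
    show "cnj (T (x + y) j k) = cnj (T x j k) + cnj (T y j k)" if "y \<in> Z" for y
      using zbopD(2)[OF T x that] by (simp add: pointwise)
    show "cnj (T (zscale c x) j k) = cnj c * cnj (T x j k)" for c
      using zbopD(3)[OF T x, of c] by (simp add: pointwise)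
    have "cmod (cnj (T x j k)) \<le> 2^n * nrm (T x)" using Z_coord[OF zbopD(1)[OF T x]] by simp
    also have "\<dots> \<le> 2^n * (C * nrm x)" using C(2)[OF x] by (intro mult_left_mono) auto
    finally show "cmod (cnj (T x j k)) \<le> 2^n * C * nrm x" by (simp add: mult.assoc)
  qed (use C in simp)
  then obtain a where a: "a \<in> Z" "\<And>y. y \<in> Z \<Longrightarrow> cnj (T y j k) = form a y" by blast
  obtain K0 where K0: "\<And>L. L \<ge> K0 \<Longrightarrow> nrm (restr {L..} a) \<le> \<eta> / 2^(n-1)"
    using restr_tail_small[OF a(1), of "\<eta> / 2^(n-1)"] \<open>\<eta> > 0\<close> by auto
  have "cmod (T x j k) \<le> \<eta> * nrm x" if "L \<ge> K0" "x \<in> W L" for L x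
  proof -
    have x: "x \<in> Z" "restr {L..} x = x" using that(2) by (auto simp: W_def)
    have "cmod (T x j k) = cmod (form a x)" using a(2)[OF x(1)] by (metis complex_mod_cnj)
    also have "form a x = form (restr {L..} a) x" using x(2) by (simp add: form_restr)
    also have "cmod \<dots> \<le> 2^(n-1) * nrm (restr {L..} a) * nrm x" using form_bound a(1) x(1) Z_restr by blast
    also have "\<dots> \<le> 2^(n-1) * (\<eta> / 2^(n-1)) * nrm x"
      using K0[OF that(1)] nrm_nonneg[OF x(1)] by (intro mult_right_mono mult_left_mono) auto
    finally show ?thesis by simp
  qed
  then show ?thesis unfolding eventually_sequentially by blast
qed

lemma Z_sum_nrm: "(\<And>i. i \<in> I \<Longrightarrow> x i \<in> Z) \<Longrightarrow> nrm (\<Sum>i\<in>I. x i) \<le> (\<Sum>i\<in>I. nrm (x i))"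
  using Z_sum[of I x] by blast

text \<open>This is what permits a gliding hump: images of vectors chosen far enough out avoid any
  given initial segment up to a small error.\<close>

lemma head_operator_small:
  assumes T: "zbop T" and "\<epsilon> > 0"
  shows "\<forall>\<^sub>F K in sequentially. \<forall>x\<in>W K. nrm (restr {..<L} (T x)) \<le> \<epsilon> * nrm x"
proof -
  define N where "N = (\<Sum>k<L. \<Sum>j<n. nrm (unitv j k))"
  have N0: "N \<ge> 0" unfolding N_def using unitv_Z nrm_nonneg by (intro sum_nonneg) auto
  define \<eta> where "\<eta> = \<epsilon> / (N + 1)"
  have \<eta>: "\<eta> > 0" using \<open>\<epsilon> > 0\<close> N0 by (simp add: \<eta>_def)
  have "\<forall>\<^sub>F K in sequentially. \<forall>k\<in>{..<L}. \<forall>j\<in>{..<n}. \<forall>x\<in>W K. cmod (T x j k) \<le> \<eta> * nrm x"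
    by (intro eventually_ball_finite ballI coord_operator_small T \<eta>) auto
  then show ?thesis
  proof eventually_elim
    case (elim K)
    show ?case
    proof
      fix x assume "x \<in> W K"
      then have x: "x \<in> Z" and b: "\<And>j k. k < L \<Longrightarrow> j < n \<Longrightarrow> cmod (T x j k) \<le> \<eta> * nrm x"
        using elim W_Z by auto
      let ?y = "restr {..<L} (T x)"
      have yZ: "?y \<in> Z" using zbopD(1)[OF T x] Z_restr by blast
      have mem: "zscale (?y j k) (unitv j k) \<in> Z" if "j < n" for j k using that unitv_Z Z_scale by blast
      have "?y = (\<Sum>k<L. \<Sum>j<n. zscale (?y j k) (unitv j k))"
        by (rule finsupp_expand[OF Z_jets[OF yZ]]) (simp add: restr_simps)
      then have "nrm ?y = nrm (\<Sum>k<L. \<Sum>j<n. zscale (?y j k) (unitv j k))" by (rule arg_cong)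
      also have "\<dots> \<le> (\<Sum>k<L. nrm (\<Sum>j<n. zscale (?y j k) (unitv j k)))"
        using mem by (intro Z_sum_nrm Z_sum_mem) simp
      also have "\<dots> \<le> (\<Sum>k<L. \<Sum>j<n. nrm (zscale (?y j k) (unitv j k)))"
      proof (rule sum_mono)
        fix k show "nrm (\<Sum>j<n. zscale (?y j k) (unitv j k)) \<le> (\<Sum>j<n. nrm (zscale (?y j k) (unitv j k)))"
          using mem by (intro Z_sum_nrm) simp
      qed
      also have "\<dots> \<le> (\<Sum>k<L. \<Sum>j<n. (\<eta> * nrm x) * nrm (unitv j k))"
      proof (intro sum_mono)
        fix j k assume "k \<in> {..<L}" "j \<in> {..<n}"
        then show "nrm (zscale (?y j k) (unitv j k)) \<le> \<eta> * nrm x * nrm (unitv j k)"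
          using b[of k j] unitv_Z nrm_nonneg by (simp add: Z_scale pointwise mult_right_mono)
      qed
      also have "\<dots> = \<eta> * N * nrm x" by (simp add: N_def sum_distrib_left sum_distrib_right algebra_simps)
      also have "\<dots> \<le> \<epsilon> * nrm x"
        using N0 \<open>\<epsilon> > 0\<close> nrm_nonneg[OF x] by (intro mult_right_mono) (auto simp: \<eta>_def field_simps)
      finally show "nrm ?y \<le> \<epsilon> * nrm x" .
    qed
  qed
qed

text \<open>The sum has left bound 2 b and right bound 2 b M. Balancing these gives their geometric
  mean, and the balancing exponent is exactly - ln M. The factor 2 provides the strict inequality
  that \<open>nrm_less_rep\<close> asks for.\<close>

lemma block_upper:
  assumes X: "\<And>i. i < M \<Longrightarrow> X i \<in> Z" "\<And>i. i < M \<Longrightarrow> nrm (X i) \<le> b" "b > 0"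
    and \<kappa>: "\<And>i. \<kappa> i \<le> \<kappa> (Suc i)" and supp: "\<And>i. i < M \<Longrightarrow> restr {\<kappa> i..<\<kappa> (Suc i)} (X i) = X i" and M: "M \<ge> 1"
  shows "nrm (act (fps_exp (of_real (- ln (real M)))) (\<Sum>i<M. X i)) \<le> 2 * b * sqrt (real M)"
proof -
  have rep: "jet_rep False (2*b) (2*b) (X i)" if "i < M" for i
    using X(1,2)[OF that] X(3) by (intro nrm_less_rep) auto
  have "jet_rep False (2*b) (real m * (2*b)) (\<Sum>i<m. X i) \<and> restr {..<\<kappa> m} (\<Sum>i<m. X i) = (\<Sum>i<m. X i)" if "m \<le> M" for m
    using that
  proof (induction m)
    case 0
    have "jet_rep False (2*b) 0 0" using X(3) by (intro jet_rep_0) auto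
    then show ?case by (simp add: restr_simps)
  next
    case (Suc m)
    then have IH: "jet_rep False (2*b) (real m * (2*b)) (\<Sum>i<m. X i)" "restr {..<\<kappa> m} (\<Sum>i<m. X i) = (\<Sum>i<m. X i)" by auto
    have s: "restr {\<kappa> m..<\<kappa> (Suc m)} (X m) = X m" using supp Suc.prems by simp
    have "restr {..<\<kappa> m} (X m) = restr {..<\<kappa> m} (restr {\<kappa> m..<\<kappa> (Suc m)} (X m))" unfolding s ..
    also have "\<dots> = 0" by (auto simp: fun_eq_iff pointwise)
    finally have z: "restr {..<\<kappa> m} (X m) = 0" .
    have "jet_rep False (2*b) (real m * (2*b) + 2*b) ((\<Sum>i<m. X i) + X m)"
      using jet_rep_disjoint_add[OF IH(1) rep IH(2) z] Suc.prems by simp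
    moreover have "restr {..<\<kappa> (Suc m)} (\<Sum>i<m. X i) = (\<Sum>i<m. X i)"
    proof -
      have "restr {..<\<kappa> (Suc m)} (restr {..<\<kappa> m} (\<Sum>i<m. X i)) = restr {..<\<kappa> m} (\<Sum>i<m. X i)"
        using \<kappa>[of m] by (auto simp: fun_eq_iff pointwise)
      then show ?thesis using IH(2) by simp
    qed
    moreover have "restr {..<\<kappa> (Suc m)} (X m) = X m"
    proof -
      have "restr {..<\<kappa> (Suc m)} (restr {\<kappa> m..<\<kappa> (Suc m)} (X m)) = restr {\<kappa> m..<\<kappa> (Suc m)} (X m)"
        by (auto simp: fun_eq_iff pointwise)
      then show ?thesis using s by simp
    qed
    ultimately show ?case by (simp add: restr_simps algebra_simps)
  qed
  then have "jet_rep False (2*b) (real M * (2*b)) (\<Sum>i<M. X i)" by simp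
  from jet_rep_balance[OF this] X(3) M
  have "jet_rep False (sqrt (2*b*(real M * (2*b)))) (sqrt (2*b*(real M * (2*b))))
      (act (fps_exp (of_real (ln (2*b / (real M * (2*b)))))) (\<Sum>i<M. X i))" by simp
  moreover have "ln (2*b / (real M * (2*b))) = - ln (real M)" using X(3) M by (simp add: ln_div)
  moreover have "sqrt (2*b*(real M * (2*b))) = 2 * b * sqrt (real M)"
  proof -
    have "2*b*(real M * (2*b)) = (2*b)^2 * real M" by (simp add: power2_eq_square)
    then show ?thesis using X(3) by (simp add: real_sqrt_mult)
  qed
  ultimately show ?thesis using nrm_le[OF _ order_refl order_refl] by metis
qed

lemma form_sum_left: "(\<And>i. i \<in> I \<Longrightarrow> x i \<in> Z) \<Longrightarrow> y \<in> Z \<Longrightarrow> form (\<Sum>i\<in>I. x i) y = (\<Sum>i\<in>I. form (x i) y)"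
proof (induction I rule: infinite_finite_induct)
  case (insert i I)
  then have "x i \<in> Z" "sum x I \<in> Z" using Z_sum_mem[of I x] by auto
  moreover have "form (sum x I) y = (\<Sum>i\<in>I. form (x i) y)" using insert by blast
  ultimately show ?case using insert.prems(2) by (simp only: sum.insert[OF insert.hyps(1,2)] form_add_left)
next
  case (infinite I)
  have "form 0 y = 0" using form_scale_left[of 0 y 0] infinite by (simp add: zscale_simps)
  then show ?case using infinite by simp
next
  case empty
  have "form 0 y = 0" using form_scale_left[of 0 y 0] empty by (simp add: zscale_simps)
  then show ?case by simp
qed

lemma form_sum_right: assumes "\<And>i. i \<in> I \<Longrightarrow> y i \<in> Z" "x \<in> Z" shows "form x (\<Sum>i\<in>I. y i) = (\<Sum>i\<in>I. form x (y i))"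
proof -
  have m: "(\<Sum>i\<in>I. y i) \<in> Z" using assms Z_sum_mem by blast
  have "form x (\<Sum>i\<in>I. y i) = (-1)^(n-1) * cnj (\<Sum>i\<in>I. form (y i) x)"
    by (simp only: form_sym[OF m assms(2)] form_sum_left[OF assms])
  also have "\<dots> = (\<Sum>i\<in>I. (-1)^(n-1) * cnj (form (y i) x))" by (simp add: sum_distrib_left)
  also have "\<dots> = (\<Sum>i\<in>I. form x (y i))"
    using form_sym[OF assms(1) assms(2)] by (intro sum.cong refl) simp
  finally show ?thesis .
qed

text \<open>By duality: take blocks \<open>Y i\<close> whose pairing with \<open>X i\<close> is 1.
  The exponential preserves the pairing, so the two transformed sums still pair to \<open>M\<close>,
  while that of the \<open>Y i\<close> has norm of order sqrt M by
  \<open>block_upper\<close>.\<close>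

lemma block_lower:
  assumes X: "\<And>i. i < M \<Longrightarrow> X i \<in> Z" "\<And>i. i < M \<Longrightarrow> nrm (X i) \<ge> \<gamma>" "\<gamma> > 0"
    and \<kappa>: "\<And>i. \<kappa> i \<le> \<kappa> (Suc i)" and supp: "\<And>i. i < M \<Longrightarrow> restr {\<kappa> i..<\<kappa> (Suc i)} (X i) = X i" and M: "M \<ge> 1"
  shows "\<gamma> * sqrt (real M) \<le> 2^n * 2 * CD * nrm (act (fps_exp (of_real (- ln (real M)))) (\<Sum>i<M. X i))"
proof -
  \<comment> \<open>A block of norm at least \<open>\<gamma>\<close> violates
    \<open>dual_bound (\<gamma> / (2 * CD))\<close>; normalizing a witness to pairing 1 gives it
    norm at most \<open>?b\<close>.\<close>
  let ?b = "2 * CD / \<gamma>"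
  let ?I = "\<lambda>i. {\<kappa> i..<\<kappa> (Suc i)}"
  have b0: "?b > 0" using X(3) CD_ge1 by simp
  have "\<exists>y. y \<in> Z \<and> nrm y \<le> ?b \<and> restr (?I i) y = y \<and> form (X i) y = 1" if i: "i < M" for i
  proof -
    have "\<not> dual_bound (\<gamma> / (2 * CD)) (X i)"
    proof
      assume "dual_bound (\<gamma> / (2 * CD)) (X i)"
      then have "nrm (X i) \<le> CD * (\<gamma> / (2 * CD))"
        using dual_criterion_nrm[OF Z_jets[OF X(1)[OF i]], of "\<gamma> / (2 * CD)"] X(3) CD_ge1 by simp
      then show False using X(2)[OF i] X(3) CD_ge1 by simp
    qed
    then obtain y where y: "y \<in> Z" "cmod (form (X i) y) > \<gamma> / (2 * CD) * nrm y"
      unfolding dual_bound_def by auto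
    define \<phi> where "\<phi> = form (X i) y"
    have "\<gamma> / (2 * CD) * nrm y \<ge> 0" using X(3) CD_ge1 nrm_nonneg[OF y(1)] by simp
    then have \<phi>: "\<phi> \<noteq> 0" "cmod \<phi> > 0" using y(2) by (auto simp: \<phi>_def)
    define w where "w = zscale (cnj (1 / \<phi>)) y"
    have wZ: "w \<in> Z" using y Z_scale by (simp add: w_def)
    have "nrm w = nrm y / cmod \<phi>" using y(1) by (simp add: w_def Z_scale norm_divide)
    also have "\<dots> \<le> ?b" using y(2) \<phi>(2) X(3) CD_ge1 by (simp add: \<phi>_def field_simps)
    finally have wn: "nrm w \<le> ?b" .
    have fw: "form (X i) w = 1" using \<phi> y(1) X(1)[OF i] by (simp add: w_def form_scale_right \<phi>_def)
    have "form (X i) (restr (?I i) w) = 1" using fw supp[OF i] by (simp flip: form_restr)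
    moreover have "nrm (restr (?I i) w) \<le> ?b" using Z_restr(2)[OF wZ] wn order_trans by blast
    moreover have "restr (?I i) w \<in> Z" using wZ Z_restr by blast
    moreover have "restr (?I i) (restr (?I i) w) = restr (?I i) w" by (simp add: restr_simps)
    ultimately show ?thesis by blast
  qed
  then obtain Y where Y: "\<And>i. i < M \<Longrightarrow> Y i \<in> Z" "\<And>i. i < M \<Longrightarrow> nrm (Y i) \<le> ?b"
    "\<And>i. i < M \<Longrightarrow> restr (?I i) (Y i) = Y i" "\<And>i. i < M \<Longrightarrow> form (X i) (Y i) = 1" by metis
  have mono: "\<kappa> i \<le> \<kappa> j" if "i \<le> j" for i j using lift_Suc_mono_le[of \<kappa>, OF \<kappa> that] .
  have off: "form (X i) (Y j) = 0" if "i < M" "j < M" "i \<noteq> j" for i j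
  proof -
    have "?I i \<inter> ?I j = {}" using mono[of "Suc i" j] mono[of "Suc j" i] that(3) by (cases "i < j") auto
    then have "restr (?I i) (restr (?I j) (Y j)) = 0" by (auto simp: fun_eq_iff pointwise)
    then have "restr (?I i) (Y j) = 0" using Y(3)[OF that(2)] by simp
    then have "form (restr (?I i) (X i)) (Y j) = form (X i) 0" by (simp add: form_restr)
    also have "\<dots> = 0" using form_scale_right[of "X i" 0 0] X(1)[OF that(1)] by (simp add: zscale_simps)
    finally show ?thesis using supp[OF that(1)] by simp
  qed
  let ?s = "- ln (real M)"
  define SX where "SX = (\<Sum>i<M. X i)"
  define SY where "SY = (\<Sum>i<M. Y i)"
  have mem: "SX \<in> Z" "SY \<in> Z" using X(1) Y(1) unfolding SX_def SY_def by (auto intro!: Z_sum_mem)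
  have "form SX SY = (\<Sum>i<M. form (X i) SY)" unfolding SX_def using X(1) mem by (intro form_sum_left) auto
  also have "\<dots> = (\<Sum>i<M. \<Sum>j<M. form (X i) (Y j))"
    unfolding SY_def using X(1) Y(1) by (intro sum.cong refl form_sum_right) auto
  also have "\<dots> = (\<Sum>i<M. \<Sum>j<M. if j = i then 1 else 0)"
    using Y(4) off by (intro sum.cong refl) auto
  also have "\<dots> = of_nat M" by simp
  finally have fM: "form SX SY = of_nat M" .
  have "form (act (fps_exp (of_real ?s)) SX) (act (fps_exp (of_real ?s)) SY) = form SX SY"
    using act_exp_exp[OF Z_jets[OF mem(2)], of "of_real (- ?s)"] by (simp add: form_act fps_refl_exp del: of_real_minus) (simp add: fps_refl_exp[of "- ln (real M)", simplified])
  then have "real M \<le> 2^(n-1) * nrm (act (fps_exp (of_real ?s)) SX) * nrm (act (fps_exp (of_real ?s)) SY)"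
    using form_bound[OF Z_act(1)[OF mem(1)] Z_act(1)[OF mem(2)], of "fps_exp (of_real ?s)" "fps_exp (of_real ?s)"] fM by simp
  also have "\<dots> \<le> 2^(n-1) * nrm (act (fps_exp (of_real ?s)) SX) * (2 * ?b * sqrt (real M))"
    using block_upper[where X=Y and \<kappa>=\<kappa>, OF Y(1,2) b0 \<kappa> Y(3) M] nrm_nonneg[OF Z_act(1)[OF mem(1)]] unfolding SY_def[symmetric]
    by (intro mult_left_mono) auto
  finally have "real M \<le> 2^(n-1) * nrm (act (fps_exp (of_real ?s)) SX) * (2 * ?b * sqrt (real M))" .
  then have "sqrt (real M) * sqrt (real M) \<le> (2^(n-1) * nrm (act (fps_exp (of_real ?s)) SX) * (2 * ?b)) * sqrt (real M)"
    by (simp add: mult.assoc)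
  then have "sqrt (real M) \<le> 2^(n-1) * nrm (act (fps_exp (of_real ?s)) SX) * (2 * ?b)"
    using M by (simp only: mult_le_cancel_right) simp
  then have "\<gamma> * sqrt (real M) \<le> \<gamma> * (2^(n-1) * nrm (act (fps_exp (of_real ?s)) SX) * (2 * ?b))"
    using X(3) by (intro mult_left_mono) auto
  also have "\<dots> = (2^(n-1) * 2) * 2 * CD * nrm (act (fps_exp (of_real ?s)) SX)" using X(3) by simp
  also have "2^(n-1) * 2 = (2::real)^n" using n_pos power_minus_mult[of n "2::real"] by simp
  finally show ?thesis by (simp add: SX_def)
qed

text \<open>Conjugating with \<open>E\<^sub>M = exp (- ln M \<cdot> N)\<close> leaves an operator essentially bounded uniformly in \<open>M\<close>, because
  \<open>E\<^sub>M\<close> applied to a sum of \<open>M\<close> normalized disjoint blocks has norm of order \<open>\<surd>M\<close>.\<close>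
lemma conjugate_essentially_bounded:
  assumes T: "zbop T"
  shows "\<exists>C1\<ge>0. \<forall>M\<ge>1. \<exists>K. \<forall>x\<in>W K.
    nrm (act (fps_exp (of_real (ln (real M)))) (T (act (fps_exp (of_real (- ln (real M)))) x))) \<le> C1 * nrm x"
proof -
  obtain CT where CT: "CT \<ge> 0" "\<And>x. x \<in> Z \<Longrightarrow> nrm (T x) \<le> CT * nrm x" using zbop_bound[OF T] by blast
  define q where "q = 2^n * 2 * CD"
  have q: "q > 0" using CD_ge1 by (simp add: q_def)
  \<comment> \<open>Chosen so that the final inequality C1 - 3 \<le> q (2 CT + 2) fails by 1. The 3
    accounts for a loss of 1 by truncation and of at most 2 by
    \<open>2 * \<epsilon>\<close>.\<close>
  define C1 where "C1 = q * (2 * CT + 2) + 4"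
  have C10: "C1 > 3" using q CT(1) by (simp add: C1_def add_nonneg_pos)
  have "\<exists>K. \<forall>x\<in>W K. nrm (act (fps_exp (of_real (ln (real M)))) (T (act (fps_exp (of_real (- ln (real M)))) x))) \<le> C1 * nrm x"
    if M: "M \<ge> 1" for M
  proof (rule ccontr)
    define E where "E = fps_exp (complex_of_real (- ln (real M)))"
    define E' where "E' = fps_exp (complex_of_real (ln (real M)))"
    define A where "A = (\<lambda>x. act E' (T (act E x)))"
    have A: "zbop A" unfolding A_def by (intro zbop_comp[OF zbop_act] zbop_comp[OF T] zbop_act)
    assume "\<nexists>K. \<forall>x\<in>W K. nrm (act (fps_exp (of_real (ln (real M)))) (T (act (fps_exp (of_real (- ln (real M)))) x))) \<le> C1 * nrm x"
    then have bad: "\<exists>x\<in>W K. nrm (A x) > C1 * nrm x" for K by (auto simp: A_def E_def E'_def not_le)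
    \<comment> \<open>There will be \<open>M\<close> block errors of size
      \<open>2 * \<epsilon>\<close>, magnified by at most \<open>opn E\<close>; with this choice
      they add up to at most 2.\<close>
    define \<epsilon> where "\<epsilon> = 1 / ((opn E + 1) * real M)"
    have \<epsilon>: "\<epsilon> > 0" using M opn_nonneg[of E] by (simp add: \<epsilon>_def)
    obtain CA where CA: "CA \<ge> 0" "\<And>x. x \<in> Z \<Longrightarrow> nrm (A x) \<le> CA * nrm x" using zbop_bound[OF A] by blast
    \<comment> \<open>Gliding hump: a bad vector far beyond \<open>K\<close>, truncated, gives
      \<open>x\<close>, and cutting \<open>A x\<close> to the same block gives \<open>y\<close>. The
      lost head is small by \<open>head_operator_small\<close>, the lost tail by taking
      \<open>L\<close> large.\<close>
    have step: "\<exists>L x y. K \<le> L \<and> x \<in> Z \<and> y \<in> Z \<and> nrm x \<le> 1 \<and> nrm y \<ge> C1 - 1 - 2 * \<epsilon> \<and> nrm (A x - y) \<le> 2 * \<epsilon> \<and>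
        restr {K..<L} x = x \<and> restr {K..<L} y = y" for K
    proof -
      obtain K' where K': "\<And>x. x \<in> W K' \<Longrightarrow> nrm (restr {..<K} (A x)) \<le> \<epsilon> * nrm x" "K' \<ge> K"
        using eventually_happens'[OF sequentially_bot eventually_conj[OF head_operator_small[OF A \<epsilon>, of K] eventually_ge_at_top[of K]]] by blast
      obtain u where u: "u \<in> W K'" "nrm (A u) > C1 * nrm u" using bad by blast
      have uZ: "u \<in> Z" using u(1) W_Z by blast
      have up: "nrm u > 0"
      proof (rule ccontr)
        assume "\<not> nrm u > 0"
        then have "u = 0" using nrm_eq_0[OF uZ] nrm_nonneg[OF uZ] by simp
        then show False using u(2) zbop_0[OF A] by simp
      qed
      define v where "v = zscale (of_real (1 / nrm u)) u"
      have vZ: "v \<in> Z" using uZ Z_scale by (simp add: v_def)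
      have vn: "nrm v = 1" using uZ up by (simp add: v_def Z_scale norm_divide)
      have "A v = zscale (of_real (1 / nrm u)) (A u)" using zbopD(3)[OF A uZ] by (simp only: v_def)
      then have "nrm (A v) = nrm (A u) / nrm u" using zbopD(1)[OF A uZ] up by (simp add: Z_scale norm_divide)
      then have Av: "nrm (A v) > C1" using u(2) up by (simp add: pos_less_divide_eq)
      have vW: "restr {K'..} v = v" using u(1) by (simp add: v_def W_def restr_simps)
      obtain L0 where L0: "\<And>L. L \<ge> L0 \<Longrightarrow> nrm (restr {L..} v) \<le> 1 / (CA + 1)"
        using restr_tail_small[OF vZ, of "1 / (CA + 1)"] CA(1) by auto
      define x where "x = restr {..<max L0 K'} v"
      have xZ: "x \<in> Z" using vZ Z_restr by (simp add: x_def)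
      have xn: "nrm x \<le> 1" using Z_restr(2)[OF vZ] vn by (simp add: x_def)
      have xK: "restr {K'..} x = x"
      proof -
        have "restr {K'..} (restr {..<max L0 K'} v) = restr {..<max L0 K'} (restr {K'..} v)"
          by (simp add: restr_simps Int_commute)
        then show ?thesis by (simp add: x_def vW)
      qed
      then have xW: "x \<in> W K'" using xZ by (simp add: W_def)
      have "v = x + restr {max L0 K'..} v" unfolding x_def by (rule restr_split)
      then have "A v = A x + A (restr {max L0 K'..} v)"
        using zbopD(2)[OF A xZ Z_restr(1)[OF vZ]] by (metis (no_types))
      then have "nrm (A v) \<le> nrm (A x) + nrm (A (restr {max L0 K'..} v))"
        using Z_add(2)[OF zbopD(1)[OF A xZ] zbopD(1)[OF A Z_restr(1)[OF vZ]]] by simp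
      moreover have "nrm (A (restr {max L0 K'..} v)) \<le> CA * (1 / (CA + 1))"
        using CA(2)[OF Z_restr(1)[OF vZ]] mult_left_mono[OF L0[of "max L0 K'"] CA(1)] by (meson max.cobounded1 order_trans)
      moreover have "CA * (1 / (CA + 1)) \<le> 1" using CA(1) by simp
      ultimately have Ax: "nrm (A x) > C1 - 1" using Av by linarith
      have AxZ: "A x \<in> Z" using zbopD(1)[OF A xZ] .
      obtain L1 where L1: "\<And>L. L \<ge> L1 \<Longrightarrow> nrm (restr {L..} (A x)) \<le> \<epsilon>"
        using restr_tail_small[OF AxZ \<epsilon>] by auto
      define L where "L = max L1 (max (max L0 K') K)"
      have LK: "K \<le> L" "L1 \<le> L" "max L0 K' \<le> L" by (auto simp: L_def)
      define y where "y = restr {K..<L} (A x)"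
      have yZ: "y \<in> Z" using AxZ Z_restr by (simp add: y_def)
      have dec: "A x - y = restr {..<K} (A x) + restr {L..} (A x)"
        unfolding y_def using LK(1) by (auto simp: fun_eq_iff pointwise)
      have "nrm (A x - y) \<le> nrm (restr {..<K} (A x)) + nrm (restr {L..} (A x))"
        unfolding dec using AxZ by (intro Z_add Z_restr)
      also have "\<dots> \<le> \<epsilon> * 1 + \<epsilon>"
      proof (rule add_mono)
        have "nrm (restr {..<K} (A x)) \<le> \<epsilon> * nrm x" using K'(1)[OF xW] .
        also have "\<dots> \<le> \<epsilon> * 1" using xn \<epsilon> by (intro mult_left_mono) auto
        finally show "nrm (restr {..<K} (A x)) \<le> \<epsilon> * 1" .
        show "nrm (restr {L..} (A x)) \<le> \<epsilon>" using L1 LK by blast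
      qed
      finally have d: "nrm (A x - y) \<le> 2 * \<epsilon>" by simp
      have "nrm (A x) \<le> nrm (A x - y) + nrm y" using Z_add(2)[OF Z_diff(1)[OF AxZ yZ] yZ] by simp
      then have yn: "nrm y \<ge> C1 - 1 - 2 * \<epsilon>" using Ax d by linarith
      have "restr {K..<L} x = x"
      proof -
        have "restr {K..<L} (restr {..<max L0 K'} (restr {K'..} v)) = restr {..<max L0 K'} (restr {K'..} v)"
          using LK(3) K'(2) by (auto simp: fun_eq_iff pointwise)
        then show ?thesis by (simp add: x_def vW)
      qed
      moreover have "restr {K..<L} y = y" by (simp add: y_def restr_simps)
      ultimately show ?thesis using LK(1) xZ yZ xn yn d by blast
    qed
    then obtain nx xf yf where nx: "\<And>K. K \<le> nx K" "\<And>K. xf K \<in> Z" "\<And>K. yf K \<in> Z" "\<And>K. nrm (xf K) \<le> 1"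
      "\<And>K. nrm (yf K) \<ge> C1 - 1 - 2 * \<epsilon>" "\<And>K. nrm (A (xf K) - yf K) \<le> 2 * \<epsilon>"
      "\<And>K. restr {K..<nx K} (xf K) = xf K" "\<And>K. restr {K..<nx K} (yf K) = yf K" by metis
    define \<kappa> where "\<kappa> i = (nx ^^ i) 0" for i
    have kS: "\<kappa> (Suc i) = nx (\<kappa> i)" for i by (simp add: \<kappa>_def)
    define X where "X i = xf (\<kappa> i)" for i
    define Y where "Y i = yf (\<kappa> i)" for i
    have XZ: "X i \<in> Z" and YZ: "Y i \<in> Z" for i using nx(2,3) by (auto simp: X_def Y_def)
    have \<kappa>: "\<kappa> i \<le> \<kappa> (Suc i)" for i unfolding kS by (rule nx(1))
    have sX: "restr {\<kappa> i..<\<kappa> (Suc i)} (X i) = X i" and sY: "restr {\<kappa> i..<\<kappa> (Suc i)} (Y i) = Y i" for i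
      unfolding kS X_def Y_def by (rule nx)+
    define SX where "SX = (\<Sum>i<M. X i)"
    define SY where "SY = (\<Sum>i<M. Y i)"
    have SZ: "SX \<in> Z" "SY \<in> Z" unfolding SX_def SY_def using XZ YZ by (auto intro!: Z_sum_mem)
    have "\<epsilon> \<le> 1"
    proof -
      have "1 * 1 \<le> (opn E + 1) * real M" using M opn_nonneg[of E] by (intro mult_mono) auto
      then show ?thesis by (simp add: \<epsilon>_def)
    qed
    have \<gamma>: "C1 - 1 - 2 * \<epsilon> \<ge> C1 - 3" "C1 - 1 - 2*\<epsilon> > 0" using \<open>\<epsilon> \<le> 1\<close> C10 by linarith+
    have low: "(C1 - 1 - 2 * \<epsilon>) * sqrt (real M) \<le> q * nrm (act E SY)"
      unfolding q_def E_def SY_def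
      by (rule block_lower[where X=Y and \<kappa>=\<kappa>]) (use YZ nx(5) \<gamma> \<kappa> sY M in \<open>auto simp: Y_def\<close>)
    have up: "nrm (act E SX) \<le> 2 * 1 * sqrt (real M)"
      unfolding E_def SX_def
      by (rule block_upper[where X=X and \<kappa>=\<kappa>]) (use XZ nx(4) \<kappa> sX M in \<open>auto simp: X_def\<close>)
    \<comment> \<open>\<open>E\<close> cancels the outer factor of the conjugated operator, so the
      transformed image of a block sum is \<open>T\<close> of the transformed sum and has norm of
      order sqrt M.\<close>
    have EA: "act E (A x) = T (act E x)" if "x \<in> Z" for x
    proof -
      have "T (act E x) \<in> Z" using zbopD(1)[OF T Z_act(1)[OF that]] .
      from act_exp_exp[OF Z_jets[OF this], of "of_real (- ln (real M))"] show ?thesis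
        by (simp add: A_def E_def E'_def)
    qed
    have dif: "A SX - SY = (\<Sum>i<M. A (X i) - Y i)"
      unfolding SX_def SY_def using zbop_sum[OF A, of "{..<M}" X] XZ by (simp add: sum_subtractf)
    have "nrm (A SX - SY) \<le> (\<Sum>i<M. nrm (A (X i) - Y i))"
      unfolding dif using XZ YZ zbopD(1)[OF A] by (intro Z_sum_nrm Z_diff) auto
    also have "\<dots> \<le> (\<Sum>i<M. 2 * \<epsilon>)" using nx(6) by (intro sum_mono) (simp add: X_def Y_def)
    finally have d: "nrm (A SX - SY) \<le> real M * (2 * \<epsilon>)" by simp
    have ASZ: "A SX \<in> Z" using zbopD(1)[OF A SZ(1)] .
    have "act E SY = act E (A SX) - act E (A SX - SY)"
      using zbop_diff[OF zbop_act[of E] ASZ Z_diff(1)[OF ASZ SZ(2)]] by simp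
    then have "nrm (act E SY) \<le> nrm (act E (A SX)) + nrm (act E (A SX - SY))"
      using Z_diff(2)[OF Z_act(1)[OF ASZ] Z_act(1)[OF Z_diff(1)[OF ASZ SZ(2)]]] by simp
    also have "\<dots> \<le> CT * (2 * sqrt (real M)) + opn E * (real M * (2 * \<epsilon>))"
    proof (rule add_mono)
      have "nrm (act E (A SX)) \<le> CT * nrm (act E SX)"
        unfolding EA[OF SZ(1)] by (rule CT(2)[OF Z_act(1)[OF SZ(1)]])
      also have "\<dots> \<le> CT * (2 * sqrt (real M))" using up CT(1) by (intro mult_left_mono) auto
      finally show "nrm (act E (A SX)) \<le> CT * (2 * sqrt (real M))" .
      show "nrm (act E (A SX - SY)) \<le> opn E * (real M * (2 * \<epsilon>))"
        using Z_act(2)[OF Z_diff(1)[OF ASZ SZ(2)], of E] mult_left_mono[OF d opn_nonneg[of E]] by linarith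
    qed
    finally have n1: "nrm (act E SY) \<le> CT * (2 * sqrt (real M)) + opn E * (real M * (2 * \<epsilon>))" .
    have n2: "opn E * (real M * (2 * \<epsilon>)) \<le> 2"
    proof -
      have "(opn E + 1) * real M * \<epsilon> = 1" using M opn_nonneg[of E] by (simp add: \<epsilon>_def)
      moreover have "opn E * (real M * (2 * \<epsilon>)) = 2 * ((opn E + 1) * real M * \<epsilon>) - 2 * (real M * \<epsilon>)"
        by (simp add: algebra_simps)
      moreover have "0 \<le> real M * \<epsilon>" using \<epsilon> by simp
      ultimately show ?thesis by linarith
    qed
    have n3: "2 \<le> 2 * sqrt (real M)" using M by simp
    have "nrm (act E SY) \<le> CT * (2 * sqrt (real M)) + 2 * sqrt (real M)" using n1 n2 n3 by linarith
    then have "nrm (act E SY) \<le> (2 * CT + 2) * sqrt (real M)" by (simp add: algebra_simps)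
    then have "q * nrm (act E SY) \<le> q * ((2 * CT + 2) * sqrt (real M))" using q by (intro mult_left_mono) auto
    with low have "(C1 - 1 - 2 * \<epsilon>) * sqrt (real M) \<le> (q * (2 * CT + 2)) * sqrt (real M)" by (simp add: mult.assoc)
    then have "C1 - 1 - 2 * \<epsilon> \<le> q * (2 * CT + 2)" using M by (simp only: mult_le_cancel_right) simp
    then show False using \<gamma>(1) by (simp add: C1_def)
  qed
  then show ?thesis using C10 by (intro exI[of _ C1]) auto
qed

section \<open>Commutators with the shift\<close>

text \<open>The added term is zero; with it both indices 0 and 1 occur even when
  \<open>n = 1\<close>.\<close>

lemma act_expand_Suc: "act F x = (\<Sum>i<Suc n. zscale (F $ i) (act (fps_X ^ i) x))"
proof -
  have "act (fps_X ^ n) x = 0" by (auto simp: fun_eq_iff act_X_power pointwise)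
  then show ?thesis using act_expand[of F x] by (simp add: zscale_simps)
qed

lemma act_W: assumes "x \<in> W K" shows "act F x \<in> W K"
proof -
  have "restr {K..} (act F x) = act F (restr {K..} x)" by (simp add: act_restr)
  then show ?thesis using assms by (simp add: W_def Z_act)
qed

text \<open>Conjugating \<open>T\<close> by exp (t N) gives a polynomial in t of degree at most 2n
  with linear coefficient N T - T N. At t = 2^i s with s = ln M its values are bounded far out by
  the same \<open>C1\<close>, because 2^i s = ln (M^(2^i)). The weights of
  \<open>derivative_weights\<close> leave - s times T N - N T, and s may be taken large.\<close>

lemma commutator_small:
  assumes T: "zbop T" and \<epsilon>: "\<epsilon> > 0"
  shows "\<forall>\<^sub>F K in sequentially. \<forall>x\<in>W K. nrm (T (act fps_X x) - act fps_X (T x)) \<le> \<epsilon> * nrm x"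
proof -
  obtain C1 where C1: "C1 \<ge> 0" "\<And>M. M \<ge> 1 \<Longrightarrow> \<exists>K. \<forall>x\<in>W K.
    nrm (act (fps_exp (of_real (ln (real M)))) (T (act (fps_exp (of_real (- ln (real M)))) x))) \<le> C1 * nrm x"
    using conjugate_essentially_bounded[OF T] by blast
  have "2 * n \<ge> 1" using n_pos by simp
  then obtain c :: "nat \<Rightarrow> real" where c: "\<And>j. j \<le> 2*n \<Longrightarrow> (\<Sum>i\<le>2*n. c i * (2^i)^j) = of_bool (j = 1)"
    using derivative_weights by blast
  define S where "S = (\<Sum>i\<le>2*n. \<bar>c i\<bar>)"
  have S0: "S \<ge> 0" by (simp add: S_def sum_nonneg)
  have "filterlim (\<lambda>M. ln (real M)) at_top sequentially"
    by (rule filterlim_compose[OF ln_at_top filterlim_real_sequentially])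
  then have "\<forall>\<^sub>F M in sequentially. ln (real M) \<ge> S * C1 / \<epsilon> + 1" by (simp add: filterlim_at_top)
  then obtain M where M: "ln (real M) \<ge> S * C1 / \<epsilon> + 1" "M \<ge> 1"
    using eventually_happens'[OF sequentially_bot eventually_conj[OF _ eventually_ge_at_top[of 1]]] by blast
  define s where "s = ln (real M)"
  have "S * C1 / \<epsilon> \<ge> 0" using S0 C1(1) \<epsilon> by simp
  then have s: "s > 0" "S * C1 / \<epsilon> \<le> s" using M(1) unfolding s_def by linarith+
  have s2: "S * C1 \<le> s * \<epsilon>" using s(2) \<epsilon> by (simp add: pos_divide_le_eq)
  define A where "A t x = act (fps_exp (of_real t)) (T (act (fps_exp (of_real (- t))) x))" for t :: real and x
  have "\<exists>K. \<forall>x\<in>W K. nrm (A (2^i * s) x) \<le> C1 * nrm x" for i :: nat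
  proof -
    have "ln (real (M^(2^i))) = 2^i * s" using M(2) by (simp add: s_def ln_realpow)
    moreover have "M^(2^i) \<ge> 1" using M(2) by simp
    ultimately show ?thesis using C1(2)[of "M^(2^i)"] unfolding A_def by presburger
  qed
  then obtain K where K: "\<And>i x. x \<in> W (K i) \<Longrightarrow> nrm (A (2^i * s) x) \<le> C1 * nrm x" by metis
  \<comment> \<open>Each node has its own starting index; as there are finitely many nodes, one
    index serves all.\<close>
  define L where "L = Max (K ` {..2*n})"
  have "nrm (T (act fps_X x) - act fps_X (T x)) \<le> \<epsilon> * nrm x" if "L' \<ge> L" "x \<in> W L'" for L' x
  proof -
    have x: "x \<in> Z" using that(2) by (rule W_Z)
    define D where "D = T (act fps_X x) - act fps_X (T x)"
    have DZ: "D \<in> Z" unfolding D_def using x zbopD(1)[OF T] by (intro Z_diff Z_act) (auto intro: Z_act)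
    have AZ: "A t x \<in> Z" for t unfolding A_def using x zbopD(1)[OF T] by (intro Z_act) (auto intro: Z_act)
    define G where "G a b = act (fps_X^a) (T (act (fps_X^b) x))" for a b
    have Aexp: "A t x j k = (\<Sum>a<Suc n. \<Sum>b<Suc n. t^(a+b) * ((-1)^b / (fact a * fact b) * G a b j k))" for t j k
    proof -
      have m: "act (fps_X^b) x \<in> Z" for b using x by (rule Z_act)
      have "T (act (fps_exp (of_real (- t))) x) = T (\<Sum>b<Suc n. zscale (fps_exp (of_real (- t)) $ b) (act (fps_X ^ b) x))"
        using act_expand_Suc by (rule arg_cong)
      also have "\<dots> = (\<Sum>b<Suc n. T (zscale (fps_exp (of_real (- t)) $ b) (act (fps_X ^ b) x)))"
        using m by (intro zbop_sum[OF T] Z_scale)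
      also have "\<dots> = (\<Sum>b<Suc n. zscale (fps_exp (of_real (- t)) $ b) (T (act (fps_X ^ b) x)))"
        by (intro sum.cong refl zbopD(3)[OF T] m)
      finally have 1: "T (act (fps_exp (of_real (- t))) x) = (\<Sum>b<Suc n. zscale (fps_exp (of_real (- t)) $ b) (T (act (fps_X ^ b) x)))" .
      have "A t x = (\<Sum>a<Suc n. zscale (fps_exp (of_real t) $ a) (act (fps_X ^ a) (T (act (fps_exp (of_real (- t))) x))))"
        unfolding A_def by (rule act_expand_Suc)
      also have "\<dots> = (\<Sum>a<Suc n. zscale (fps_exp (of_real t) $ a) (\<Sum>b<Suc n. zscale (fps_exp (of_real (- t)) $ b) (G a b)))"
        unfolding 1 act_sum act_simps(3) G_def ..
      finally have "A t x j k = (\<Sum>a<Suc n. \<Sum>b<Suc n. (of_real t^a / fact a) * ((of_real (- t)^b / fact b) * G a b j k))"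
        by (simp only: sum_fun_apply2 zscale_apply fps_exp_nth sum_distrib_left of_nat_fact)
      also have "\<dots> = (\<Sum>a<Suc n. \<Sum>b<Suc n. of_real t^(a+b) * ((-1)^b / (fact a * fact b) * G a b j k))"
      proof (intro sum.cong refl)
        fix a b
        have "of_real (- t)^b = (-1)^b * (of_real t :: complex)^b" by (simp add: power_minus[of "of_real t"])
        then show "of_real t^a / fact a * (of_real (- t)^b / fact b * G a b j k) = of_real t^(a+b) * ((-1)^b / (fact a * fact b) * G a b j k)"
          by (simp only: power_add) (simp add: field_simps)
      qed
      finally show ?thesis .
    qed
    have "(\<Sum>i\<le>2*n. zscale (of_real (c i)) (A (2^i * s) x)) = zscale (of_real (- s)) D"
    proof (intro ext)
      fix j k
      define H where "H a b = (-1)^b / (fact a * fact b) * G a b j k" for a b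
      have "(\<Sum>i\<le>2*n. zscale (of_real (c i)) (A (2^i * s) x)) j k
          = (\<Sum>i\<le>2*n. \<Sum>a<Suc n. \<Sum>b<Suc n. of_real (c i * (2^i)^(a+b)) * (of_real (s^(a+b)) * H a b))"
        by (simp add: sum_fun_apply2 zscale_apply Aexp H_def sum_distrib_left power_mult_distrib mult.assoc del: sum.lessThan_Suc)
      also have "\<dots> = (\<Sum>a<Suc n. \<Sum>b<Suc n. \<Sum>i\<le>2*n. of_real (c i * (2^i)^(a+b)) * (of_real (s^(a+b)) * H a b))"
        by (rule trans[OF sum.swap], rule sum.cong[OF refl], rule sum.swap)
      also have "\<dots> = (\<Sum>a<Suc n. \<Sum>b<Suc n. of_real (\<Sum>i\<le>2*n. c i * (2^i)^(a+b)) * (of_real (s^(a+b)) * H a b))"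
        by (simp only: of_real_sum sum_distrib_right)
      also have "\<dots> = (\<Sum>a<Suc n. \<Sum>b<Suc n. of_bool (a + b = 1) * (of_real (s^(a+b)) * H a b))"
        using c by (intro sum.cong refl) simp
      also have "\<dots> = (\<Sum>a<Suc n. (if a = 0 then of_real s * H 0 1 else 0) + (if a = 1 then of_real s * H 1 0 else 0))"
      proof (intro sum.cong refl)
        fix a
        have "(\<Sum>b<Suc n. of_bool (a + b = 1) * (of_real (s^(a+b)) * H a b))
            = (\<Sum>b<Suc n. (if b = 1 then (if a = 0 then of_real s * H 0 1 else 0) else 0) + (if b = 0 then (if a = 1 then of_real s * H 1 0 else 0) else 0))"
        proof (intro sum.cong refl)
          fix b
          show "of_bool (a + b = 1) * (of_real (s^(a+b)) * H a b) = (if b = 1 then (if a = 0 then of_real s * H 0 1 else 0) else 0)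
              + (if b = 0 then (if a = 1 then of_real s * H 1 0 else 0) else 0)"
            by (cases a; cases b) auto
        qed
        also have "\<dots> = (if a = 0 then of_real s * H 0 1 else 0) + (if a = 1 then of_real s * H 1 0 else 0)"
          unfolding sum.distrib using n_pos by (simp del: sum.lessThan_Suc)
        finally show "(\<Sum>b<Suc n. of_bool (a + b = 1) * (of_real (s^(a+b)) * H a b))
          = (if a = 0 then of_real s * H 0 1 else 0) + (if a = 1 then of_real s * H 1 0 else 0)" .
      qed
      also have "\<dots> = of_real s * H 0 1 + of_real s * H 1 0"
        unfolding sum.distrib using n_pos by (simp del: sum.lessThan_Suc)
      also have "\<dots> = zscale (of_real (- s)) D j k"
      proof -
        have "G 0 1 = T (act fps_X x)" "G 1 0 = act fps_X (T x)"
          using zbopD(1)[OF T] Z_act(1) x by (simp_all add: G_def act_1 Z_jets)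
        then show ?thesis by (simp add: H_def D_def zscale_apply algebra_simps)
      qed
      finally show "(\<Sum>i\<le>2*n. zscale (of_real (c i)) (A (2^i * s) x)) j k = zscale (of_real (- s)) D j k" .
    qed
    then have "nrm (zscale (of_real (- s)) D) = nrm (\<Sum>i\<le>2*n. zscale (of_real (c i)) (A (2^i * s) x))" by simp
    also have "\<dots> \<le> (\<Sum>i\<le>2*n. nrm (zscale (of_real (c i)) (A (2^i * s) x)))"
      using AZ by (intro Z_sum_nrm Z_scale)
    also have "\<dots> \<le> (\<Sum>i\<le>2*n. \<bar>c i\<bar> * (C1 * nrm x))"
    proof (rule sum_mono)
      fix i assume "i \<in> {..2*n}"
      then have "K i \<le> L'" using that(1) Max_ge[of "K ` {..2*n}" "K i"] by (auto simp: L_def)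
      then have "nrm (A (2^i * s) x) \<le> C1 * nrm x" using that(2) W_mono K by blast
      then show "nrm (zscale (of_real (c i)) (A (2^i * s) x)) \<le> \<bar>c i\<bar> * (C1 * nrm x)"
        using AZ by (simp add: Z_scale mult_left_mono)
    qed
    also have "\<dots> = (S * C1) * nrm x" by (simp add: S_def sum_distrib_right mult.assoc)
    also have "\<dots> \<le> (s * \<epsilon>) * nrm x" using s2 nrm_nonneg[OF x] by (rule mult_right_mono)
    finally have "s * nrm D \<le> s * (\<epsilon> * nrm x)" using DZ s(1) by (simp add: Z_scale mult.assoc)
    then show ?thesis using s(1) by (simp add: D_def)
  qed
  then show ?thesis unfolding eventually_sequentially by blast
qed

text \<open>Induction with [T, N^(j+1)] = [T, N^j] N + N^j [T, N], where the shift maps each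
  \<open>W K\<close> into itself.\<close>

lemma shift_commutator_small:
  assumes T: "zbop T" and "\<epsilon> > 0"
  shows "\<forall>\<^sub>F K in sequentially. \<forall>x\<in>W K. nrm (T (act (fps_X^j) x) - act (fps_X^j) (T x)) \<le> \<epsilon> * nrm x"
  using \<open>\<epsilon> > 0\<close>
proof (induction j arbitrary: \<epsilon>)
  case 0
  have "T (act (fps_X^0) x) - act (fps_X^0) (T x) = 0" if "x \<in> Z" for x
    using that zbopD(1)[OF T that] by (simp add: act_1 Z_jets)
  then show ?case using 0 W_Z nrm_nonneg by (intro always_eventually) simp
next
  case (Suc j)
  have CN: "CN > 0" using CN_ge1 by simp
  have e: "\<epsilon> / (2 * CN) > 0" "\<epsilon> / (2 * CN^j) > 0" using Suc.prems CN by auto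
  from Suc.IH[OF e(1)] commutator_small[OF T e(2)] show ?case
  proof eventually_elim
    case (elim K)
    show ?case
    proof
      fix x assume xW: "x \<in> W K"
      then have x: "x \<in> Z" by (rule W_Z)
      note TZ = zbopD(1)[OF T]
      have m: "act fps_X x \<in> W K" using xW by (rule act_W)
      have mZ: "act fps_X x \<in> Z" using x by (rule Z_act)
      let ?u = "T (act (fps_X^j) (act fps_X x)) - act (fps_X^j) (T (act fps_X x))"
      let ?d = "T (act fps_X x) - act fps_X (T x)"
      have dZ: "?d \<in> Z" using TZ[OF mZ] Z_act(1)[OF TZ[OF x]] by (rule Z_diff)
      have uZ: "?u \<in> Z" using TZ[OF Z_act(1)[OF mZ]] Z_act(1)[OF TZ[OF mZ]] by (rule Z_diff)
      have dec: "T (act (fps_X^Suc j) x) - act (fps_X^Suc j) (T x) = ?u + act (fps_X^j) ?d"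
        using zbop_diff[OF zbop_act TZ[OF mZ] Z_act(1)[OF TZ[OF x]]] by (simp add: act_act mult.commute)
      have "nrm (T (act (fps_X^Suc j) x) - act (fps_X^Suc j) (T x)) \<le> nrm ?u + nrm (act (fps_X^j) ?d)"
        unfolding dec using uZ Z_act(1)[OF dZ] by (rule Z_add)
      also have "\<dots> \<le> \<epsilon> / (2 * CN) * (CN * nrm x) + CN^j * (\<epsilon> / (2 * CN^j) * nrm x)"
      proof (rule add_mono)
        have "nrm ?u \<le> \<epsilon> / (2 * CN) * nrm (act fps_X x)" using elim(1) m by blast
        also have "\<dots> \<le> \<epsilon> / (2 * CN) * (CN * nrm x)"
          using Z_shift(2)[OF x, of 1] e(1) by (intro mult_left_mono) auto
        finally show "nrm ?u \<le> \<epsilon> / (2 * CN) * (CN * nrm x)" .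
        have "nrm (act (fps_X^j) ?d) \<le> CN^j * nrm ?d" using dZ by (rule Z_shift)
        also have "\<dots> \<le> CN^j * (\<epsilon> / (2 * CN^j) * nrm x)" using elim(2) xW CN by (intro mult_left_mono) auto
        finally show "nrm (act (fps_X^j) ?d) \<le> CN^j * (\<epsilon> / (2 * CN^j) * nrm x)" .
      qed
      also have "\<dots> = \<epsilon> * nrm x" using CN by (simp add: field_simps)
      finally show "nrm (T (act (fps_X^Suc j) x) - act (fps_X^Suc j) (T x)) \<le> \<epsilon> * nrm x" .
    qed
  qed
qed

section \<open>The operator \<open>T\<^sup>+ T\<close> on the top quotient\<close>

text \<open>The \<open>\<ell>\<^sub>2\<close> inner product of the coordinates \<open>x\<^sub>0\<close>, \<open>y\<^sub>0\<close>, i.e. of the images in the top quotient of the filtration.\<close>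
definition ip :: "(nat \<Rightarrow> nat \<Rightarrow> complex) \<Rightarrow> (nat \<Rightarrow> nat \<Rightarrow> complex) \<Rightarrow> complex" where
  "ip x y = (-1)^(n-1) * form x (act (fps_X^(n-1)) y)"

definition tnorm :: "(nat \<Rightarrow> nat \<Rightarrow> complex) \<Rightarrow> real" where
  "tnorm x = sqrt (Re (ip x x))"

lemma ip_sums: assumes "x \<in> Z" "y \<in> Z" shows "(\<lambda>k. x 0 k * cnj (y 0 k)) sums ip x y"
proof -
  have "fterm x (act (fps_X^(n-1)) y) sums form x (act (fps_X^(n-1)) y)"
    unfolding form_def using assms Z_act by (intro summable_sums fterm_summable)
  then have "(\<lambda>k. (-1)^(n-1) * fterm x (act (fps_X^(n-1)) y) k) sums ip x y"
    unfolding ip_def by (rule sums_mult)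
  moreover have "(-1)^(n-1) * fterm x (act (fps_X^(n-1)) y) k = x 0 k * cnj (y 0 k)" for k
  proof -
    have "fterm x (act (fps_X^(n-1)) y) k = (-1)^(n-1) * (x 0 k * cnj (y 0 k))"
      using fterm_level[of 0 x k y] n_pos by simp
    moreover have "(-1::complex)^(n-1) * (-1)^(n-1) = 1" by (simp flip: power_mult_distrib)
    ultimately show ?thesis by (simp flip: mult.assoc)
  qed
  ultimately show ?thesis by simp
qed

lemma ip_self_sums: assumes "x \<in> Z" shows "(\<lambda>k. (cmod (x 0 k))^2) sums Re (ip x x)"
  using sums_Re[OF ip_sums[OF assms assms]] by (simp add: complex_mult_cnj cmod_power2)

lemma tnorm_sq: assumes "x \<in> Z" shows "(tnorm x)^2 = Re (ip x x)" and tnorm_nonneg: "tnorm x \<ge> 0"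
proof -
  have "0 \<le> Re (ip x x)" using ip_self_sums[OF assms] by (metis sums_unique suminf_nonneg sums_summable zero_le_power2)
  then show "(tnorm x)^2 = Re (ip x x)" "tnorm x \<ge> 0" by (auto simp: tnorm_def)
qed

lemma tnorm_partial: assumes "x \<in> Z" shows "(\<Sum>k<K. (cmod (x 0 k))^2) \<le> (tnorm x)^2"
  unfolding tnorm_sq[OF assms] using ip_self_sums[OF assms]
  by (metis sum_le_suminf finite_lessThan sums_iff zero_le_power2)

lemma tnorm_cong: assumes "x \<in> Z" "y \<in> Z" "x 0 = y 0" shows "tnorm x = tnorm y"
  using ip_self_sums[OF assms(1)] ip_self_sums[OF assms(2)] assms(3) sums_unique2 unfolding tnorm_def by metis

lemma tnorm_le: assumes "x \<in> Z" shows "tnorm x \<le> 2^n * CN^n * nrm x"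
proof -
  have CN: "CN^(n-1) \<le> CN^n" "CN^n \<ge> 1" "0 \<le> CN^(n-1)" using CN_ge1 by (auto intro: power_increasing)
  have "(tnorm x)^2 \<le> cmod (ip x x)" unfolding tnorm_sq[OF assms] by (rule complex_Re_le_cmod)
  also have "\<dots> \<le> 2^(n-1) * nrm x * nrm (act (fps_X^(n-1)) x)"
    using form_bound[OF assms Z_act(1)[OF assms]] by (simp add: ip_def norm_mult norm_power)
  also have "\<dots> \<le> 2^(n-1) * nrm x * (CN^(n-1) * nrm x)"
    using Z_shift(2)[OF assms] nrm_nonneg[OF assms] by (intro mult_left_mono) auto
  also have "\<dots> = (2^(n-1) * CN^(n-1)) * (nrm x)^2" by (simp add: power2_eq_square)
  also have "\<dots> \<le> (2^n * CN^n) * (nrm x)^2"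
    using CN by (intro mult_right_mono mult_mono) (auto intro: power_increasing)
  also have "\<dots> \<le> (2^n * CN^n)^2 * (nrm x)^2"
  proof (rule mult_right_mono)
    have "1 * 1 \<le> 2^n * CN^n" using CN by (intro mult_mono) auto
    then show "2^n * CN^n \<le> (2^n * CN^n)^2" by (intro self_le_power) auto
  qed simp
  finally have "(tnorm x)^2 \<le> (2^n * CN^n * nrm x)^2" by (simp add: power_mult_distrib)
  moreover have "0 \<le> 2^n * CN^n * nrm x" using nrm_nonneg[OF assms] CN by simp
  ultimately show ?thesis by (rule power2_le_imp_le)
qed

text \<open>Within a class of the top quotient this picks a representative whose norm is controlled
  by the ell_2 norm of the class alone. Supports are kept because the lift vanishes where
  \<open>x 0\<close> does.\<close>

lemma lift_W:
  assumes x: "x \<in> W K" shows "\<exists>b\<in>W K. b 0 = x 0 \<and> nrm b \<le> 2 * tnorm x"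
proof -
  have xZ: "x \<in> Z" using x by (rule W_Z)
  obtain b where b: "jet_rep True (2 * tnorm x) (2 * tnorm x) b" "b 0 = x 0" "\<And>k j. x 0 k = 0 \<Longrightarrow> b j k = 0"
    using lift_ex[OF tnorm_nonneg[OF xZ] tnorm_partial[OF xZ]] by blast
  have x0: "x 0 k = 0" if "k < K" for k
  proof -
    have "x 0 k = restr {K..} x 0 k" using x by (simp add: W_def)
    then show ?thesis using that by (simp add: restr_apply)
  qed
  have "restr {K..} b = b" using b(3) x0 by (auto simp: fun_eq_iff restr_apply)
  then have "b \<in> W K" using jet_rep_Z[OF b(1)] by (simp add: W_def)
  then show ?thesis using b(2) nrm_le[OF b(1) order_refl order_refl] by blast
qed

text \<open>The first remaining level lies in ell_2 by \<open>level_bound\<close>, so it has a lift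
  too; shifting that lift \<open>j\<close> times will reproduce the level in its place.\<close>

lemma level_lift_W:
  assumes x: "x \<in> W K" and j: "j < n" "\<forall>i<j. x i = 0"
  shows "\<exists>y\<in>W K. y 0 = x j \<and> nrm y \<le> 2 * (2 * CN^(n-1-j) * (2^(n-1) * nrm x))"
proof -
  have xZ: "x \<in> Z" using x by (rule W_Z)
  have D: "0 \<le> 2^(n-1) * nrm x" using nrm_nonneg[OF xZ] by simp
  have "0 \<le> 2 * CN^(n-1-j) * (2^(n-1) * nrm x)" using D CN_ge1 by simp
  from lift_ex[OF this level_bound[OF j D Z_dual_bound[OF xZ]]]
  obtain b where b: "jet_rep True (2 * (2 * CN^(n-1-j) * (2^(n-1) * nrm x))) (2 * (2 * CN^(n-1-j) * (2^(n-1) * nrm x))) b"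
    "b 0 = x j" "\<And>k i. x j k = 0 \<Longrightarrow> b i k = 0" by blast
  have x0: "x j k = 0" if "k < K" for k
  proof -
    have "x j k = restr {K..} x j k" using x by (simp add: W_def)
    then show ?thesis using that by (simp add: restr_apply)
  qed
  have "restr {K..} b = b" using b(3) x0 by (auto simp: fun_eq_iff restr_apply)
  then have "b \<in> W K" using jet_rep_Z[OF b(1)] by (simp add: W_def)
  then show ?thesis using b(2) nrm_le[OF b(1) order_refl order_refl] by blast
qed

text \<open>The power n-1 of the shift factors through the top quotient.\<close>

lemma act_X_power_cong: assumes "x 0 = y 0" shows "act (fps_X^(n-1)) x = act (fps_X^(n-1)) y"
proof (intro ext)
  fix j k
  show "act (fps_X^(n-1)) x j k = act (fps_X^(n-1)) y j k"
  proof (cases "n - 1 \<le> j \<and> j < n")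
    case True
    then have "j - (n - 1) = 0" by simp
    then show ?thesis using assms by (simp add: act_X_power)
  next
    case False
    then show ?thesis unfolding act_X_power by (simp only: if_False)
  qed
qed

lemma tnorm_diff_sq:
  assumes "x \<in> Z" "y \<in> Z"
  shows "(tnorm (x - zscale (of_real \<theta>) y))^2 = (tnorm x)^2 - 2 * \<theta> * Re (ip y x) + \<theta>^2 * (tnorm y)^2"
proof -
  have m: "zscale (of_real \<theta>) y \<in> Z" "x - zscale (of_real \<theta>) y \<in> Z" using assms Z_scale Z_diff by blast+
  have "(\<lambda>k. (cmod (x 0 k))^2 - 2 * \<theta> * Re (y 0 k * cnj (x 0 k)) + \<theta>^2 * (cmod (y 0 k))^2) sums
      (Re (ip x x) - 2 * \<theta> * Re (ip y x) + \<theta>^2 * Re (ip y y))"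
    using assms by (intro sums_add sums_diff sums_mult ip_self_sums sums_Re ip_sums)
  moreover have "(cmod (x 0 k))^2 - 2 * \<theta> * Re (y 0 k * cnj (x 0 k)) + \<theta>^2 * (cmod (y 0 k))^2
      = (cmod ((x - zscale (of_real \<theta>) y) 0 k))^2" for k
    unfolding minus_apply zscale_apply cmod_power2 by (simp add: power2_eq_square algebra_simps)
  ultimately have "(\<lambda>k. (cmod ((x - zscale (of_real \<theta>) y) 0 k))^2) sums
      (Re (ip x x) - 2 * \<theta> * Re (ip y x) + \<theta>^2 * Re (ip y y))" by simp
  then show ?thesis using ip_self_sums[OF m(2)] sums_unique2 by (simp add: tnorm_sq assms m) blast
qed

lemma ip_restr: assumes "x \<in> W K" shows "ip (restr {K..} y) x = ip y x"
proof -
  have "restr {K..} (act (fps_X^(n-1)) x) = act (fps_X^(n-1)) x" using act_W[OF assms] by (simp add: W_def)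
  then show ?thesis by (simp add: ip_def form_restr)
qed

end

section \<open>An isomorphic embedding, its adjoint, and coercivity of \<open>A\<close> at the top
  level\<close>

locale rochberg_embedding = rochberg_index +
  fixes T T' :: "(nat \<Rightarrow> nat \<Rightarrow> complex) \<Rightarrow> nat \<Rightarrow> nat \<Rightarrow> complex" and cT :: real
  assumes T: "zbop T" and T': "zbop T'" and adj: "\<And>x y. x \<in> Z \<Longrightarrow> y \<in> Z \<Longrightarrow> form (T' x) y = form x (T y)"
    and cT: "cT > 0" "\<And>x. x \<in> Z \<Longrightarrow> cT * nrm x \<le> nrm (T x)"
begin

definition A :: "(nat \<Rightarrow> nat \<Rightarrow> complex) \<Rightarrow> nat \<Rightarrow> nat \<Rightarrow> complex" where
  "A x = T' (T x)"

lemma A: "zbop A"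
  unfolding A_def[abs_def] using T' T by (rule zbop_comp)

lemma form_A: "x \<in> Z \<Longrightarrow> y \<in> Z \<Longrightarrow> form (A x) y = form (T x) (T y)"
  unfolding A_def using adj zbopD(1)[OF T] by blast

text \<open>Up to constants the ell_2 norm of the top level is the norm of the (n-1)-st shift. That
  shift nearly commutes with \<open>T\<close>, and \<open>T\<close> is bounded below. The commutator
  error is measured in \<open>nrm\<close>; the hypothesis \<open>nrm x \<le> 2 * tnorm x\<close>,
  satisfied by lifts, turns it into a small multiple of \<open>tnorm x\<close>.\<close>

lemma tnorm_T_lower:
  assumes x: "x \<in> Z" "nrm x \<le> 2 * tnorm x" and \<epsilon>: "4 * \<epsilon> \<le> cT / 2^n" "\<epsilon> \<ge> 0"
    and com: "nrm (T (act (fps_X^(n-1)) x) - act (fps_X^(n-1)) (T x)) \<le> \<epsilon> * nrm x"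
  shows "cT / (2^n * (4 * CN^(n-1))) * tnorm x \<le> tnorm (T x)"
proof -
  let ?N = "act (fps_X^(n-1))"
  have CN: "CN^(n-1) > 0" using CN_ge1 by simp
  have TZ: "T x \<in> Z" using zbopD(1)[OF T x(1)] .
  have NZ: "?N x \<in> Z" using x(1) by (rule Z_act)
  have t0: "tnorm x \<ge> 0" using tnorm_nonneg[OF x(1)] .
  \<comment> \<open>The shift of \<open>T x\<close> depends only on the top level, so
    \<open>T x\<close> may be replaced by a lift whose norm is at most
    \<open>2 * tnorm (T x)\<close>.\<close>
  obtain b where b: "b \<in> W 0" "b 0 = T x 0" "nrm b \<le> 2 * tnorm (T x)"
    using lift_W[of "T x" 0] TZ by (auto simp: W_def restr_simps)
  have bZ: "b \<in> Z" using b(1) by (rule W_Z)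
  have "?N (T x) = ?N b" using b(2) by (intro act_X_power_cong) simp
  then have "nrm (?N (T x)) \<le> CN^(n-1) * nrm b" using Z_shift(2)[OF bZ] by simp
  also have "\<dots> \<le> CN^(n-1) * (2 * tnorm (T x))" using b(3) CN by (intro mult_left_mono) auto
  finally have 1: "nrm (?N (T x)) \<le> 2 * CN^(n-1) * tnorm (T x)" by simp
  have 2: "tnorm x \<le> 2^n * nrm (?N x)"
  proof -
    have "tnorm x * tnorm x \<le> cmod (ip x x)" using tnorm_sq[OF x(1)] complex_Re_le_cmod[of "ip x x"] by (simp add: power2_eq_square)
    also have "\<dots> \<le> 2^(n-1) * nrm x * nrm (?N x)"
      using form_bound[OF x(1) NZ] by (simp add: ip_def norm_mult norm_power)
    also have "\<dots> \<le> 2^(n-1) * (2 * tnorm x) * nrm (?N x)"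
      using x(2) nrm_nonneg[OF NZ] by (intro mult_right_mono mult_left_mono) auto
    also have "\<dots> = ((2^(n-1) * 2) * nrm (?N x)) * tnorm x" by simp
    also have "2^(n-1) * 2 = (2::real)^n" using n_pos power_minus_mult[of n "2::real"] by simp
    finally show ?thesis using t0 nrm_nonneg[OF NZ] by (cases "tnorm x = 0") auto
  qed
  have "T (?N x) = (T (?N x) - ?N (T x)) + ?N (T x)" by simp
  then have "nrm (T (?N x)) \<le> nrm (T (?N x) - ?N (T x)) + nrm (?N (T x))"
    using Z_add(2)[OF Z_diff(1)[OF zbopD(1)[OF T NZ] Z_act(1)[OF TZ]] Z_act(1)[OF TZ]] by metis
  also have "\<dots> \<le> \<epsilon> * (2 * tnorm x) + 2 * CN^(n-1) * tnorm (T x)"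
    using com 1 mult_left_mono[OF x(2) \<epsilon>(2)] by linarith
  finally have 3: "cT * nrm (?N x) \<le> \<epsilon> * (2 * tnorm x) + 2 * CN^(n-1) * tnorm (T x)" using cT(2)[OF NZ] by linarith
  define q where "q = cT / 2^n * tnorm x"
  have "tnorm x / 2^n \<le> nrm (?N x)" using 2 by (simp add: pos_divide_le_eq mult.commute)
  then have "cT * (tnorm x / 2^n) \<le> cT * nrm (?N x)" using cT(1) by (intro mult_left_mono) auto
  then have "q \<le> cT * nrm (?N x)" by (simp add: q_def)
  moreover have "\<epsilon> * (2 * tnorm x) \<le> q / 2"
  proof -
    have "\<epsilon> * (2 * tnorm x) = (4 * \<epsilon>) * tnorm x / 2" by simp
    also have "\<dots> \<le> q / 2" unfolding q_def by (rule divide_right_mono[OF mult_right_mono[OF \<epsilon>(1) t0]]) simp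
    finally show ?thesis .
  qed
  ultimately have "q \<le> 2 * (2 * CN^(n-1) * tnorm (T x))" using 3 by linarith
  then have "q \<le> tnorm (T x) * (4 * CN^(n-1))" by (simp add: mult_ac)
  then have "q / (4 * CN^(n-1)) \<le> tnorm (T x)" using CN by (simp add: pos_divide_le_eq)
  moreover have "q / (4 * CN^(n-1)) = cT / (2^n * (4 * CN^(n-1))) * tnorm x" by (simp add: q_def)
  ultimately show ?thesis by (simp only:)
qed

text \<open>The adjoint relation puts one \<open>T\<close> in front of the (n-1)-st shift of
  \<open>x\<close>; exchanging the two produces the square of \<open>tnorm (T x)\<close> up to a
  commutator error.\<close>

lemma ip_A_lower: "\<exists>c>0. \<forall>\<^sub>F K in sequentially. \<forall>x\<in>W K. nrm x \<le> 2 * tnorm x \<longrightarrow> c * (tnorm x)^2 \<le> Re (ip (A x) x)"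
proof -
  obtain CT where CT: "CT \<ge> 0" "\<And>x. x \<in> Z \<Longrightarrow> nrm (T x) \<le> CT * nrm x" using zbop_bound[OF T] by blast
  have CN: "CN^(n-1) > 0" using CN_ge1 by simp
  define c0 where "c0 = cT / (2^n * (4 * CN^(n-1)))"
  have c0: "c0 > 0" using cT(1) CN by (simp add: c0_def)
  \<comment> \<open>The first bound is the one required by \<open>tnorm_T_lower\<close>; the second
    lets half of \<open>c0^2\<close> absorb the commutator error.\<close>
  define \<epsilon> where "\<epsilon> = min (cT / 2^n / 4) (c0^2 / (2 * (2^(n-1) * (CT + 1) * 4)))"
  have \<epsilon>: "\<epsilon> > 0" "4 * \<epsilon> \<le> cT / 2^n" "\<epsilon> \<le> c0^2 / (2 * (2^(n-1) * (CT + 1) * 4))"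
    using c0 cT(1) CT(1) by (auto simp: \<epsilon>_def)
  have \<epsilon>3: "2^(n-1) * (CT + 1) * 4 * \<epsilon> \<le> c0^2 / 2"
  proof -
    have "2 * (2^(n-1) * (CT + 1) * 4) > 0" using CT(1) by simp
    then have "\<epsilon> * (2 * (2^(n-1) * (CT + 1) * 4)) \<le> c0^2" using \<epsilon>(3) by (simp only: pos_le_divide_eq)
    then show ?thesis by (simp add: algebra_simps)
  qed
  have "\<forall>\<^sub>F K in sequentially. \<forall>x\<in>W K. nrm x \<le> 2 * tnorm x \<longrightarrow> (c0^2/2) * (tnorm x)^2 \<le> Re (ip (A x) x)"
    using shift_commutator_small[OF T \<epsilon>(1), of "n-1"]
  proof eventually_elim
    case (elim K)
    show ?case
    proof (intro ballI impI)
      fix x assume xW: "x \<in> W K" and x2: "nrm x \<le> 2 * tnorm x"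
      let ?N = "act (fps_X^(n-1))"
      let ?d = "T (?N x) - ?N (T x)"
      have x: "x \<in> Z" using xW by (rule W_Z)
      have TZ: "T x \<in> Z" using zbopD(1)[OF T x] .
      have NZ: "?N x \<in> Z" using x by (rule Z_act)
      have dZ: "?d \<in> Z" using Z_diff(1)[OF zbopD(1)[OF T NZ] Z_act(1)[OF TZ]] .
      have com: "nrm ?d \<le> \<epsilon> * nrm x" using elim xW by blast
      have t0: "tnorm x \<ge> 0" using tnorm_nonneg[OF x] .
      have low: "c0 * tnorm x \<le> tnorm (T x)"
        unfolding c0_def using tnorm_T_lower[OF x x2 \<epsilon>(2) _ com] \<epsilon>(1) by simp
      have "form (A x) (?N x) = form (T x) (T (?N x))" using form_A[OF x NZ] .
      also have "\<dots> = form (T x) (?N (T x) + ?d)" by simp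
      also have "\<dots> = form (T x) (?N (T x)) + form (T x) ?d" using form_add_right[OF TZ Z_act(1)[OF TZ] dZ] .
      finally have "ip (A x) x = ip (T x) (T x) + (-1)^(n-1) * form (T x) ?d"
        by (simp add: ip_def distrib_left)
      moreover have "cmod ((-1)^(n-1) * form (T x) ?d) \<le> 2^(n-1) * (CT + 1) * 4 * \<epsilon> * (tnorm x)^2"
      proof -
        have "cmod ((-1)^(n-1) * form (T x) ?d) \<le> 2^(n-1) * nrm (T x) * nrm ?d"
          using form_bound[OF TZ dZ] by (simp add: norm_mult norm_power)
        also have "\<dots> \<le> 2^(n-1) * ((CT + 1) * (2 * tnorm x)) * (\<epsilon> * (2 * tnorm x))"
        proof (intro mult_mono)
          have "nrm (T x) \<le> CT * nrm x" by (rule CT(2)[OF x])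
          also have "\<dots> \<le> (CT + 1) * (2 * tnorm x)" using x2 CT(1) nrm_nonneg[OF x] by (intro mult_mono) auto
          finally show "nrm (T x) \<le> (CT + 1) * (2 * tnorm x)" .
          show "nrm ?d \<le> \<epsilon> * (2 * tnorm x)" using com mult_left_mono[OF x2, of \<epsilon>] \<epsilon>(1) by linarith
        qed (use CT(1) t0 nrm_nonneg[OF TZ] nrm_nonneg[OF dZ] in auto)
        also have "\<dots> = 2^(n-1) * (CT + 1) * 4 * \<epsilon> * (tnorm x)^2" by (simp add: power2_eq_square)
        finally show ?thesis .
      qed
      moreover have "\<dots> \<le> (c0^2/2) * (tnorm x)^2" using \<epsilon>3 by (intro mult_right_mono) auto
      moreover have "Re (ip (T x) (T x)) \<ge> c0^2 * (tnorm x)^2"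
      proof -
        have "(c0 * tnorm x)^2 \<le> (tnorm (T x))^2" using low c0 t0 by (intro power_mono) auto
        then show ?thesis by (simp add: tnorm_sq[OF TZ] power_mult_distrib)
      qed
      ultimately show "(c0^2/2) * (tnorm x)^2 \<le> Re (ip (A x) x)"
        using abs_Re_le_cmod[of "(-1)^(n-1) * form (T x) ?d"] by (simp only: plus_complex.sel abs_le_iff) linarith
    qed
  qed
  then show ?thesis using c0 by (intro exI[of _ "c0^2/2"]) auto
qed

text \<open>The usual estimate for a damped iteration with a coercive operator: the squared norm is
  multiplied by at most 1 - 2 \<theta> c + \<theta>^2 B^2, which is smallest at \<theta> = c / B^2.
  Taking B \<ge> c keeps the radicand of \<rho> nonnegative.\<close>

lemma contraction: "\<exists>\<theta> \<rho>. 0 < \<theta> \<and> 0 \<le> \<rho> \<and> \<rho> < 1 \<and> (\<forall>\<^sub>F K in sequentially. \<forall>x\<in>W K. nrm x \<le> 2 * tnorm x \<longrightarrow>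
    tnorm (x - zscale (of_real \<theta>) (restr {K..} (A x))) \<le> \<rho> * tnorm x)"
proof -
  obtain c where c: "c > 0" and ev: "\<forall>\<^sub>F K in sequentially. \<forall>x\<in>W K. nrm x \<le> 2 * tnorm x \<longrightarrow> c * (tnorm x)^2 \<le> Re (ip (A x) x)"
    using ip_A_lower by blast
  obtain CA where CA: "CA \<ge> 0" "\<And>x. x \<in> Z \<Longrightarrow> nrm (A x) \<le> CA * nrm x" using zbop_bound[OF A] by blast
  define B where "B = max c (2^n * CN^n * CA * 2)"
  have B: "B \<ge> c" "B > 0" "2^n * CN^n * CA * 2 \<le> B" using c by (auto simp: B_def)
  define \<theta> where "\<theta> = c / B^2"
  define \<rho> where "\<rho> = sqrt (1 - c^2 / B^2)"
  have th: "\<theta> > 0" using c B by (simp add: \<theta>_def)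
  have cB: "c^2 / B^2 \<le> 1" "c^2 / B^2 > 0" using c B by (auto intro: power_mono simp: divide_le_eq_1)
  then have rho: "0 \<le> \<rho>" "\<rho> < 1" "\<rho>^2 = 1 - c^2 / B^2" by (auto simp: \<rho>_def)
  from ev have "\<forall>\<^sub>F K in sequentially. \<forall>x\<in>W K. nrm x \<le> 2 * tnorm x \<longrightarrow>
    tnorm (x - zscale (of_real \<theta>) (restr {K..} (A x))) \<le> \<rho> * tnorm x"
  proof eventually_elim
    case (elim K)
    show ?case
    proof (intro ballI impI)
      fix x assume xW: "x \<in> W K" and x2: "nrm x \<le> 2 * tnorm x"
      let ?y = "restr {K..} (A x)"
      have x: "x \<in> Z" using xW by (rule W_Z)
      have AZ: "A x \<in> Z" using zbopD(1)[OF A x] .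
      have y: "?y \<in> Z" using AZ by (rule Z_restr)
      have t0: "tnorm x \<ge> 0" using tnorm_nonneg[OF x] .
      have "tnorm ?y \<le> 2^n * CN^n * nrm ?y" by (rule tnorm_le[OF y])
      also have "\<dots> \<le> 2^n * CN^n * (CA * (2 * tnorm x))"
        using Z_restr(2)[OF AZ, of "{K..}"] CA(2)[OF x] mult_left_mono[OF x2 CA(1)] CN_ge1
        by (intro mult_left_mono) auto
      also have "\<dots> \<le> B * tnorm x" using mult_right_mono[OF B(3) t0] by (simp add: mult.assoc)
      finally have ty: "(tnorm ?y)^2 \<le> (B * tnorm x)^2" using tnorm_nonneg[OF y] by (intro power_mono)
      have "c * (tnorm x)^2 \<le> Re (ip ?y x)" using elim xW x2 ip_restr[OF xW] by simp
      then have "2 * \<theta> * (c * (tnorm x)^2) \<le> 2 * \<theta> * Re (ip ?y x)" using th by (intro mult_left_mono) auto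
      moreover have "\<theta>^2 * (tnorm ?y)^2 \<le> \<theta>^2 * (B * tnorm x)^2" using ty by (intro mult_left_mono) auto
      ultimately have "(tnorm (x - zscale (of_real \<theta>) ?y))^2 \<le> (tnorm x)^2 - 2 * \<theta> * (c * (tnorm x)^2) + \<theta>^2 * (B * tnorm x)^2"
        unfolding tnorm_diff_sq[OF x y] by linarith
      also have "\<dots> = (1 - c^2 / B^2) * (tnorm x)^2"
      proof -
        have e: "\<theta> * c = c^2 / B^2" "\<theta>^2 * B^2 = c^2 / B^2"
          using B(2) by (simp_all add: \<theta>_def power2_eq_square)
        have "(tnorm x)^2 - 2 * \<theta> * (c * (tnorm x)^2) + \<theta>^2 * (B * tnorm x)^2
            = (tnorm x)^2 - 2 * (\<theta> * c) * (tnorm x)^2 + (\<theta>^2 * B^2) * (tnorm x)^2"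
          by (simp add: power_mult_distrib)
        then show ?thesis unfolding e by (simp add: algebra_simps)
      qed
      finally have "(tnorm (x - zscale (of_real \<theta>) ?y))^2 \<le> (\<rho> * tnorm x)^2" by (simp add: rho(3) power_mult_distrib)
      moreover have "0 \<le> \<rho> * tnorm x" using rho(1) t0 by simp
      ultimately show "tnorm (x - zscale (of_real \<theta>) ?y) \<le> \<rho> * tnorm x" by (rule power2_le_imp_le)
    qed
  qed
  then show ?thesis using th rho(1,2) by blast
qed

end

section \<open>Solving modulo null sequences\<close>

context rochberg_index
begin

lemma W_add: "x \<in> W K \<Longrightarrow> y \<in> W K \<Longrightarrow> x + y \<in> W K"
  and W_diff: "x \<in> W K \<Longrightarrow> y \<in> W K \<Longrightarrow> x - y \<in> W K"
  and W_scale: "x \<in> W K \<Longrightarrow> zscale c x \<in> W K"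
  and W_0: "0 \<in> W K"
  by (auto simp: W_def restr_simps Z_add Z_diff Z_scale)

text \<open>Modulo null sequences, the sequences \<open>x\<^sub>m \<in> W m\<close> bounded in norm form a space on which all operators commute
  with the shift \<open>N = act fps_X\<close>; this removes all bookkeeping of error terms.\<close>
definition bseq :: "(nat \<Rightarrow> nat \<Rightarrow> nat \<Rightarrow> complex) \<Rightarrow> bool" where
  "bseq x \<longleftrightarrow> (\<forall>m. x m \<in> W m) \<and> (\<exists>B. \<forall>m. nrm (x m) \<le> B)"

definition nullseq :: "(nat \<Rightarrow> nat \<Rightarrow> nat \<Rightarrow> complex) \<Rightarrow> bool" where
  "nullseq x \<longleftrightarrow> (\<forall>m. x m \<in> Z) \<and> (\<lambda>m. nrm (x m)) \<longlonglongrightarrow> 0"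

lemma bseqD: "bseq x \<Longrightarrow> x m \<in> W m" "bseq x \<Longrightarrow> x m \<in> Z"
  unfolding bseq_def using W_Z by blast+

lemma bseq_bound: assumes "bseq x" obtains B where "B \<ge> 0" "\<And>m. nrm (x m) \<le> B"
proof -
  obtain B where B: "\<And>m. nrm (x m) \<le> B" using assms by (auto simp: bseq_def)
  then have "B \<ge> 0" using nrm_nonneg[OF bseqD(2)[OF assms, of 0]] order_trans by blast
  then show ?thesis using that B by blast
qed

lemma bseqI: "(\<And>m. x m \<in> W m) \<Longrightarrow> (\<And>m. nrm (x m) \<le> B) \<Longrightarrow> bseq x"
  by (auto simp: bseq_def)

lemma nullseqI: assumes "\<And>m. x m \<in> Z" "\<And>m. nrm (x m) \<le> e m" "e \<longlonglongrightarrow> 0" shows "nullseq x"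
proof -
  have "(\<lambda>m. nrm (x m)) \<longlonglongrightarrow> 0"
    by (rule real_tendsto_sandwich[OF _ _ tendsto_const assms(3)]) (use assms nrm_nonneg in auto)
  then show ?thesis using assms(1) by (simp add: nullseq_def)
qed

lemma bseq_add: assumes "bseq x" "bseq y" shows "bseq (\<lambda>m. x m + y m)"
proof -
  obtain B where B: "\<And>m. nrm (x m) \<le> B" using bseq_bound[OF assms(1)] by blast
  obtain C where C: "\<And>m. nrm (y m) \<le> C" using bseq_bound[OF assms(2)] by blast
  show ?thesis
  proof (rule bseqI)
    show "x m + y m \<in> W m" for m using assms bseqD(1) W_add by blast
    show "nrm (x m + y m) \<le> B + C" for m
      using Z_add(2)[OF bseqD(2)[OF assms(1)] bseqD(2)[OF assms(2)], of m m] B[of m] C[of m] by linarith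
  qed
qed

lemma bseq_scale: assumes "bseq x" shows "bseq (\<lambda>m. zscale c (x m))"
proof -
  obtain B where B: "\<And>m. nrm (x m) \<le> B" using bseq_bound[OF assms(1)] by blast
  show ?thesis
  proof (rule bseqI)
    show "zscale c (x m) \<in> W m" for m using assms bseqD(1) W_scale by blast
    show "nrm (zscale c (x m)) \<le> cmod c * B" for m
      using Z_scale(2)[OF bseqD(2)[OF assms], of c m] B[of m] by (simp add: mult_left_mono)
  qed
qed

lemma bseq_diff: assumes "bseq x" "bseq y" shows "bseq (\<lambda>m. x m - y m)"
  using bseq_add[OF assms(1) bseq_scale[OF assms(2), of "-1"]] by (simp add: zscale_simps)

lemma bseq_op: assumes "zbop S" "bseq x" shows "bseq (\<lambda>m. restr {m..} (S (x m)))"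
proof -
  obtain B where B: "\<And>m. nrm (x m) \<le> B" using bseq_bound[OF assms(2)] by blast
  obtain C where C: "C \<ge> 0" "\<And>x. x \<in> Z \<Longrightarrow> nrm (S x) \<le> C * nrm x" using zbop_bound[OF assms(1)] by blast
  show ?thesis
  proof (rule bseqI)
    fix m
    have SZ: "S (x m) \<in> Z" using zbopD(1)[OF assms(1) bseqD(2)[OF assms(2)]] .
    show "restr {m..} (S (x m)) \<in> W m" using SZ by (rule restr_W)
    show "nrm (restr {m..} (S (x m))) \<le> C * B"
      using Z_restr(2)[OF SZ, of "{m..}"] C(2)[OF bseqD(2)[OF assms(2), of m]] mult_left_mono[OF B[of m] C(1)] by linarith
  qed
qed

lemma bseq_act: assumes "bseq x" shows "bseq (\<lambda>m. act F (x m))"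
proof -
  have "restr {m..} (act F (x m)) = act F (x m)" for m using act_W[OF bseqD(1)[OF assms]] by (simp add: W_def)
  then show ?thesis using bseq_op[OF zbop_act assms, of F] by simp
qed

lemma nullseq_add: assumes "nullseq x" "nullseq y" shows "nullseq (\<lambda>m. x m + y m)"
proof (rule nullseqI)
  have m: "x m \<in> Z" "y m \<in> Z" for m using assms by (auto simp: nullseq_def)
  show "x m + y m \<in> Z" for m using m Z_add by blast
  show "nrm (x m + y m) \<le> nrm (x m) + nrm (y m)" for m using m Z_add by blast
  show "(\<lambda>m. nrm (x m) + nrm (y m)) \<longlonglongrightarrow> 0" using assms tendsto_add[of _ 0 _ _ 0] by (fastforce simp: nullseq_def)
qed

lemma nullseq_diff: assumes "nullseq x" "nullseq y" shows "nullseq (\<lambda>m. x m - y m)"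
proof (rule nullseqI)
  have m: "x m \<in> Z" "y m \<in> Z" for m using assms by (auto simp: nullseq_def)
  show "x m - y m \<in> Z" for m using m Z_diff by blast
  show "nrm (x m - y m) \<le> nrm (x m) + nrm (y m)" for m using m Z_diff by blast
  show "(\<lambda>m. nrm (x m) + nrm (y m)) \<longlonglongrightarrow> 0" using assms tendsto_add[of _ 0 _ _ 0] by (fastforce simp: nullseq_def)
qed

text \<open>Since \<open>x m\<close> lies in \<open>W m\<close>, the estimate of commutators on
  far-out vectors becomes convergence to 0.\<close>

lemma nullseq_commutator: assumes S: "zbop S" and x: "bseq x"
  shows "nullseq (\<lambda>m. restr {m..} (S (act (fps_X^j) (x m))) - act (fps_X^j) (restr {m..} (S (x m))))"
proof -
  obtain B where B: "B > 0" "\<And>m. nrm (x m) \<le> B"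
  proof -
    obtain B' where "B' \<ge> 0" "\<And>m. nrm (x m) \<le> B'" using bseq_bound[OF x] by blast
    then show ?thesis using that[of "B' + 1"] by (simp add: add_increasing2)
  qed
  let ?d = "\<lambda>m. S (act (fps_X^j) (x m)) - act (fps_X^j) (S (x m))"
  have xZ: "x m \<in> Z" for m using bseqD(2)[OF x] .
  have dZ: "?d m \<in> Z" for m
    using Z_diff(1)[OF zbopD(1)[OF S Z_act(1)[OF xZ]] Z_act(1)[OF zbopD(1)[OF S xZ]]] .
  have eq: "restr {m..} (S (act (fps_X^j) (x m))) - act (fps_X^j) (restr {m..} (S (x m))) = restr {m..} (?d m)" for m
    by (simp add: restr_simps act_restr)
  have "(\<lambda>m. nrm (?d m)) \<longlonglongrightarrow> 0"
  proof (rule LIMSEQ_I)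
    fix r :: real assume r: "r > 0"
    have "r / (2 * B) > 0" using r B by simp
    from shift_commutator_small[OF S this, of j]
    obtain K where K: "\<And>m y. m \<ge> K \<Longrightarrow> y \<in> W m \<Longrightarrow> nrm (S (act (fps_X^j) y) - act (fps_X^j) (S y)) \<le> r / (2 * B) * nrm y"
      unfolding eventually_sequentially by blast
    have "norm (nrm (?d m) - 0) < r" if "m \<ge> K" for m
    proof -
      have "nrm (?d m) \<le> r / (2 * B) * nrm (x m)" using K[OF that bseqD(1)[OF x]] .
      also have "\<dots> \<le> r / (2 * B) * B" using B(1) B(2)[of m] r by (intro mult_left_mono) auto
      also have "\<dots> = r / 2" using B by simp
      finally show ?thesis using nrm_nonneg[OF dZ] r by simp
    qed
    then show "\<exists>no. \<forall>m\<ge>no. norm (nrm (?d m) - 0) < r" by blast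
  qed
  then show ?thesis unfolding eq using dZ Z_restr by (intro nullseqI[where e="\<lambda>m. nrm (?d m)"]) auto
qed

text \<open>Completeness for geometric series. The limit is formed coordinatewise; its membership in
  \<open>Z\<close> and the rate come from the dual criterion, because pairings with finitely
  supported vectors pass to the limit.\<close>

lemma series_converges:
  assumes x: "\<And>i. x i \<in> Z" "\<And>i. nrm (x i) \<le> C * (1/2)^i" and C: "C \<ge> 0"
  shows "\<exists>s\<in>Z. \<forall>m. nrm (s - (\<Sum>i<m. x i)) \<le> CD * (2^(n-1) * (2 * C)) * (1/2)^m"
proof -
  have "summable (\<lambda>i. x i j k)" for j k
  proof (rule summable_comparison_test'[where N=0])
    show "summable (\<lambda>i. 2^n * (C * (1/2)^i))" by (intro summable_mult summable_geometric) simp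
    show "norm (x i j k) \<le> 2^n * (C * (1/2)^i)" for i
      by (rule order_trans[OF Z_coord[OF x(1)] mult_left_mono[OF x(2)]]) simp
  qed
  define s where "s j k = (\<Sum>i. x i j k)" for j k
  have lim: "(\<lambda>l. (\<Sum>i<l. x i) j k) \<longlonglongrightarrow> s j k" for j k
    unfolding s_def sum_fun_apply2 using \<open>\<And>j k. summable (\<lambda>i. x i j k)\<close> by (rule summable_LIMSEQ)
  have js: "jets s" using Z_jets[OF x(1)] by (auto simp: jets_def s_def fun_eq_iff zero_fun_apply)
  have P: "(\<Sum>i<m. x i) \<in> Z" for m using x(1) by (intro Z_sum_mem)
  have pb: "nrm ((\<Sum>i<l. x i) - (\<Sum>i<m. x i)) \<le> 2 * C * (1/2)^m" if "m \<le> l" for l m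
  proof -
    have "(\<Sum>i<l. x i) - (\<Sum>i<m. x i) = (\<Sum>i\<in>{m..<l}. x i)"
      using that by (simp add: sum_diff_nat_ivl[of 0 m l x, symmetric] atLeast0LessThan)
    then have "nrm ((\<Sum>i<l. x i) - (\<Sum>i<m. x i)) \<le> (\<Sum>i\<in>{m..<l}. nrm (x i))" using x(1) by (simp add: Z_sum_nrm)
    also have "\<dots> \<le> (\<Sum>i\<in>{m..<l}. C * (1/2)^i)" using x(2) by (intro sum_mono)
    also have "\<dots> \<le> 2 * C * (1/2)^m"
    proof -
      have "(\<Sum>i\<in>{m..<l}. C * (1/2::real)^i) = 2 * C * (1/2)^m - 2 * C * (1/2)^l"
        using that by (induction l rule: dec_induct) auto
      then show ?thesis using C by simp
    qed
    finally show ?thesis .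
  qed
  have "dual_bound (2^(n-1) * (2 * C * (1/2)^m)) (s - (\<Sum>i<m. x i))" for m
    unfolding dual_bound_def
  proof (intro ballI impI)
    fix y assume y: "y \<in> Z" "finsupp y"
    then obtain K where K: "restr {..<K} y = y" by (auto simp: finsupp_def)
    have "(\<lambda>l. form ((\<Sum>i<l. x i) - (\<Sum>i<m. x i)) y) \<longlonglongrightarrow> form (s - (\<Sum>i<m. x i)) y"
      unfolding form_finsupp[OF K] fterm_def fps_mult_nth col_nth minus_apply
      by (intro tendsto_sum tendsto_mult tendsto_diff tendsto_const lim)
    then have "(\<lambda>l. cmod (form ((\<Sum>i<l. x i) - (\<Sum>i<m. x i)) y)) \<longlonglongrightarrow> cmod (form (s - (\<Sum>i<m. x i)) y)"
      by (rule tendsto_norm)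
    moreover have "\<forall>\<^sub>F l in sequentially. cmod (form ((\<Sum>i<l. x i) - (\<Sum>i<m. x i)) y) \<le> 2^(n-1) * (2 * C * (1/2)^m) * nrm y"
      using eventually_ge_at_top[of m]
    proof eventually_elim
      case (elim l)
      have "cmod (form ((\<Sum>i<l. x i) - (\<Sum>i<m. x i)) y) \<le> 2^(n-1) * nrm ((\<Sum>i<l. x i) - (\<Sum>i<m. x i)) * nrm y"
        using P y(1) by (intro form_bound Z_diff)
      also have "\<dots> \<le> 2^(n-1) * (2 * C * (1/2)^m) * nrm y"
        using pb[OF elim] nrm_nonneg[OF y(1)] by (intro mult_right_mono mult_left_mono) auto
      finally show ?case .
    qed
    ultimately show "cmod (form (s - (\<Sum>i<m. x i)) y) \<le> 2^(n-1) * (2 * C * (1/2)^m) * nrm y"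
      by (rule tendsto_upperbound) simp
  qed
  then have *: "s - (\<Sum>i<m. x i) \<in> Z \<and> nrm (s - (\<Sum>i<m. x i)) \<le> CD * (2^(n-1) * (2 * C * (1/2)^m))" for m
    using js Z_jets[OF P[of m]] C by (intro dual_criterion_nrm) auto
  have "s \<in> Z" using *[of 0] by simp
  then show ?thesis using * by (intro bexI[of _ s]) (auto simp: mult.assoc)
qed

end

context rochberg_embedding
begin

text \<open>Damped iteration at the top level. As \<open>contraction\<close> needs vectors with
  \<open>nrm\<close> comparable to \<open>tnorm\<close>, each residual is first replaced by a lift
  of its top level. The steps decay geometrically, so the bound on \<open>x\<close> does not depend
  on the number \<open>m\<close> of iterations.\<close>

lemma top_level_solve: "\<exists>C\<ge>0. \<exists>\<rho>. 0 \<le> \<rho> \<and> \<rho> < 1 \<and> (\<forall>\<^sub>F K in sequentially. \<forall>b\<in>W K. \<forall>m.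
    \<exists>x\<in>W K. nrm x \<le> C * tnorm b \<and> tnorm (b - restr {K..} (A x)) \<le> \<rho>^m * tnorm b)"
proof -
  obtain \<theta> \<rho> where th: "0 < \<theta>" "0 \<le> \<rho>" "\<rho> < 1" and ev: "\<forall>\<^sub>F K in sequentially. \<forall>x\<in>W K. nrm x \<le> 2 * tnorm x \<longrightarrow>
    tnorm (x - zscale (of_real \<theta>) (restr {K..} (A x))) \<le> \<rho> * tnorm x" using contraction by blast
  have "\<forall>\<^sub>F K in sequentially. \<forall>b\<in>W K. \<forall>m.
    \<exists>x\<in>W K. nrm x \<le> 2 * \<theta> / (1 - \<rho>) * tnorm b \<and> tnorm (b - restr {K..} (A x)) \<le> \<rho>^m * tnorm b"
    using ev
  proof eventually_elim
    case (elim K)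
    show ?case
    proof (intro ballI allI)
      fix b m assume b: "b \<in> W K"
      have bZ: "b \<in> Z" using b by (rule W_Z)
      have "\<exists>x\<in>W K. nrm x \<le> 2 * \<theta> * (\<Sum>i<m. \<rho>^i) * tnorm b \<and> tnorm (b - restr {K..} (A x)) \<le> \<rho>^m * tnorm b"
      proof (induction m)
        case 0
        show ?case using W_0 zbop_0[OF A] by (intro bexI[of _ 0]) (auto simp: restr_simps)
      next
        case (Suc m)
        then obtain x where x: "x \<in> W K" "nrm x \<le> 2 * \<theta> * (\<Sum>i<m. \<rho>^i) * tnorm b"
          "tnorm (b - restr {K..} (A x)) \<le> \<rho>^m * tnorm b" by blast
        have xZ: "x \<in> Z" using x(1) by (rule W_Z)
        define r where "r = b - restr {K..} (A x)"
        have rW: "r \<in> W K" unfolding r_def using b restr_W[OF zbopD(1)[OF A xZ]] by (rule W_diff)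
        have rZ: "r \<in> Z" using rW by (rule W_Z)
        obtain v where v: "v \<in> W K" "v 0 = r 0" "nrm v \<le> 2 * tnorm r" using lift_W[OF rW] by blast
        have vZ: "v \<in> Z" using v(1) by (rule W_Z)
        have tv: "tnorm v = tnorm r" by (rule tnorm_cong[OF vZ rZ v(2)])
        define x' where "x' = x + zscale (of_real \<theta>) v"
        have sZ: "zscale (of_real \<theta>) v \<in> Z" using vZ by (rule Z_scale)
        have x'W: "x' \<in> W K" unfolding x'_def using x(1) W_scale[OF v(1)] by (rule W_add)
        have "nrm x' \<le> nrm x + \<theta> * nrm v"
          unfolding x'_def using Z_add(2)[OF xZ sZ] Z_scale(2)[OF vZ] th(1) by simp
        also have "\<dots> \<le> 2 * \<theta> * (\<Sum>i<m. \<rho>^i) * tnorm b + \<theta> * (2 * (\<rho>^m * tnorm b))"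
          using x(2,3) v(3) th(1) unfolding r_def by (intro add_mono mult_left_mono) auto
        also have "\<dots> = 2 * \<theta> * (\<Sum>i<Suc m. \<rho>^i) * tnorm b" by (simp add: algebra_simps)
        finally have n: "nrm x' \<le> 2 * \<theta> * (\<Sum>i<Suc m. \<rho>^i) * tnorm b" .
        have AvZ: "restr {K..} (A v) \<in> Z" using zbopD(1)[OF A vZ] by (rule Z_restr)
        have e: "b - restr {K..} (A x') = r - zscale (of_real \<theta>) (restr {K..} (A v))"
          unfolding r_def x'_def zbopD(2)[OF A xZ sZ] zbopD(3)[OF A vZ] by (simp add: restr_simps)
        have "tnorm (b - restr {K..} (A x')) = tnorm (v - zscale (of_real \<theta>) (restr {K..} (A v)))"
          unfolding e using rZ vZ AvZ v(2) by (intro tnorm_cong Z_diff Z_scale) (auto simp: fun_eq_iff)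
        also have "\<dots> \<le> \<rho> * tnorm v"
        proof -
          have "nrm v \<le> 2 * tnorm v" using v(3) tv by simp
          then show ?thesis using elim v(1) by blast
        qed
        also have "\<dots> \<le> \<rho> * (\<rho>^m * tnorm b)" using x(3) th(2) unfolding tv r_def by (intro mult_left_mono)
        finally have "tnorm (b - restr {K..} (A x')) \<le> \<rho>^Suc m * tnorm b" by (simp add: mult.assoc)
        then show ?case using n x'W by blast
      qed
      moreover have "2 * \<theta> * (\<Sum>i<m. \<rho>^i) * tnorm b \<le> 2 * \<theta> / (1 - \<rho>) * tnorm b"
      proof (rule mult_right_mono[OF _ tnorm_nonneg[OF bZ]])
        have "(\<Sum>i<m. \<rho>^i) \<le> 1 / (1 - \<rho>)"
        proof -
          have "(\<Sum>i<m. \<rho>^i) = (1 - \<rho>^m) / (1 - \<rho>)" using th(3) sum_gp_strict[of \<rho> m] by simp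
          also have "\<dots> \<le> 1 / (1 - \<rho>)" using th(2,3) by (intro divide_right_mono) auto
          finally show ?thesis .
        qed
        then show "2 * \<theta> * (\<Sum>i<m. \<rho>^i) \<le> 2 * \<theta> / (1 - \<rho>)" using mult_left_mono[of _ _ "2 * \<theta>"] th(1) by fastforce
      qed
      ultimately show "\<exists>x\<in>W K. nrm x \<le> 2 * \<theta> / (1 - \<rho>) * tnorm b \<and> tnorm (b - restr {K..} (A x)) \<le> \<rho>^m * tnorm b"
        by (meson order_trans)
    qed
  qed
  then show ?thesis using th by (intro exI[of _ "2 * \<theta> / (1 - \<rho>)"] conjI exI[of _ \<rho>]) auto
qed

text \<open>A diagonal choice: the equation with index \<open>m\<close> gets \<open>m\<close>
  iterations, so the residuals tend to 0; the finitely many indices below \<open>K\<close> get the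
  solution 0.\<close>

lemma top_level_solve_seq: assumes v: "bseq v"
  shows "\<exists>x. bseq x \<and> (\<lambda>m. tnorm (v m - restr {m..} (A (x m)))) \<longlonglongrightarrow> 0"
proof -
  obtain C \<rho> K where C: "C \<ge> 0" "0 \<le> \<rho>" "\<rho> < 1" and K: "\<And>m b l. m \<ge> K \<Longrightarrow> b \<in> W m \<Longrightarrow>
    \<exists>x\<in>W m. nrm x \<le> C * tnorm b \<and> tnorm (b - restr {m..} (A x)) \<le> \<rho>^l * tnorm b"
    using top_level_solve unfolding eventually_sequentially by blast
  obtain B where B: "B \<ge> 0" "\<And>m. nrm (v m) \<le> B" using bseq_bound[OF v] by blast
  define B' where "B' = 2^n * CN^n * B"
  have tb: "tnorm (v m) \<le> B'" for m
  proof -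
    have "tnorm (v m) \<le> 2^n * CN^n * nrm (v m)" using tnorm_le[OF bseqD(2)[OF v]] .
    also have "\<dots> \<le> B'" unfolding B'_def using B(2) CN_ge1 by (intro mult_left_mono) auto
    finally show ?thesis .
  qed
  have B'0: "B' \<ge> 0" using B(1) CN_ge1 by (simp add: B'_def)
  have "\<exists>x\<in>W m. nrm x \<le> C * B' \<and> (m \<ge> K \<longrightarrow> tnorm (v m - restr {m..} (A x)) \<le> \<rho>^m * B')" for m
  proof (cases "m \<ge> K")
    case True
    then obtain x where x: "x \<in> W m" "nrm x \<le> C * tnorm (v m)" "tnorm (v m - restr {m..} (A x)) \<le> \<rho>^m * tnorm (v m)"
      using K[OF True bseqD(1)[OF v], of m] by blast
    then show ?thesis using mult_left_mono[OF tb C(1), of m] mult_left_mono[OF tb, of "\<rho>^m" m] C(2) by (intro bexI[of _ x]) auto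
  next
    case False
    then show ?thesis using W_0 C(1) B'0 by (intro bexI[of _ 0]) auto
  qed
  then obtain x where x: "\<And>m. x m \<in> W m" "\<And>m. nrm (x m) \<le> C * B'" "\<And>m. m \<ge> K \<Longrightarrow> tnorm (v m - restr {m..} (A (x m))) \<le> \<rho>^m * B'" by metis
  have "bseq x" using x(1,2) by (rule bseqI)
  moreover have "(\<lambda>m. tnorm (v m - restr {m..} (A (x m)))) \<longlonglongrightarrow> 0"
  proof (rule real_tendsto_sandwich)
    show "\<forall>\<^sub>F m in sequentially. 0 \<le> tnorm (v m - restr {m..} (A (x m)))"
    proof (intro always_eventually allI tnorm_nonneg Z_diff Z_restr)
      show "v m \<in> Z" for m using bseqD(2)[OF v] .
      show "A (x m) \<in> Z" for m using zbopD(1)[OF A W_Z[OF x(1)]] .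
    qed
    show "\<forall>\<^sub>F m in sequentially. tnorm (v m - restr {m..} (A (x m))) \<le> \<rho>^m * B'"
      using eventually_ge_at_top[of K] by (rule eventually_mono) (rule x(3))
    show "(\<lambda>m. \<rho>^m * B') \<longlonglongrightarrow> 0" using C by (intro tendsto_mult_left_zero LIMSEQ_power_zero) auto
  qed simp
  ultimately show ?thesis by blast
qed

text \<open>Downward induction on the number of vanishing leading levels. The leading level of
  \<open>b\<close> is moved to the top and solved there by \<open>X\<close>; the j-th shift of
  \<open>X\<close> solves it in its place, as \<open>A\<close> commutes with the shift modulo null
  sequences.\<close>

lemma seq_solve:
  assumes "j \<le> n"
  shows "\<forall>b. bseq b \<longrightarrow> (\<forall>m. \<forall>i<j. b m i = 0) \<longrightarrow> (\<exists>x. bseq x \<and> nullseq (\<lambda>m. b m - restr {m..} (A (x m))))"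
  using assms
proof (induction j rule: inc_induct)
  case base
  show ?case
  proof (intro allI impI)
    fix b assume b: "bseq b" "\<forall>m. \<forall>i<n. b m i = 0"
    have "b m = 0" for m
    proof (rule ext)
      fix i
      show "b m i = 0 i" using b(2) Z_jets[OF bseqD(2)[OF b(1)], of m] by (cases "i < n") (auto simp: jets_def zero_fun_apply)
    qed
    moreover have "bseq (\<lambda>m. 0)" using W_0 by (intro bseqI[of _ 0]) auto
    ultimately show "\<exists>x. bseq x \<and> nullseq (\<lambda>m. b m - restr {m..} (A (x m)))"
      by (intro exI[of _ "\<lambda>m. 0"]) (simp add: zbop_0[OF A] restr_simps nullseq_def)
  qed
next
  case (step j)
  show ?case
  proof (intro allI impI)
    fix b assume b: "bseq b" "\<forall>m. \<forall>i<j. b m i = 0"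
    let ?N = "act (fps_X^j)"
    let ?A = "\<lambda>m x. restr {m..} (A x)"
    obtain B where B: "B \<ge> 0" "\<And>m. nrm (b m) \<le> B" using bseq_bound[OF b(1)] by blast
    define D where "D = 2 * (2 * CN^(n-1-j) * (2^(n-1) * B))"
    have "\<exists>y\<in>W m. y 0 = b m j \<and> nrm y \<le> D" for m
    proof -
      obtain y where y: "y \<in> W m" "y 0 = b m j" "nrm y \<le> 2 * (2 * CN^(n-1-j) * (2^(n-1) * nrm (b m)))"
        using level_lift_W[OF bseqD(1)[OF b(1)] step(2), of m] b(2) by blast
      have "2 * (2 * CN^(n-1-j) * (2^(n-1) * nrm (b m))) \<le> D"
        unfolding D_def using B(2)[of m] CN_ge1 by (intro mult_left_mono) auto
      then show ?thesis using y by (intro bexI[of _ y]) auto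
    qed
    then obtain v where v: "\<And>m. v m \<in> W m" "\<And>m. v m 0 = b m j" "\<And>m. nrm (v m) \<le> D" by metis
    have bv: "bseq v" using v(1,3) by (rule bseqI)
    obtain X where X: "bseq X" "(\<lambda>m. tnorm (v m - ?A m (X m))) \<longlonglongrightarrow> 0" using top_level_solve_seq[OF bv] by blast
    have bAX: "bseq (\<lambda>m. ?A m (X m))" using A X(1) by (rule bseq_op)
    have br: "bseq (\<lambda>m. v m - ?A m (X m))" using bv bAX by (rule bseq_diff)
    have "\<exists>z\<in>W m. z 0 = (v m - ?A m (X m)) 0 \<and> nrm z \<le> 2 * tnorm (v m - ?A m (X m))" for m
      using lift_W[OF bseqD(1)[OF br]] .
    then obtain z where z: "\<And>m. z m \<in> W m" "\<And>m. z m 0 = (v m - ?A m (X m)) 0" "\<And>m. nrm (z m) \<le> 2 * tnorm (v m - ?A m (X m))" by metis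
    have zlim: "(\<lambda>m. 2 * tnorm (v m - ?A m (X m))) \<longlonglongrightarrow> 0" using X(2) by (rule tendsto_mult_right_zero)
    have zZ: "z m \<in> Z" for m using z(1) by (rule W_Z)
    have bz: "bseq z"
    proof -
      obtain E where "\<And>m. norm (2 * tnorm (v m - ?A m (X m))) \<le> E"
        using convergent_imp_Bseq[OF convergentI[OF zlim]] unfolding Bseq_def by blast
      then have "nrm (z m) \<le> E" for m using order_trans[OF z(3)[of m] abs_ge_self] order_trans by (metis real_norm_def)
      then show ?thesis using z(1) bseqI by blast
    qed
    have nz: "nullseq (\<lambda>m. ?N (z m))"
    proof (rule nullseqI)
      show "?N (z m) \<in> Z" for m using zZ by (rule Z_act)
      show "nrm (?N (z m)) \<le> CN^j * (2 * tnorm (v m - ?A m (X m)))" for m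
        by (rule order_trans[OF Z_shift(2)[OF zZ] mult_left_mono[OF z(3)]]) (use CN_ge1 in simp)
      show "(\<lambda>m. CN^j * (2 * tnorm (v m - ?A m (X m)))) \<longlonglongrightarrow> 0" using zlim by (rule tendsto_mult_right_zero)
    qed
    \<comment> \<open>Subtracting also the shifted lift \<open>z\<close> of the top residual makes
      level \<open>j\<close> vanish exactly and not merely in the limit, as the induction hypothesis
      demands.\<close>
    define b' where "b' m = b m - ?N (?A m (X m)) - ?N (z m)" for m
    have bb': "bseq b'" unfolding b'_def using b(1) bAX bz by (intro bseq_diff bseq_act)
    have "b' m i = 0" if "i < Suc j" for m i
    proof (rule ext)
      fix k
      show "b' m i k = 0 k"
      proof (cases "i < j")
        case True
        then show ?thesis using b(2) by (simp add: b'_def act_X_power zero_fun_apply)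
      next
        case False
        then have "i = j" using that by simp
        moreover have "z m 0 k = b m j k - ?A m (X m) 0 k" using z(2)[of m] v(2)[of m] by simp
        ultimately show ?thesis using step(2) by (simp add: b'_def act_X_power zero_fun_apply)
      qed
    qed
    then obtain x where x: "bseq x" "nullseq (\<lambda>m. b' m - ?A m (x m))" using step.IH bb' by blast
    have bNX: "bseq (\<lambda>m. ?N (X m))" using X(1) by (rule bseq_act)
    have "bseq (\<lambda>m. ?N (X m) + x m)" using bNX x(1) by (rule bseq_add)
    moreover have "b m - ?A m (?N (X m) + x m) = (b' m - ?A m (x m)) + ?N (z m) - (?A m (?N (X m)) - ?N (?A m (X m)))" for m
      unfolding b'_def zbopD(2)[OF A bseqD(2)[OF bNX] bseqD(2)[OF x(1)]] by (simp add: restr_simps algebra_simps)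
    moreover have "nullseq (\<lambda>m. (b' m - ?A m (x m)) + ?N (z m) - (?A m (?N (X m)) - ?N (?A m (X m))))"
      using x(2) nz nullseq_commutator[OF A X(1), of j] by (intro nullseq_diff[OF nullseq_add])
    ultimately show "\<exists>x. bseq x \<and> nullseq (\<lambda>m. b m - ?A m (x m))" by (intro exI[of _ "\<lambda>m. ?N (X m) + x m"]) simp
  qed
qed

text \<open>Back from sequences to uniform constants: if the claim failed with \<open>K\<close> and
  \<open>C\<close> both equal to \<open>m\<close>, for every \<open>m\<close>, the normalized
  counterexamples would form a bounded sequence, for which \<open>seq_solve\<close> gives bounded
  solutions with residuals tending to 0.\<close>

lemma approx_surjective:
  "\<exists>K C. \<forall>b\<in>W K. \<exists>x\<in>W K. nrm x \<le> C * nrm b \<and> nrm (b - restr {K..} (A x)) \<le> 1/2 * nrm b"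
proof (rule ccontr)
  assume "\<not> ?thesis"
  then have "\<exists>b\<in>W m. \<forall>x\<in>W m. \<not> (nrm x \<le> real m * nrm b \<and> nrm (b - restr {m..} (A x)) \<le> 1/2 * nrm b)" for m by blast
  then obtain b where b: "\<And>m. b m \<in> W m"
    "\<And>m x. x \<in> W m \<Longrightarrow> \<not> (nrm x \<le> real m * nrm (b m) \<and> nrm (b m - restr {m..} (A x)) \<le> 1/2 * nrm (b m))" by metis
  have bZ: "b m \<in> Z" for m using b(1) by (rule W_Z)
  have bp: "nrm (b m) > 0" for m
  proof (rule ccontr)
    assume "\<not> nrm (b m) > 0"
    then have "nrm (b m) = 0" using nrm_nonneg[OF bZ[of m]] by linarith
    then have "b m = 0" using nrm_eq_0[OF bZ] by blast
    then show False using b(2)[OF W_0, of m] by (simp add: zbop_0[OF A] restr_simps)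
  qed
  define d where "d m = zscale (of_real (1 / nrm (b m))) (b m)" for m
  have "bseq d"
  proof (rule bseqI)
    show "d m \<in> W m" for m unfolding d_def using b(1) by (rule W_scale)
    show "nrm (d m) \<le> 1" for m using bp[of m] by (simp add: d_def Z_scale[OF bZ] norm_divide)
  qed
  then obtain x where x: "bseq x" "nullseq (\<lambda>m. d m - restr {m..} (A (x m)))" using seq_solve[of 0] by auto
  obtain B where B: "\<And>m. nrm (x m) \<le> B" using bseq_bound[OF x(1)] by blast
  have "\<forall>\<^sub>F m in sequentially. nrm (d m - restr {m..} (A (x m))) < 1/2"
    using x(2) unfolding nullseq_def by (intro order_tendstoD(2)[where y=0]) auto
  then obtain m where m: "nrm (d m - restr {m..} (A (x m))) < 1/2" "m \<ge> nat \<lceil>B\<rceil>"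
    using eventually_happens'[OF sequentially_bot eventually_conj[OF _ eventually_ge_at_top]] by blast
  have mB: "B \<le> real m" using m(2) by linarith
  define y where "y = zscale (of_real (nrm (b m))) (x m)"
  have xZ: "x m \<in> Z" using bseqD(2)[OF x(1)] .
  have "y \<in> W m" unfolding y_def using bseqD(1)[OF x(1)] by (rule W_scale)
  moreover have "nrm y \<le> real m * nrm (b m)"
    using bp[of m] B[of m] mB by (simp add: y_def Z_scale[OF xZ] mult.commute mult_right_mono)
  moreover have "nrm (b m - restr {m..} (A y)) \<le> 1/2 * nrm (b m)"
  proof -
    have bd: "b m = zscale (of_real (nrm (b m))) (d m)" using bp[of m] by (simp add: d_def zscale_simps)
    have "b m - restr {m..} (A y) = zscale (of_real (nrm (b m))) (d m - restr {m..} (A (x m)))"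
      by (subst bd) (simp add: y_def zbopD(3)[OF A xZ] restr_simps zscale_simps)
    then have "nrm (b m - restr {m..} (A y)) = nrm (b m) * nrm (d m - restr {m..} (A (x m)))"
      using x(2) bp[of m] by (simp add: Z_scale nullseq_def)
    also have "\<dots> \<le> nrm (b m) * (1/2)" using m(1) bp[of m] by (intro mult_left_mono) auto
    finally show ?thesis by simp
  qed
  ultimately show False using b(2) by blast
qed

end

section \<open>The projection\<close>

context rochberg_index
begin

lemma form_zero: "x \<in> Z \<Longrightarrow> form 0 x = 0" "x \<in> Z \<Longrightarrow> form x 0 = 0"
  using form_scale_left[of 0 x 0] form_scale_right[of x 0 0] by (simp_all add: zscale_simps)

lemma geometric_nrm_eq_0: assumes "y \<in> Z" "\<And>m. nrm y \<le> c * (1/2)^m" shows "y = 0"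
proof -
  have "(\<lambda>m. c * (1/2::real)^m) \<longlonglongrightarrow> c * 0" by (intro tendsto_intros LIMSEQ_power_zero) simp
  then have "nrm y \<le> c * 0" by (rule LIMSEQ_le_const) (use assms(2) in blast)
  then show ?thesis using nrm_eq_0[OF assms(1)] nrm_nonneg[OF assms(1)] by simp
qed

end

context rochberg_embedding
begin

text \<open>Approximate solutions are applied repeatedly to the residual, which is halved each time,
  and the corrections are summed.\<close>

lemma surjective: "\<exists>K C. C \<ge> 0 \<and> (\<forall>b\<in>W K. \<exists>x\<in>W K. nrm x \<le> C * nrm b \<and> restr {K..} (A x) = b)"
proof -
  obtain K C0 where KC0: "\<And>b. b \<in> W K \<Longrightarrow> \<exists>x\<in>W K. nrm x \<le> C0 * nrm b \<and> nrm (b - restr {K..} (A x)) \<le> 1/2 * nrm b"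
    using approx_surjective by blast
  define C where "C = max 0 C0"
  have C: "C \<ge> 0" by (simp add: C_def)
  have "\<exists>x\<in>W K. nrm x \<le> C * nrm b \<and> nrm (b - restr {K..} (A x)) \<le> 1/2 * nrm b" if b: "b \<in> W K" for b
  proof -
    have "C0 * nrm b \<le> C * nrm b" using nrm_nonneg[OF W_Z[OF b]] by (intro mult_right_mono) (auto simp: C_def)
    then show ?thesis using KC0[OF b] order_trans by blast
  qed
  then obtain g where g: "\<And>b. b \<in> W K \<Longrightarrow> g b \<in> W K" "\<And>b. b \<in> W K \<Longrightarrow> nrm (g b) \<le> C * nrm b"
    "\<And>b. b \<in> W K \<Longrightarrow> nrm (b - restr {K..} (A (g b))) \<le> 1/2 * nrm b" by metis
  define AK where "AK = (\<lambda>x. restr {K..} (A x))"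
  have AK: "zbop AK" unfolding AK_def using zbop_restr A by (rule zbop_comp)
  obtain CA where CA: "CA \<ge> 0" "\<And>x. x \<in> Z \<Longrightarrow> nrm (AK x) \<le> CA * nrm x" using zbop_bound[OF AK] by blast
  have "\<exists>x\<in>W K. nrm x \<le> CD * (2^(n-1) * (2 * C)) * nrm b \<and> AK x = b" if b: "b \<in> W K" for b
  proof -
    have bZ: "b \<in> Z" using b by (rule W_Z)
    define r where "r i = ((\<lambda>b. b - AK (g b)) ^^ i) b" for i
    have rS: "r (Suc i) = r i - AK (g (r i))" for i by (simp add: r_def)
    have rW: "r i \<in> W K" for i
    proof (induction i)
      case 0 then show ?case using b by (simp add: r_def)
    next
      case (Suc i)
      have "AK (g (r i)) \<in> W K" unfolding AK_def using restr_W[OF zbopD(1)[OF A W_Z[OF g(1)[OF Suc]]]] .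
      then show ?case unfolding rS using Suc W_diff by blast
    qed
    have rn: "nrm (r i) \<le> nrm b * (1/2)^i" for i
    proof (induction i)
      case 0 then show ?case by (simp add: r_def)
    next
      case (Suc i)
      have "nrm (r (Suc i)) \<le> 1/2 * nrm (r i)" unfolding rS AK_def using g(3)[OF rW] .
      then show ?case using Suc by simp
    qed
    define x where "x i = g (r i)" for i
    have xW: "x i \<in> W K" for i unfolding x_def using g(1)[OF rW] .
    have xZ: "x i \<in> Z" for i using xW by (rule W_Z)
    have xn: "nrm (x i) \<le> C * nrm b * (1/2)^i" for i
      using g(2)[OF rW[of i]] mult_left_mono[OF rn[of i] C] by (simp add: x_def)
    have "C * nrm b \<ge> 0" using C nrm_nonneg[OF bZ] by simp
    from series_converges[OF xZ xn this] obtain s where s: "s \<in> Z"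
      "\<And>m. nrm (s - (\<Sum>i<m. x i)) \<le> CD * (2^(n-1) * (2 * (C * nrm b))) * (1/2)^m" by blast
    define c where "c = CD * (2^(n-1) * (2 * (C * nrm b)))"
    have P: "(\<Sum>i<m. x i) \<in> Z" for m using xZ by (intro Z_sum_mem)
    have dZ: "s - (\<Sum>i<m. x i) \<in> Z" for m using s(1) P by (rule Z_diff)
    have sn: "nrm (s - (\<Sum>i<m. x i)) \<le> c * (1/2)^m" for m using s(2) by (simp add: c_def)
    have PW: "restr {K..} (\<Sum>i<m. x i) = (\<Sum>i<m. x i)" for m
    proof -
      have "restr {K..} (x i) = x i" for i using xW[of i] by (simp add: W_def)
      then show ?thesis using zbop_sum[OF zbop_restr, of "{..<m}" x "{K..}"] xZ by simp
    qed
    have "s - restr {K..} s = 0"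
    proof (rule geometric_nrm_eq_0)
      show "s - restr {K..} s \<in> Z" using s(1) Z_restr Z_diff by blast
      fix m
      let ?d = "s - (\<Sum>i<m. x i)"
      have "s - restr {K..} s = ?d - restr {K..} ?d" by (simp add: restr_simps PW)
      then have "nrm (s - restr {K..} s) \<le> nrm ?d + nrm (restr {K..} ?d)"
        using Z_diff(2)[OF dZ Z_restr(1)[OF dZ], of m "{K..}" m] by (simp only:)
      also have "\<dots> \<le> 2 * c * (1/2)^m" using sn[of m] Z_restr(2)[OF dZ, of "{K..}" m] by simp
      finally show "nrm (s - restr {K..} s) \<le> 2 * c * (1/2)^m" .
    qed
    then have sW: "s \<in> W K" using s(1) by (simp add: W_def)
    have AP: "AK (\<Sum>i<m. x i) = b - r m" for m
    proof -
      have "AK (\<Sum>i<m. x i) = (\<Sum>i<m. AK (x i))" using xZ by (intro zbop_sum[OF AK])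
      also have "\<dots> = (\<Sum>i<m. r i - r (Suc i))" by (simp add: rS x_def)
      also have "\<dots> = r 0 - r m" by (rule sum_lessThan_telescope')
      also have "r 0 = b" by (simp add: r_def)
      finally show ?thesis .
    qed
    have "b - AK s = 0"
    proof (rule geometric_nrm_eq_0)
      show "b - AK s \<in> Z" using bZ zbopD(1)[OF AK s(1)] by (rule Z_diff)
      fix m
      let ?d = "s - (\<Sum>i<m. x i)"
      have "b - AK s = r m - AK ?d" using zbop_diff[OF AK s(1) P, of m] AP[of m] by simp
      then have "nrm (b - AK s) \<le> nrm (r m) + nrm (AK ?d)"
        using Z_diff(2)[OF W_Z[OF rW] zbopD(1)[OF AK dZ], of m m] by (simp only:)
      also have "\<dots> \<le> nrm b * (1/2)^m + CA * (c * (1/2)^m)"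
        using rn[of m] CA(2)[OF dZ[of m]] mult_left_mono[OF sn[of m] CA(1)] by linarith
      finally show "nrm (b - AK s) \<le> (nrm b + CA * c) * (1/2)^m" by (simp add: algebra_simps)
    qed
    then have "AK s = b" by simp
    moreover have "nrm s \<le> CD * (2^(n-1) * (2 * C)) * nrm b" using sn[of 0] by (simp add: c_def algebra_simps)
    ultimately show ?thesis using sW by blast
  qed
  then show ?thesis using C CD_ge1 unfolding AK_def
    by (intro exI[of _ K] exI[of _ "CD * (2^(n-1) * (2 * C))"]) simp
qed

text \<open>As the pairing is symmetric up to sign and conjugation, the kernel of the compression is
  orthogonal to its range. The range is all of \<open>W K\<close>, and vectors supported below
  \<open>K\<close> are orthogonal to \<open>x\<close> anyway, so nondegeneracy applies.\<close>

lemma injective: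
  assumes sur: "\<And>b. b \<in> W K \<Longrightarrow> \<exists>x\<in>W K. restr {K..} (A x) = b" and x: "x \<in> W K" "restr {K..} (A x) = 0"
  shows "x = 0"
proof (rule form_nondegenerate)
  have xr: "restr {K..} x = x" using x(1) by (simp add: W_def)
  show xZ: "x \<in> Z" using x(1) by (rule W_Z)
  have TZ: "T x \<in> Z" using zbopD(1)[OF T xZ] .
  fix y assume y: "y \<in> Z"
  obtain u where u: "u \<in> W K" "restr {K..} (A u) = restr {K..} y" using sur[OF restr_W[OF y]] by blast
  have uZ: "u \<in> Z" and ur: "restr {K..} u = u" using u(1) by (auto simp: W_def)
  have TuZ: "T u \<in> Z" using zbopD(1)[OF T uZ] .
  have "form (T x) (T u) = form (A x) u" using form_A[OF xZ uZ] by simp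
  also have "\<dots> = form (restr {K..} (A x)) u" using ur by (simp add: form_restr)
  also have "\<dots> = 0" unfolding x(2) using uZ by (rule form_zero)
  finally have 0: "form (T u) (T x) = 0" using form_sym[OF TZ TuZ] by simp
  have "form y x = form (restr {K..} y) x" using xr by (simp add: form_restr)
  also have "\<dots> = form (A u) x" unfolding u(2)[symmetric] using xr by (simp add: form_restr)
  also have "\<dots> = 0" using form_A[OF uZ xZ] 0 by simp
  finally show "form x y = 0" using form_sym[OF y xZ] by simp
qed

text \<open>The operator sought is \<open>T L\<close>, where \<open>L\<close> inverts the
  compression of \<open>A\<close> after the compressed adjoint, so that \<open>L (T w) = w\<close>
  on \<open>W K\<close>. Linearity of \<open>L\<close> comes from \<open>injective\<close>, its
  boundedness from the constant in \<open>surjective\<close>.\<close>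

lemma tail_projection:
  "\<exists>K P. zbop P \<and> (\<forall>z\<in>Z. P z \<in> T ` Z) \<and> (\<forall>w\<in>W K. P (T w) = T w)"
proof -
  obtain K C where C: "C \<ge> 0" and sur: "\<And>b. b \<in> W K \<Longrightarrow> \<exists>x\<in>W K. nrm x \<le> C * nrm b \<and> restr {K..} (A x) = b"
    using surjective by blast
  have R: "zbop (\<lambda>z. restr {K..} (T' z))" using zbop_restr T' by (rule zbop_comp)
  have AK: "zbop (\<lambda>x. restr {K..} (A x))" using zbop_restr A by (rule zbop_comp)
  have "\<exists>x\<in>W K. nrm x \<le> C * nrm (restr {K..} (T' z)) \<and> restr {K..} (A x) = restr {K..} (T' z)" if "z \<in> Z" for z
    using sur[OF restr_W[OF zbopD(1)[OF T' that]]] .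
  then obtain L where L: "\<And>z. z \<in> Z \<Longrightarrow> L z \<in> W K" "\<And>z. z \<in> Z \<Longrightarrow> nrm (L z) \<le> C * nrm (restr {K..} (T' z))"
    "\<And>z. z \<in> Z \<Longrightarrow> restr {K..} (A (L z)) = restr {K..} (T' z)" by metis
  have LZ: "L z \<in> Z" if "z \<in> Z" for z using L(1)[OF that] by (rule W_Z)
  have uniq: "x = y" if "x \<in> W K" "y \<in> W K" "restr {K..} (A x) = restr {K..} (A y)" for x y
  proof -
    have "restr {K..} (A (x - y)) = 0" using zbop_diff[OF AK W_Z[OF that(1)] W_Z[OF that(2)]] that(3) by simp
    then have "x - y = 0" using injective[of K "x - y"] sur W_diff[OF that(1,2)] by blast
    then show ?thesis by simp
  qed
  obtain CR where CR: "CR \<ge> 0" "\<And>x. x \<in> Z \<Longrightarrow> nrm (restr {K..} (T' x)) \<le> CR * nrm x" using zbop_bound[OF R] by blast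
  have "zbop L" unfolding zbop_def
  proof (intro conjI ballI allI)
    show "L x \<in> Z" if "x \<in> Z" for x using LZ[OF that] .
    show "L (x + y) = L x + L y" if "x \<in> Z" "y \<in> Z" for x y
    proof (rule uniq)
      show "L (x + y) \<in> W K" using that Z_add L(1) by blast
      show "L x + L y \<in> W K" using that L(1) W_add by blast
      show "restr {K..} (A (L (x + y))) = restr {K..} (A (L x + L y))"
        using zbopD(2)[OF AK LZ LZ] zbopD(2)[OF R] L(3) that Z_add(1) by simp
    qed
    show "L (zscale c x) = zscale c (L x)" if "x \<in> Z" for x c
    proof (rule uniq)
      show "L (zscale c x) \<in> W K" using that Z_scale L(1) by blast
      show "zscale c (L x) \<in> W K" using that L(1) W_scale by blast
      show "restr {K..} (A (L (zscale c x))) = restr {K..} (A (zscale c (L x)))"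
        using zbopD(3)[OF AK LZ] zbopD(3)[OF R] L(3) that Z_scale(1) by simp
    qed
    have "nrm (L x) \<le> (C * CR) * nrm x" if "x \<in> Z" for x
      using L(2)[OF that] mult_left_mono[OF CR(2)[OF that] C] by simp
    then show "\<exists>C\<ge>0. \<forall>x\<in>Z. nrm (L x) \<le> C * nrm x" using C CR(1) by (intro exI[of _ "C * CR"]) simp
  qed
  then have "zbop (\<lambda>z. T (L z))" by (rule zbop_comp[OF T])
  moreover have "\<forall>z\<in>Z. T (L z) \<in> T ` Z" using LZ by blast
  moreover have "T (L (T w)) = T w" if w: "w \<in> W K" for w
  proof -
    have TwZ: "T w \<in> Z" using zbopD(1)[OF T W_Z[OF w]] .
    have "restr {K..} (A (L (T w))) = restr {K..} (A w)" using L(3)[OF TwZ] by (simp add: A_def)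
    then have "L (T w) = w" by (rule uniq[OF L(1)[OF TwZ] w])
    then show ?thesis by simp
  qed
  ultimately show ?thesis by blast
qed

text \<open>A vector \<open>y\<close> is added to the range of \<open>P\<close> with the help of a coordinate functional that does not vanish at \<open>y - P y\<close>.\<close>
lemma extend_projection:
  assumes P: "zbop P" "\<And>z. z \<in> Z \<Longrightarrow> P z \<in> T ` Z" and e: "e \<in> Z"
  shows "\<exists>P'. zbop P' \<and> (\<forall>z\<in>Z. P' z \<in> T ` Z) \<and> P' (T e) = T e \<and> (\<forall>w\<in>Z. P w = w \<longrightarrow> P' w = w)"
proof (cases "P (T e) = T e")
  case True
  then show ?thesis using P by blast
next
  case False
  define v where "v = T e - P (T e)"
  have TeZ: "T e \<in> Z" using zbopD(1)[OF T e] .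
  have vZ: "v \<in> Z" unfolding v_def using TeZ zbopD(1)[OF P(1) TeZ] by (rule Z_diff)
  obtain a where a: "a \<in> Z" "P (T e) = T a" using P(2)[OF TeZ] by blast
  have va: "v = T (e - a)" unfolding v_def a(2) using zbop_diff[OF T e a(1)] by simp
  have "v \<noteq> 0" using False by (simp add: v_def)
  then obtain i l where il: "v i l \<noteq> 0" by (auto simp: fun_eq_iff zero_fun_apply)
  \<comment> \<open>This functional is 1 at \<open>T e\<close> and 0 at every vector fixed by
    \<open>P\<close>.\<close>
  define \<phi> where "\<phi> z = (z - P z) i l / v i l" for z
  define P' where "P' z = P z + zscale (\<phi> z) v" for z
  obtain CP where CP: "CP \<ge> 0" "\<And>x. x \<in> Z \<Longrightarrow> nrm (P x) \<le> CP * nrm x" using zbop_bound[OF P(1)] by blast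
  have PZ: "P z \<in> Z" if "z \<in> Z" for z using zbopD(1)[OF P(1) that] .
  have \<phi>b: "cmod (\<phi> z) \<le> (2^n * (1 + CP) / cmod (v i l)) * nrm z" if z: "z \<in> Z" for z
  proof -
    have "cmod ((z - P z) i l) \<le> 2^n * nrm (z - P z)" using Z_coord[OF Z_diff(1)[OF z PZ[OF z]]] .
    also have "\<dots> \<le> 2^n * ((1 + CP) * nrm z)"
      using Z_diff(2)[OF z PZ[OF z]] CP(2)[OF z] by (intro mult_left_mono) (auto simp: algebra_simps)
    finally show ?thesis using il by (simp add: \<phi>_def norm_divide divide_right_mono field_simps)
  qed
  have "zbop P'" unfolding zbop_def
  proof (intro conjI ballI allI)
    show "P' x \<in> Z" if "x \<in> Z" for x unfolding P'_def using PZ[OF that] Z_scale(1)[OF vZ] by (rule Z_add)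
    show "P' (x + y) = P' x + P' y" if "x \<in> Z" "y \<in> Z" for x y
    proof -
      have "\<phi> (x + y) = \<phi> x + \<phi> y"
        by (simp add: \<phi>_def zbopD(2)[OF P(1) that] plus_fun_apply add_divide_distrib diff_divide_distrib)
      then show ?thesis unfolding P'_def zbopD(2)[OF P(1) that] by (simp add: zscale_simps)
    qed
    show "P' (zscale c x) = zscale c (P' x)" if "x \<in> Z" for x c
    proof -
      have "\<phi> (zscale c x) = c * \<phi> x"
        by (simp add: \<phi>_def zbopD(3)[OF P(1) that] zscale_apply right_diff_distrib)
      then show ?thesis unfolding P'_def zbopD(3)[OF P(1) that] by (simp add: zscale_simps)
    qed
    define M where "M = CP + (2^n * (1 + CP) / cmod (v i l)) * nrm v"
    have "nrm (P' x) \<le> M * nrm x" if x: "x \<in> Z" for x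
    proof -
      have "nrm (P' x) \<le> nrm (P x) + cmod (\<phi> x) * nrm v"
        unfolding P'_def using Z_add(2)[OF PZ[OF x] Z_scale(1)[OF vZ, of "\<phi> x"]] by (simp add: Z_scale(2)[OF vZ])
      also have "\<dots> \<le> CP * nrm x + (2^n * (1 + CP) / cmod (v i l)) * nrm x * nrm v"
        using CP(2)[OF x] mult_right_mono[OF \<phi>b[OF x] nrm_nonneg[OF vZ]] by (rule add_mono)
      also have "\<dots> = M * nrm x" by (simp add: M_def algebra_simps)
      finally show ?thesis .
    qed
    moreover have "M \<ge> 0" using CP(1) nrm_nonneg[OF vZ] by (simp add: M_def)
    ultimately show "\<exists>C\<ge>0. \<forall>x\<in>Z. nrm (P' x) \<le> C * nrm x" by blast
  qed
  moreover have "P' z \<in> T ` Z" if "z \<in> Z" for z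
  proof -
    obtain u where u: "u \<in> Z" "P z = T u" using P(2)[OF \<open>z \<in> Z\<close>] by blast
    have m: "e - a \<in> Z" using e a(1) by (rule Z_diff)
    have "P' z = T (u + zscale (\<phi> z) (e - a))"
      unfolding P'_def u(2) va using zbopD(2)[OF T u(1) Z_scale(1)[OF m]] zbopD(3)[OF T m] by simp
    then show ?thesis using u(1) Z_scale(1)[OF m] Z_add(1) by blast
  qed
  moreover have "P' (T e) = T e"
  proof -
    have "\<phi> (T e) = 1" using il by (simp add: \<phi>_def v_def)
    then show ?thesis by (simp add: P'_def zscale_simps) (simp add: v_def)
  qed
  moreover have "P' w = w" if "P w = w" for w
    using that by (simp add: P'_def \<phi>_def zscale_simps zero_fun_apply)
  ultimately show ?thesis by blast
qed

text \<open>\<open>W K\<close> and the finitely many unit vectors below \<open>K\<close> span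
  \<open>Z\<close>, so it suffices to adjoin the images of these unit vectors;
  \<open>extend_projection\<close> never spoils a vector that is already fixed.\<close>

lemma projection_onto_range:
  "\<exists>P. zbop P \<and> (\<forall>z\<in>Z. P z \<in> T ` Z) \<and> (\<forall>w\<in>Z. P (T w) = T w)"
proof -
  obtain K P0 where P0: "zbop P0" "\<forall>z\<in>Z. P0 z \<in> T ` Z" "\<forall>w\<in>W K. P0 (T w) = T w"
    using tail_projection by blast
  have "\<exists>P. zbop P \<and> (\<forall>z\<in>Z. P z \<in> T ` Z) \<and> (\<forall>w\<in>W K. P (T w) = T w) \<and> (\<forall>p\<in>F. P (T (unitv (fst p) (snd p))) = T (unitv (fst p) (snd p)))"
    if "finite F" "F \<subseteq> {..<n} \<times> {..<K}" for F
    using that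
  proof (induction F rule: finite_induct)
    case empty
    then show ?case using P0 by blast
  next
    case (insert p F)
    then obtain P where P: "zbop P" "\<forall>z\<in>Z. P z \<in> T ` Z" "\<forall>w\<in>W K. P (T w) = T w"
      "\<forall>p\<in>F. P (T (unitv (fst p) (snd p))) = T (unitv (fst p) (snd p))" by auto
    have U: "unitv (fst q) (snd q) \<in> Z" if "q \<in> insert p F" for q
      using insert.prems that by (intro unitv_Z) auto
    obtain P' where P': "zbop P'" "\<forall>z\<in>Z. P' z \<in> T ` Z" "P' (T (unitv (fst p) (snd p))) = T (unitv (fst p) (snd p))"
      "\<forall>w\<in>Z. P w = w \<longrightarrow> P' w = w" using extend_projection[OF P(1) _ U[of p]] P(2) by blast
    have "\<forall>w\<in>W K. P' (T w) = T w" using P'(4) P(3) zbopD(1)[OF T] W_Z by blast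
    moreover have "\<forall>q\<in>insert p F. P' (T (unitv (fst q) (snd q))) = T (unitv (fst q) (snd q))"
      using P'(3,4) P(4) zbopD(1)[OF T U] by blast
    ultimately show ?case using P'(1,2) by blast
  qed
  from this[OF _ order_refl] obtain P where P: "zbop P" "\<forall>z\<in>Z. P z \<in> T ` Z" "\<And>w. w \<in> W K \<Longrightarrow> P (T w) = T w"
    "\<And>j k. j < n \<Longrightarrow> k < K \<Longrightarrow> P (T (unitv j k)) = T (unitv j k)" by auto
  have PT: "zbop (\<lambda>w. P (T w))" using P(1) T by (rule zbop_comp)
  have "P (T w) = T w" if w: "w \<in> Z" for w
  proof -
    let ?y = "restr {..<K} w"
    let ?e = "\<lambda>k j. zscale (?y j k) (unitv j k)"
    have yZ: "?y \<in> Z" and zZ: "restr {K..} w \<in> Z" using w Z_restr by auto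
    have mem: "?e k j \<in> Z" if "j < n" for j k using that unitv_Z Z_scale by blast
    have mem2: "(\<Sum>j<n. ?e k j) \<in> Z" for k using mem by (intro Z_sum_mem) simp
    have expand: "?y = (\<Sum>k<K. \<Sum>j<n. ?e k j)"
      by (rule finsupp_expand[OF Z_jets[OF yZ]]) (simp add: restr_simps)
    have S: "S ?y = (\<Sum>k<K. \<Sum>j<n. S (?e k j))" if "zbop S" for S
    proof -
      have "S ?y = S (\<Sum>k<K. \<Sum>j<n. ?e k j)" by (rule arg_cong[OF expand])
      also have "\<dots> = (\<Sum>k<K. S (\<Sum>j<n. ?e k j))" using mem2 by (rule zbop_sum[OF that])
      also have "\<dots> = (\<Sum>k<K. \<Sum>j<n. S (?e k j))"
        using mem by (intro sum.cong[OF refl] zbop_sum[OF that]) simp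
      finally show ?thesis .
    qed
    have "P (T (?e k j)) = T (?e k j)" if "j < n" "k < K" for j k
      using P(4)[OF that] zbopD(3)[OF PT unitv_Z[OF that(1)]] zbopD(3)[OF T unitv_Z[OF that(1)]] by simp
    then have "(\<Sum>k<K. \<Sum>j<n. P (T (?e k j))) = (\<Sum>k<K. \<Sum>j<n. T (?e k j))" by (intro sum.cong refl) simp
    then have "P (T ?y) = T ?y" using S[OF PT] S[OF T] by (simp only:)
    moreover have "P (T (restr {K..} w)) = T (restr {K..} w)" using P(3)[OF restr_W[OF w]] .
    moreover have "P (T (?y + restr {K..} w)) = P (T ?y) + P (T (restr {K..} w))" using zbopD(2)[OF PT yZ zZ] .
    moreover have "T (?y + restr {K..} w) = T ?y + T (restr {K..} w)" using zbopD(2)[OF T yZ zZ] .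
    ultimately show ?thesis using restr_split[of w K] by simp
  qed
  then show ?thesis using P(1,2) by blast
qed

end

theorem theorem6p1:
  fixes n :: nat and Y :: "(nat \<Rightarrow> nat \<Rightarrow> complex) set"
  assumes "n \<ge> 1"
    and "closed_subspace_Z n Y"
    and "isomorphic_to_Z n Y"
  shows "complemented_in_Z n Y"
proof -
  interpret rochberg_index n using assms(1) by unfold_locales
  \<comment> \<open>The equivalence constant between \<open>nrm\<close> and \<open>zn_norm\<close>,
    through which all bounds are converted.\<close>
  define M where "M = CD * 2^(n-1)"
  have M: "M > 0" using CD_ge1 by (simp add: M_def)
  have lo: "nrm x \<le> zn_norm n x" and hi: "zn_norm n x \<le> M * nrm x" if "x \<in> Z" for x
    using zn_norm_bounds[OF that] by (simp_all add: M_def)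
  have YZ: "Y \<subseteq> Z" using assms(2) by (simp add: closed_subspace_Z_def rochberg_eq)
  obtain T c C where lin: "zlinear n T" and range: "T ` Z = Y" and c: "0 < c" "\<And>x. x \<in> Z \<Longrightarrow> c * zn_norm n x \<le> zn_norm n (T x)"
    "\<And>x. x \<in> Z \<Longrightarrow> zn_norm n (T x) \<le> C * zn_norm n x"
    using assms(3) unfolding isomorphic_to_Z_def rochberg_eq by blast
  have TZ: "T x \<in> Z" if "x \<in> Z" for x using range YZ that by blast
  have zT: "zbop T" unfolding zbop_def
  proof (intro conjI ballI allI)
    show "T x \<in> Z" if "x \<in> Z" for x using TZ[OF that] .
    show "T (x + y) = T x + T y" if "x \<in> Z" "y \<in> Z" for x y
      using lin that by (simp add: zlinear_def rochberg_eq zadd_plus)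
    show "T (zscale c x) = zscale c (T x)" if "x \<in> Z" for x c
      using lin that by (simp add: zlinear_def rochberg_eq)
    have "nrm (T x) \<le> (\<bar>C\<bar> * M) * nrm x" if x: "x \<in> Z" for x
    proof -
      have "nrm (T x) \<le> C * zn_norm n x" using lo[OF TZ[OF x]] c(3)[OF x] by linarith
      also have "\<dots> \<le> \<bar>C\<bar> * zn_norm n x" using lo[OF x] nrm_nonneg[OF x] by (intro mult_right_mono) auto
      also have "\<dots> \<le> \<bar>C\<bar> * (M * nrm x)" using hi[OF x] by (intro mult_left_mono) auto
      finally show ?thesis by simp
    qed
    then show "\<exists>C\<ge>0. \<forall>x\<in>Z. nrm (T x) \<le> C * nrm x" using M by (intro exI[of _ "\<bar>C\<bar> * M"]) simp
  qed
  obtain T' where T': "zbop T'" "\<And>x y. x \<in> Z \<Longrightarrow> y \<in> Z \<Longrightarrow> form (T' x) y = form x (T y)"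
    using adjoint_ex[OF zT] by blast
  interpret rochberg_embedding n T T' "c / M"
  proof unfold_locales
    show "c / M > 0" using c(1) M by simp
    show "c / M * nrm x \<le> nrm (T x)" if x: "x \<in> Z" for x
    proof -
      have "c * nrm x \<le> c * zn_norm n x" using lo[OF x] c(1) by (intro mult_left_mono) auto
      also have "\<dots> \<le> zn_norm n (T x)" by (rule c(2)[OF x])
      also have "\<dots> \<le> M * nrm (T x)" by (rule hi[OF TZ[OF x]])
      finally show ?thesis using M by (simp add: field_simps)
    qed
  qed (use zT T' in auto)
  obtain P where P: "zbop P" "\<forall>z\<in>Z. P z \<in> T ` Z" "\<forall>w\<in>Z. P (T w) = T w" using projection_onto_range by blast
  obtain D where D: "D \<ge> 0" "\<And>x. x \<in> Z \<Longrightarrow> nrm (P x) \<le> D * nrm x" using zbop_bound[OF P(1)] by blast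
  have "zlinear n P" using zbopD[OF P(1)] by (simp add: zlinear_def rochberg_eq zadd_plus)
  moreover have "P ` rochberg n \<subseteq> Y" using P(2) range by (auto simp: rochberg_eq)
  moreover have "\<forall>y\<in>Y. P y = y" using P(3) range by blast
  moreover have "zn_norm n (P x) \<le> (M * D) * zn_norm n x" if x: "x \<in> Z" for x
  proof -
    have "zn_norm n (P x) \<le> M * nrm (P x)" by (rule hi[OF zbopD(1)[OF P(1) x]])
    also have "\<dots> \<le> M * (D * nrm x)" using D(2)[OF x] M by (intro mult_left_mono) auto
    also have "\<dots> \<le> M * (D * zn_norm n x)" using lo[OF x] M D(1) by (intro mult_left_mono) auto
    finally show ?thesis by simp
  qed
  ultimately show ?thesis unfolding complemented_in_Z_def rochberg_eq by blast
qed

end
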